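(* Let $m, n \in \mathbb{N}$ (positive integers) be such that $m \geq 3$, $n \mid m$ and $(m,n) \neq (3,1)$. Let $G := \mathbb{Z}/m\mathbb{Z} \times \mathbb{Z}/n\mathbb{Z}$ and let $\pi : F_2 \rightarrow G$ be an epimorphism. Then $$\Gamma^+(G,\pi)^{\mathrm{ab}} \cong G \times \mathbb{Z}^{\,r}, \qquad r = 1 + \frac{n m^2}{12} \prod_{p \mid m} \left(1 - p^{-2}\right),$$ where the product runs over all primes $p$ dividing $m$. Furthermore, for every epimorphism $\pi$ from $F_2$ onto the respective finite group, \begin{align*} \Gamma^+(\mathbb{Z}/2\mathbb{Z},\pi)^{\mathrm{ab}} &\cong \mathbb{Z}/2\mathbb{Z} \times \mathbb{Z}/4\mathbb{Z} \times \mathbb{Z},\\ \Gamma^+(\mathbb{Z}/3\mathbb{Z},\pi)^{\mathrm{ab}} &\cong \mathbb{Z}/3\mathbb{Z} \times \mathbb{Z}/3\mathbb{Z} \times \mathbb{Z},\\ \Gamma^+(\mathbb{Z}/2\mathbb{Z} \times \mathbb{Z}/2\mathbb{Z},\pi)^{\mathrm{ab}} &\cong \mathbb{Z}/2\mathbb{Z} \times \mathbb{Z}/2\mathbb{Z} \times \mathbb{Z}/2\mathbb{Z} \times \mathbb{Z}^2. \end{align*}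
   Context: $F_2$ is the free group of rank $2$ and $F_2'$ its commutator subgroup. Let $\rho : \mathrm{Aut}(F_2) \rightarrow \mathrm{Aut}(F_2/F_2') \cong \mathrm{GL}_2(\mathbb{Z})$ be the natural homomorphism, and let $\mathrm{Aut}^+(F_2) := \rho^{-1}(\mathrm{SL}_2(\mathbb{Z}))$ be the special automorphism group. For an epimorphism $\pi : F_2 \rightarrow G$ onto a finite group $G$, set $$\Gamma^+(G,\pi) := \{ \varphi \in \mathrm{Aut}^+(F_2) \mid \pi \circ \varphi = \pi \}.$$ For a group $H$, $H^{\mathrm{ab}} = H/[H,H]$ denotes its abelianization. *)

theory Defs
  imports
    "HOL-Analysis.Determinants"
    "HOL-Algebra.Bij"
    "HOL-Algebra.Elementary_Groups"
    "HOL-Algebra.Generated_Groups"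
    "HOL-Algebra.Product_Groups"
    "HOL-Computational_Algebra.Primes"
begin

section \<open>Free groups\<close>

text \<open>
  The free group on the set of all elements of a type, realised by reduced words. The letter
  \<open>(x, True)\<close> is the generator \<open>x\<close>, and \<open>(x, False)\<close> is its inverse.
\<close>

type_synonym 'a word = "('a \<times> bool) list"

definition flip :: "'a \<times> bool \<Rightarrow> 'a \<times> bool"
  where "flip l = (fst l, \<not> snd l)"

definition reduced :: "'a word \<Rightarrow> bool"
  where "reduced w \<longleftrightarrow> successively (\<lambda>k l. l \<noteq> flip k) w"

fun push :: "'a \<times> bool \<Rightarrow> 'a word \<Rightarrow> 'a word"
  where
    "push k [] = [k]"
  | "push k (l # w) = (if l = flip k then w else k # l # w)"

definition free_group :: "'a word monoid"
  where "free_group = \<lparr>carrier = {w. reduced w}, monoid.mult = foldr push, one = []\<rparr>"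

lemma flip_flip [simp]: "flip (flip l) = l"
  by (simp add: flip_def)

lemma flip_neq [simp]: "flip l \<noteq> l" "l \<noteq> flip l"
  by (auto simp: flip_def prod_eq_iff)

lemma reduced_Nil [simp]: "reduced []"
  by (simp add: reduced_def)

lemma reduced_singleton [simp]: "reduced [l]"
  by (simp add: reduced_def)

lemma reduced_Cons: "reduced (k # w) \<longleftrightarrow> reduced w \<and> (w = [] \<or> hd w \<noteq> flip k)"
  by (cases w) (auto simp: reduced_def)

lemma reduced_push: "reduced w \<Longrightarrow> reduced (push k w)"
  by (cases w) (auto simp: reduced_Cons)

lemma push_reduced: "reduced (k # w) \<Longrightarrow> push k w = k # w"
  by (cases w) (auto simp: reduced_Cons)

lemma push_flip: "reduced w \<Longrightarrow> push k (push (flip k) w) = w"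
  by (cases w) (auto simp: push_reduced)

lemma reduced_foldr_push: "reduced w \<Longrightarrow> reduced (foldr push u w)"
  by (induction u) (auto simp: reduced_push)

lemma foldr_push_Nil: "reduced u \<Longrightarrow> foldr push u [] = u"
  by (induction u) (auto simp: push_reduced reduced_Cons)

lemma foldr_push_push:
  assumes "reduced w"
  shows "foldr push (push k u) w = push k (foldr push u w)"
  using assms by (cases u) (auto simp: push_flip reduced_foldr_push)

lemma foldr_push_assoc:
  assumes "reduced w"
  shows "foldr push (foldr push u v) w = foldr push u (foldr push v w)"
  using assms by (induction u) (auto simp: foldr_push_push)

lemma reduced_inverse: "reduced u \<Longrightarrow> reduced (rev (map flip u))"
  unfolding reduced_def successively_rev successively_map
  by (erule successively_mono) (metis flip_flip)

lemma foldr_push_inverse: "foldr push (rev (map flip u)) u = []"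
  by (induction u) auto

lemma group_free_group: "group free_group"
proof (rule groupI)
  fix u assume "u \<in> carrier free_group"
  then show "\<exists>v\<in>carrier free_group. v \<otimes>\<^bsub>free_group\<^esub> u = \<one>\<^bsub>free_group\<^esub>"
    by (intro bexI [of _ "rev (map flip u)"])
       (auto simp: free_group_def reduced_inverse foldr_push_inverse)
qed (auto simp: free_group_def reduced_foldr_push foldr_push_assoc)

definition gen :: "'a \<Rightarrow> 'a word"
  where "gen x = [(x, True)]"

lemma gen_closed [simp]: "gen x \<in> carrier free_group"
  by (simp add: gen_def free_group_def)

lemma inv_gen: "inv\<^bsub>free_group\<^esub> (gen x) = [(x, False)]"
  by (rule group.inv_equality [OF group_free_group])
     (auto simp: free_group_def gen_def flip_def)

lemma free_group_induct [consumes 1, case_names one gen inv]: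
  assumes w: "w \<in> carrier free_group"
    and one: "P \<one>\<^bsub>free_group\<^esub>"
    and gen: "\<And>x u. u \<in> carrier free_group \<Longrightarrow> P u \<Longrightarrow> P (gen x \<otimes>\<^bsub>free_group\<^esub> u)"
    and inv: "\<And>x u. u \<in> carrier free_group \<Longrightarrow> P u \<Longrightarrow>
                P (inv\<^bsub>free_group\<^esub> (gen x) \<otimes>\<^bsub>free_group\<^esub> u)"
  shows "P w"
  using w
proof (induction w)
  case Nil
  then show ?case using one by (simp add: free_group_def)
next
  case (Cons l w)
  then have w: "w \<in> carrier free_group" and push: "push l w = l # w"
    by (auto simp: free_group_def reduced_Cons push_reduced)
  obtain x s where l: "l = (x, s)" by fastforce
  have "gen x \<otimes>\<^bsub>free_group\<^esub> w = push (x, True) w"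
    by (simp add: free_group_def gen_def)
  moreover have "inv\<^bsub>free_group\<^esub> (gen x) \<otimes>\<^bsub>free_group\<^esub> w = push (x, False) w"
    unfolding inv_gen by (simp add: free_group_def)
  ultimately show ?case
    using gen [OF w Cons.IH [OF w], of x] inv [OF w Cons.IH [OF w], of x] push
    by (cases s) (simp_all add: l)
qed

definition lift_free :: "('b, 'c) monoid_scheme \<Rightarrow> ('a \<Rightarrow> 'b) \<Rightarrow> 'a word \<Rightarrow> 'b"
  where "lift_free G f w =
    foldr (\<lambda>l g. (if snd l then f (fst l) else inv\<^bsub>G\<^esub> f (fst l)) \<otimes>\<^bsub>G\<^esub> g) w \<one>\<^bsub>G\<^esub>"

lemma free_group_universal:
  assumes "group G" and f: "\<And>x. f x \<in> carrier G"
  shows "lift_free G f \<in> hom free_group G"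
    and "lift_free G f (gen x) = f x"
    and "h \<in> hom free_group G \<Longrightarrow> (\<And>x. h (gen x) = f x) \<Longrightarrow> w \<in> carrier free_group \<Longrightarrow>
           h w = lift_free G f w"
proof -
  interpret group G by fact
  let ?e = "lift_free G f"
  let ?l = "\<lambda>l. if snd l then f (fst l) else inv\<^bsub>G\<^esub> f (fst l)"
  have Cons: "?e (l # w) = ?l l \<otimes>\<^bsub>G\<^esub> ?e w" for l w
    by (simp add: lift_free_def)
  have l: "?l l \<in> carrier G" for l by (simp add: f)
  have e: "?e w \<in> carrier G" for w
    by (induction w) (use l Cons in \<open>auto simp: lift_free_def\<close>)
  have flip: "?l l \<otimes>\<^bsub>G\<^esub> (?l (flip l) \<otimes>\<^bsub>G\<^esub> g) = g" if "g \<in> carrier G" for l g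
    using that f by (auto simp: flip_def m_assoc [symmetric])
  have push: "?e (push k w) = ?l k \<otimes>\<^bsub>G\<^esub> ?e w" for k w
  proof (cases w)
    case (Cons l w')
    then show ?thesis
      using \<open>\<And>l w. ?e (l # w) = ?l l \<otimes>\<^bsub>G\<^esub> ?e w\<close> flip [OF e] by (cases "l = flip k") auto
  qed (simp add: lift_free_def)
  have mult: "?e (foldr push u v) = ?e u \<otimes>\<^bsub>G\<^esub> ?e v" for u v
  proof (induction u)
    case Nil
    then show ?case using e by (simp add: lift_free_def)
  next
    case (Cons k u)
    have "?e (foldr push (k # u) v) = ?l k \<otimes>\<^bsub>G\<^esub> (?e u \<otimes>\<^bsub>G\<^esub> ?e v)"
      using Cons push by simp
    then show ?case
      unfolding \<open>\<And>l w. ?e (l # w) = ?l l \<otimes>\<^bsub>G\<^esub> ?e w\<close> using l [of k] e by (simp only: m_assoc)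
  qed
  show hom: "?e \<in> hom free_group G"
    using e mult by (auto simp: hom_def free_group_def)
  show gen: "?e (gen x) = f x" for x
    using f by (simp add: lift_free_def gen_def)
  assume h: "h \<in> hom free_group G" "\<And>x. h (gen x) = f x" and w: "w \<in> carrier free_group"
  interpret h: group_hom free_group G h
    using h group_free_group by (simp add: group_hom_def group_hom_axioms_def is_group)
  interpret e: group_hom free_group G ?e
    using hom group_free_group by (simp add: group_hom_def group_hom_axioms_def is_group)
  show "h w = ?e w"
    using w by (induction w rule: free_group_induct) (auto simp: h(2) gen)
qed

abbreviation F2 :: "2 word monoid"
  where "F2 \<equiv> free_group"


section \<open>Special automorphisms\<close>

definition abelianization :: "('a, 'b) monoid_scheme \<Rightarrow> 'a set monoid"
  where "abelianization G = G Mod derived G (carrier G)"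

definition rho :: "(2 word \<Rightarrow> 2 word) \<Rightarrow> (2 word set \<Rightarrow> 2 word set)"
  where "rho \<phi> = (\<lambda>C \<in> carrier (abelianization F2). \<phi> ` C)"

definition ab_gen :: "2 \<Rightarrow> 2 word set"
  where "ab_gen i = derived F2 (carrier F2) #>\<^bsub>F2\<^esub> gen i"

text \<open>
  The identification of the automorphism group of the abelianized free group with integer matrices,
  with respect to the basis \<^term>\<open>ab_gen 1\<close>, \<^term>\<open>ab_gen 2\<close>: the \<open>j\<close>-th column holds the
  coordinates of the image of the \<open>j\<close>-th basis element.
\<close>

definition ab_matrix :: "(2 word set \<Rightarrow> 2 word set) \<Rightarrow> int^2^2"
  where "ab_matrix \<alpha> = (THE A. \<forall>j. \<alpha> (ab_gen j) =
    ab_gen 1 [^]\<^bsub>abelianization F2\<^esub> (A $ 1 $ j) \<otimes>\<^bsub>abelianization F2\<^esub>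
    ab_gen 2 [^]\<^bsub>abelianization F2\<^esub> (A $ 2 $ j))"

definition SL2Z :: "(int^2^2) set"
  where "SL2Z = {A. det A = 1}"

definition Aut_plus :: "(2 word \<Rightarrow> 2 word) set"
  where "Aut_plus = {\<phi> \<in> carrier (AutoGroup F2). ab_matrix (rho \<phi>) \<in> SL2Z}"

definition Gamma_plus :: "(2 word \<Rightarrow> 'b) \<Rightarrow> (2 word \<Rightarrow> 2 word) monoid"
  where "Gamma_plus \<pi> =
    (AutoGroup F2)\<lparr>carrier := {\<phi> \<in> Aut_plus. \<forall>w \<in> carrier F2. \<pi> (\<phi> w) = \<pi> w}\<rparr>"

definition Z_power :: "nat \<Rightarrow> (nat \<Rightarrow> int) monoid"
  where "Z_power r = product_group {..<r} (\<lambda>_. integer_group)"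


subsection \<open>Well-definedness of \<^const>\<open>rho\<close> and \<^const>\<open>ab_matrix\<close>\<close>

lemma comm_group_abelianization: "group G \<Longrightarrow> comm_group (abelianization G)"
  unfolding abelianization_def by (rule group.derived_quot_is_comm_group)

lemma coset_hom: "(\<lambda>w. derived F2 (carrier F2) #>\<^bsub>F2\<^esub> w) \<in> hom F2 (abelianization F2)"
  unfolding abelianization_def
  by (intro normal.r_coset_hom_Mod group.derived_self_is_normal group_free_group)

lemma ab_gen_closed [simp]: "ab_gen i \<in> carrier (abelianization F2)"
  using hom_in_carrier [OF coset_hom gen_closed] by (simp add: ab_gen_def)

lemma ab_gen_span:
  assumes "C \<in> carrier (abelianization F2)"
  shows "\<exists>(a::int) (b::int). C = ab_gen 1 [^]\<^bsub>abelianization F2\<^esub> a \<otimes>\<^bsub>abelianization F2\<^esub>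
                            ab_gen 2 [^]\<^bsub>abelianization F2\<^esub> b"
proof -
  interpret A: comm_group "abelianization F2"
    by (rule comm_group_abelianization [OF group_free_group])
  let ?q = "\<lambda>w. derived F2 (carrier F2) #>\<^bsub>F2\<^esub> w"
  interpret q: group_hom F2 "abelianization F2" ?q
    using coset_hom group_free_group by (simp add: group_hom_def group_hom_axioms_def A.is_group)
  let ?p = "\<lambda>(a::int) (b::int). ab_gen 1 [^]\<^bsub>abelianization F2\<^esub> a \<otimes>\<^bsub>abelianization F2\<^esub>
                        ab_gen 2 [^]\<^bsub>abelianization F2\<^esub> b"
  have p: "?p a b \<otimes>\<^bsub>abelianization F2\<^esub> ?p c d = ?p (a + c) (b + d)" for a b c d
    unfolding A.int_pow_mult [OF ab_gen_closed] using A.int_pow_closed [OF ab_gen_closed]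
    by (simp add: A.m_ac)
  have pp: "\<exists>a b. B = ?p a b \<Longrightarrow> \<exists>a b. C = ?p a b \<Longrightarrow>
      \<exists>a b. B \<otimes>\<^bsub>abelianization F2\<^esub> C = ?p a b" for B C
    using p by metis
  have g: "\<exists>a b. ab_gen i = ?p a b" for i
  proof (cases "i = 1")
    case True
    then show ?thesis by (intro exI [of _ 1] exI [of _ 0]) simp
  next
    case False
    then have "i = 2" using exhaust_2 by blast
    then show ?thesis by (intro exI [of _ 0] exI [of _ 1]) simp
  qed
  have gi: "\<exists>a b. inv\<^bsub>abelianization F2\<^esub> ab_gen i = ?p a b" for i
  proof -
    obtain a b where "ab_gen i = ?p a b" using g by blast
    then have "inv\<^bsub>abelianization F2\<^esub> ab_gen i = ?p (-a) (-b)"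
      by (simp add: A.inv_mult A.int_pow_neg)
    then show ?thesis by blast
  qed
  have "\<exists>a b. ?q w = ?p a b" if "w \<in> carrier F2" for w
    using that
  proof (induction w rule: free_group_induct)
    case one
    show ?case by (intro exI [of _ 0]) simp
  next
    case (gen x u)
    then show ?case using pp [OF g [of x]] by (simp flip: ab_gen_def)
  next
    case (inv x u)
    then show ?case using pp [OF gi [of x]] by (simp flip: ab_gen_def)
  qed
  then show ?thesis
    using assms by (auto simp: abelianization_def FactGroup_def RCOSETS_def)
qed

lemma ab_gen_coordinates_unique:
  fixes a b c d :: int
  assumes "ab_gen 1 [^]\<^bsub>abelianization F2\<^esub> a \<otimes>\<^bsub>abelianization F2\<^esub>
             ab_gen 2 [^]\<^bsub>abelianization F2\<^esub> b =
           ab_gen 1 [^]\<^bsub>abelianization F2\<^esub> c \<otimes>\<^bsub>abelianization F2\<^esub>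
             ab_gen 2 [^]\<^bsub>abelianization F2\<^esub> d"
  shows "a = c \<and> b = d"
proof -
  interpret A: comm_group "abelianization F2"
    by (rule comm_group_abelianization [OF group_free_group])
  interpret Z: comm_group integer_group by (rule abelian_integer_group)
  have coord: "n * a + m * b = n * c + m * d" for n m
  proof -
    define f where "f = (\<lambda>x :: 2. if x = 1 then n else m)"
    interpret e: group_hom F2 integer_group "lift_free integer_group f"
      using free_group_universal(1) [of integer_group f] group_free_group
      by (simp add: group_hom_def group_hom_axioms_def)
    have "lift_free integer_group f ` derived F2 (carrier F2) =
            derived integer_group (lift_free integer_group f ` carrier F2)"
      by (rule e.derived_img [symmetric]) simp
    also have "\<dots> = {\<one>\<^bsub>integer_group\<^esub>}"
      by (rule Z.derived_eq_singleton) simp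
    finally have ker: "derived F2 (carrier F2) \<subseteq> kernel F2 integer_group (lift_free integer_group f)"
      using e.G.derived_in_carrier [OF subset_refl] by (auto simp: kernel_def)
    obtain g where g: "g \<in> hom (abelianization F2) integer_group"
      and gq: "\<And>w. w \<in> carrier F2 \<Longrightarrow>
        g (derived F2 (carrier F2) #>\<^bsub>F2\<^esub> w) = lift_free integer_group f w"
      using e.FactGroup_universal_kernel [OF e.G.derived_self_is_normal ker]
      unfolding abelianization_def by blast
    interpret g: group_hom "abelianization F2" integer_group g
      using g by (simp add: group_hom_def group_hom_axioms_def A.is_group)
    have gen: "g (ab_gen x) = f x" for x
      unfolding ab_gen_def gq [OF gen_closed] by (rule free_group_universal(2)) auto
    show ?thesis
      using arg_cong [OF assms, of g]
      by (simp add: g.hom_int_pow gen) (simp add: f_def algebra_simps)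
  qed
  show ?thesis using coord [of 1 0] coord [of 0 1] by simp
qed

lemma ab_matrix_ex1:
  assumes "\<alpha> \<in> hom (abelianization F2) (abelianization F2)"
  shows "\<exists>!A :: int^2^2. \<forall>j. \<alpha> (ab_gen j) =
    ab_gen 1 [^]\<^bsub>abelianization F2\<^esub> (A $ 1 $ j) \<otimes>\<^bsub>abelianization F2\<^esub>
    ab_gen 2 [^]\<^bsub>abelianization F2\<^esub> (A $ 2 $ j)"
proof (rule ex_ex1I)
  have "\<exists>c :: int \<times> int. \<alpha> (ab_gen j) = ab_gen 1 [^]\<^bsub>abelianization F2\<^esub> fst c
      \<otimes>\<^bsub>abelianization F2\<^esub> ab_gen 2 [^]\<^bsub>abelianization F2\<^esub> snd c" for j
    using ab_gen_span [OF hom_in_carrier [OF assms ab_gen_closed], of j] by auto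
  then obtain c :: "2 \<Rightarrow> int \<times> int" where c: "\<And>j. \<alpha> (ab_gen j) =
      ab_gen 1 [^]\<^bsub>abelianization F2\<^esub> fst (c j) \<otimes>\<^bsub>abelianization F2\<^esub>
      ab_gen 2 [^]\<^bsub>abelianization F2\<^esub> snd (c j)"
    by metis
  show "\<exists>A :: int^2^2. \<forall>j. \<alpha> (ab_gen j) =
    ab_gen 1 [^]\<^bsub>abelianization F2\<^esub> (A $ 1 $ j) \<otimes>\<^bsub>abelianization F2\<^esub>
    ab_gen 2 [^]\<^bsub>abelianization F2\<^esub> (A $ 2 $ j)"
    by (intro exI [of _ "\<chi> i j. if i = 1 then fst (c j) else snd (c j)"] allI) (simp add: c)
next
  fix A B :: "int^2^2"
  assume A: "\<forall>j. \<alpha> (ab_gen j) =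
      ab_gen 1 [^]\<^bsub>abelianization F2\<^esub> (A $ 1 $ j) \<otimes>\<^bsub>abelianization F2\<^esub>
      ab_gen 2 [^]\<^bsub>abelianization F2\<^esub> (A $ 2 $ j)"
    and B: "\<forall>j. \<alpha> (ab_gen j) =
      ab_gen 1 [^]\<^bsub>abelianization F2\<^esub> (B $ 1 $ j) \<otimes>\<^bsub>abelianization F2\<^esub>
      ab_gen 2 [^]\<^bsub>abelianization F2\<^esub> (B $ 2 $ j)"
  then have "A $ 1 $ j = B $ 1 $ j \<and> A $ 2 $ j = B $ 2 $ j" for j
    by (intro ab_gen_coordinates_unique) metis
  then show "A = B"
    by (auto simp: vec_eq_iff forall_2)
qed

lemma rho_closed:
  assumes "\<phi> \<in> carrier (AutoGroup F2)"
  shows "rho \<phi> \<in> carrier (AutoGroup (abelianization F2))"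
proof -
  let ?D = "derived F2 (carrier F2)" and ?A = "abelianization F2"
  have hom: "\<phi> \<in> hom F2 F2" and bij: "bij_betw \<phi> (carrier F2) (carrier F2)"
    using assms by (auto simp: AutoGroup_def auto_def Bij_def)
  interpret \<phi>: group_hom F2 F2 \<phi>
    using hom group_free_group by (simp add: group_hom_def group_hom_axioms_def)
  interpret A: comm_group ?A
    by (rule comm_group_abelianization [OF group_free_group])
  have surj: "\<phi> ` carrier F2 = carrier F2" and inj: "inj_on \<phi> (carrier F2)"
    using bij by (auto simp: bij_betw_def)
  have D: "\<phi> ` ?D = ?D"
    using \<phi>.derived_img [OF subset_refl] surj by simp
  have Dsub: "?D \<subseteq> carrier F2"
    by (rule \<phi>.G.derived_in_carrier) simp
  have car: "carrier ?A = (\<lambda>w. ?D #>\<^bsub>F2\<^esub> w) ` carrier F2"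
    by (auto simp: abelianization_def FactGroup_def RCOSETS_def)
  have coset: "\<phi> ` (?D #>\<^bsub>F2\<^esub> w) = ?D #>\<^bsub>F2\<^esub> \<phi> w" if w: "w \<in> carrier F2" for w
  proof -
    have "\<phi> ` (?D #>\<^bsub>F2\<^esub> w) = (\<lambda>d. d \<otimes>\<^bsub>F2\<^esub> \<phi> w) ` (\<phi> ` ?D)"
      using w Dsub by (force simp: r_coset_def)
    then show ?thesis
      unfolding D by (auto simp: r_coset_def)
  qed
  have "rho \<phi> ` carrier ?A = (\<lambda>w. ?D #>\<^bsub>F2\<^esub> w) ` (\<phi> ` carrier F2)"
    by (auto simp: rho_def car coset image_image)
  then have surj': "rho \<phi> ` carrier ?A = carrier ?A"
    by (simp only: surj car)
  have inj': "inj_on (rho \<phi>) (carrier ?A)"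
  proof (rule inj_onI)
    fix B C assume BC: "B \<in> carrier ?A" "C \<in> carrier ?A" "rho \<phi> B = rho \<phi> C"
    then have "\<phi> ` B = \<phi> ` C" by (simp add: rho_def)
    moreover have "B \<subseteq> carrier F2" "C \<subseteq> carrier F2"
      using BC Dsub by (auto simp: car dest: \<phi>.G.r_coset_subset_G [THEN subsetD])
    ultimately show "B = C" using inj by (simp add: inj_on_image_eq_iff)
  qed
  have mult: "rho \<phi> (B \<otimes>\<^bsub>?A\<^esub> C) = rho \<phi> B \<otimes>\<^bsub>?A\<^esub> rho \<phi> C"
    if BC: "B \<in> carrier ?A" "C \<in> carrier ?A" for B C
  proof -
    obtain u v where uv: "u \<in> carrier F2" "v \<in> carrier F2"
      "B = ?D #>\<^bsub>F2\<^esub> u" "C = ?D #>\<^bsub>F2\<^esub> v"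
      using BC car by auto
    have m: "(?D #>\<^bsub>F2\<^esub> x) \<otimes>\<^bsub>?A\<^esub> (?D #>\<^bsub>F2\<^esub> y) = ?D #>\<^bsub>F2\<^esub> (x \<otimes>\<^bsub>F2\<^esub> y)"
      if "x \<in> carrier F2" "y \<in> carrier F2" for x y
      using hom_mult [OF coset_hom that] by simp
    show ?thesis
      using uv BC A.m_closed [OF BC] by (simp add: rho_def m coset)
  qed
  have "rho \<phi> \<in> hom ?A ?A"
    using surj' mult by (auto simp: hom_def)
  then show ?thesis
    using surj' inj' by (auto simp: AutoGroup_def auto_def Bij_def bij_betw_def rho_def)
qed

end

theory Submission
  imports Defs "HOL-Algebra.FiniteProduct"
begin

text \<open>Since the target \<open>G\<close> is abelian, \<open>\<Gamma>\<^sup>+(G, \<pi>)\<close> is the preimage of a congruence subgroup \<open>\<Delta>\<close>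
  of the modular group, and by Nielsen it is an extension of \<open>\<Delta>\<close> by the inner automorphisms. The
  determinant of the Fox Jacobian, taken modulo the square of the augmentation ideal of \<open>\<int>[G]\<close>,
  is a homomorphism to \<open>G\<close> that extends \<open>\<pi>\<close> on the inner automorphisms; together with
  transvections in \<open>\<Delta>\<close>, which make the inner automorphisms of the kernel of \<open>\<pi>\<close> commutators, it
  shows that the abelianization is \<open>G \<times> \<Delta>\<^sup>a\<^sup>b\<close>. The modular group is generated by \<open>S\<close> and \<open>U\<close>
  subject to \<open>S\<^sup>4 = 1\<close> and \<open>S\<^sup>2 = U\<^sup>3\<close>. Its action on the maps from \<open>\<int>\<^sup>2\<close> onto \<open>G\<close> (a single
  orbit) defines a finite graph of groups for \<open>\<Delta>\<close>. If \<open>-1\<close> and \<open>U\<^sup>2\<close> act freely, this is a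
  trivalent graph and \<open>\<Delta>\<close> is free of rank one more than a twelfth of the number of points. In
  the remaining three cases the graph is written down explicitly.\<close>

section \<open>The modular group and its presentation\<close>

text \<open>That \<open>S\<close> and \<open>U\<close> satisfy no further relations is stated
  through actions: maps with the two relations extend to an action of the modular group. On outer
  classes this shows that a product of the lifts of \<open>S\<close> and \<open>U\<close> is
  determined by its matrix up to inner automorphisms, and Nielsen reduction extends this to all
  automorphisms. On a skew product of level structures with an abelian group it turns edge labels
  into homomorphisms on the stabilizer, without a presentation of the stabilizer. The inner part
  could shrink or stay too large in the abelianization: the Fox determinant bounds it by
  \<open>G\<close> from below, the transvections bound it by \<open>G\<close> from above. The
  twelfth: with free actions the orbits of \<open>S\<close> have 4 points and those of
  \<open>U\<close> have 6, so the contracted graph on the points X has |X|/6 vertices and |X|/4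
  edges, hence rank 1 + |X|/4 - |X|/6. In the exceptional cases the stabilizer contains
  \<open>-1\<close>, for \<open>(2, 1)\<close> and \<open>(2, 2)\<close>, or a conjugate of
  \<open>U^2\<close>, for \<open>(3, 1)\<close>. The condition on \<open>\<phi>\<close> depends on
  the kernel of \<open>\<pi>\<close> only, so a normal form for the kernel suffices to treat all
  epimorphisms.\<close>

type_synonym mat2 = "int \<times> int \<times> int \<times> int"

text \<open>Quadruples rather than \<open>int^2^2\<close>, so that products of concrete matrices are
  evaluated by rewriting.\<close>

fun mmul :: "mat2 \<Rightarrow> mat2 \<Rightarrow> mat2"
  where "mmul (a, b, c, d) (a', b', c', d') =
    (a * a' + b * c', a * b' + b * d', c * a' + d * c', c * b' + d * d')"

fun minv :: "mat2 \<Rightarrow> mat2"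
  where "minv (a, b, c, d) = (d, - b, - c, a)"

definition SL2 :: "mat2 monoid"
  where "SL2 = \<lparr>carrier = {(a, b, c, d). a * d - b * c = 1}, monoid.mult = mmul, one = (1, 0, 0, 1)\<rparr>"

abbreviation matS :: mat2 where "matS \<equiv> (0, 1, -1, 0)"
abbreviation matU :: mat2 where "matU \<equiv> (0, 1, -1, 1)"

lemma SL2_carrier [simp]: "(a, b, c, d) \<in> carrier SL2 \<longleftrightarrow> a * d - b * c = 1"
  by (simp add: SL2_def)

lemma SL2_mult [simp]: "A \<otimes>\<^bsub>SL2\<^esub> B = mmul A B"
  by (simp add: SL2_def)

lemma SL2_one [simp]: "\<one>\<^bsub>SL2\<^esub> = (1, 0, 0, 1)"
  by (simp add: SL2_def)

lemma mmul_assoc: "mmul (mmul A B) C = mmul A (mmul B C)"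
  by (cases A; cases B; cases C) (auto simp: algebra_simps)

lemma mmul_one [simp]: "mmul (1, 0, 0, 1) A = A" "mmul A (1, 0, 0, 1) = A"
  by (cases A; simp)+

lemma group_SL2: "group SL2"
proof (rule groupI)
  fix A B assume "A \<in> carrier SL2" "B \<in> carrier SL2"
  moreover obtain a b c d where A: "A = (a, b, c, d)" by (cases A)
  moreover obtain a' b' c' d' where B: "B = (a', b', c', d')" by (cases B)
  moreover have "(a * a' + b * c') * (c * b' + d * d') - (a * b' + b * d') * (c * a' + d * c')
      = (a * d - b * c) * (a' * d' - b' * c')" by (simp add: algebra_simps)
  ultimately show "A \<otimes>\<^bsub>SL2\<^esub> B \<in> carrier SL2" by simp
next
  fix A assume "A \<in> carrier SL2"
  then show "\<exists>B\<in>carrier SL2. B \<otimes>\<^bsub>SL2\<^esub> A = \<one>\<^bsub>SL2\<^esub>"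
    by (intro bexI [of _ "minv A"]; cases A) (auto simp: algebra_simps)
qed (auto simp: mmul_assoc)

lemma inv_SL2: "A \<in> carrier SL2 \<Longrightarrow> inv\<^bsub>SL2\<^esub> A = minv A"
  by (rule group.inv_equality [OF group_SL2]; cases A) (auto simp: algebra_simps)

lemma matS_closed: "matS \<in> carrier SL2" and matU_closed: "matU \<in> carrier SL2"
  by auto

text \<open>\<open>S\<close> and \<open>U\<close> have finite order, so products without inverses
  already form a group; the resulting induction has just two steps.\<close>

inductive_set SU_monoid :: "mat2 set"
  where
    one: "(1, 0, 0, 1) \<in> SU_monoid"
  | S: "A \<in> SU_monoid \<Longrightarrow> mmul matS A \<in> SU_monoid"
  | U: "A \<in> SU_monoid \<Longrightarrow> mmul matU A \<in> SU_monoid"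

text \<open>Euclid's algorithm on the first column: a translation reduces \<open>a\<close> modulo
  \<open>c\<close>, then \<open>S\<close> exchanges the rows up to sign, so that the absolute value
  of \<open>c\<close> decreases.\<close>

lemma SL2_subset_SU_monoid:
  assumes "A \<in> carrier SL2"
  shows "A \<in> SU_monoid"
proof -
  have S: "(c, d, - a, - b) \<in> SU_monoid" if "(a, b, c, d) \<in> SU_monoid" for a b c d
    using SU_monoid.S [OF that] by simp
  have neg: "(- a, - b, - c, - d) \<in> SU_monoid" if "(a, b, c, d) \<in> SU_monoid" for a b c d
    using S [OF S [OF that]] by simp
  have U: "(c, d, c - a, d - b) \<in> SU_monoid" if "(a, b, c, d) \<in> SU_monoid" for a b c d
    using SU_monoid.U [OF that] by simp
  \<comment> \<open>\<open>T\<close> and \<open>T'\<close> are left multiplication by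
    \<open>-U^2 S\<close> and by its inverse \<open>-S^3 U^4\<close>, the elementary translations of
    the first row.\<close>
  have T: "(a + c, b + d, c, d) \<in> SU_monoid" if "(a, b, c, d) \<in> SU_monoid" for a b c d
    using neg [OF U [OF U [OF S [OF that]]]] by (simp add: algebra_simps)
  have T': "(a - c, b - d, c, d) \<in> SU_monoid" if "(a, b, c, d) \<in> SU_monoid" for a b c d
    using neg [OF S [OF S [OF S [OF U [OF U [OF U [OF U [OF that]]]]]]]] by (simp add: algebra_simps)
  have Tn: "(a + int k * c, b + int k * d, c, d) \<in> SU_monoid"
    if "(a, b, c, d) \<in> SU_monoid" for a b c d k
    using that
  proof (induction k)
    case (Suc k)
    then show ?case using T [OF Suc.IH [OF Suc.prems]] by (simp add: algebra_simps)
  qed simp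
  have Tn': "(a - int k * c, b - int k * d, c, d) \<in> SU_monoid"
    if "(a, b, c, d) \<in> SU_monoid" for a b c d k
    using that
  proof (induction k)
    case (Suc k)
    then show ?case using T' [OF Suc.IH [OF Suc.prems]] by (simp add: algebra_simps)
  qed simp
  have Tk: "(a + k * c, b + k * d, c, d) \<in> SU_monoid"
    if "(a, b, c, d) \<in> SU_monoid" for a b c d k
    using Tn [OF that, of "nat k"] Tn' [OF that, of "nat (- k)"] by (cases "k \<ge> 0") auto
  have "(a, b, c, d) \<in> SU_monoid" if "a * d - b * c = 1" for a b c d
    using that
  proof (induction "nat \<bar>c\<bar>" arbitrary: a b c d rule: less_induct)
    case less
    show ?case
    proof (cases "c = 0")
      case True
      then have "a * d = 1" using less.prems by simp
      then have "a = 1 \<and> d = 1 \<or> a = -1 \<and> d = -1" by (simp add: zmult_eq_1_iff)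
      then show ?thesis
        using Tk [OF SU_monoid.one, of b] Tk [OF neg [OF SU_monoid.one], of "-b"] True by auto
    next
      case False
      define k where "k = a div c"
      have "nat \<bar>a - k * c\<bar> < nat \<bar>c\<bar>"
        using False abs_mod_less [of c a] by (simp add: k_def minus_div_mult_eq_mod)
      moreover have "- c * (b - k * d) - - d * (a - k * c) = 1"
        using less.prems by (simp add: algebra_simps)
      ultimately have "(- c, - d, a - k * c, b - k * d) \<in> SU_monoid"
        by (intro less.hyps) auto
      from Tk [OF S [OF this], of k] show ?thesis by (simp add: algebra_simps)
    qed
  qed
  then show ?thesis using assms by (cases A) auto
qed

lemma SL2_induct [consumes 1, case_names one S U]:
  assumes "A \<in> carrier SL2" and "P (1, 0, 0, 1)"
    and "\<And>A. A \<in> carrier SL2 \<Longrightarrow> P A \<Longrightarrow> P (mmul matS A)"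
    and "\<And>A. A \<in> carrier SL2 \<Longrightarrow> P A \<Longrightarrow> P (mmul matU A)"
  shows "P A"
proof -
  interpret SL2: group SL2 by (rule group_SL2)
  have "A \<in> carrier SL2 \<and> P A" if "A \<in> SU_monoid" for A
    using that
  proof induction
    case (S A)
    then show ?case using assms(3) SL2.m_closed [OF matS_closed, of A] by auto
  next
    case (U A)
    then show ?case using assms(4) SL2.m_closed [OF matU_closed, of A] by auto
  qed (use assms(2) in auto)
  then show ?thesis using SL2_subset_SU_monoid [OF assms(1)] by blast
qed

text \<open>The presentation in the form in which it is used: not as an isomorphism with an abstract
  group, but as the claim that such \<open>s\<close> and \<open>u\<close> extend to an action
  \<open>act\<close> of \<open>SL2\<close>. Bijectivity of \<open>s\<close> and \<open>u\<close>
  follows from the relations.\<close>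

locale SU_action =
  fixes Y :: "'y set" and s u :: "'y \<Rightarrow> 'y"
  assumes s_closed: "y \<in> Y \<Longrightarrow> s y \<in> Y"
    and u_closed: "y \<in> Y \<Longrightarrow> u y \<in> Y"
    and s4: "y \<in> Y \<Longrightarrow> s (s (s (s y))) = y"
    and u3: "y \<in> Y \<Longrightarrow> u (u (u y)) = s (s y)"
begin

text \<open>A relation rather than a function, as a matrix has many words in \<open>S\<close> and
  \<open>U\<close>. That the endpoint depends on the matrix alone is
  \<open>step_unique\<close>.\<close>

inductive step :: "mat2 \<Rightarrow> 'y \<Rightarrow> 'y \<Rightarrow> bool"
  where
    one: "y \<in> Y \<Longrightarrow> step (1, 0, 0, 1) y y"
  | S: "step A y z \<Longrightarrow> step (mmul matS A) y (s z)"
  | U: "step A y z \<Longrightarrow> step (mmul matU A) y (u z)"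

section \<open>Normal forms for words in S and U\<close>

lemma u_s2: "y \<in> Y \<Longrightarrow> u (s (s y)) = s (s (u y))"
  by (metis u3 u_closed)

lemma step_closed: "step A y z \<Longrightarrow> y \<in> Y \<and> z \<in> Y"
  by (induction rule: step.induct) (auto simp: s_closed u_closed)

lemma step_trans: "step B y' z \<Longrightarrow> step A y y' \<Longrightarrow> step (mmul B A) y z"
  by (induction rule: step.induct) (auto simp: mmul_assoc intro: step.intros simp del: mmul.simps)

text \<open>The six powers of \<open>U\<close>, each with the image of \<open>y\<close> under the
  same word. As \<open>U^3 = -1\<close> acts like \<open>S^2\<close>, the last three are the first
  three times \<open>-1\<close>.\<close>

definition base :: "mat2 \<Rightarrow> 'y \<Rightarrow> 'y \<Rightarrow> bool"
  where "base B y w \<longleftrightarrow> (B, w) \<in> {((1, 0, 0, 1), y), (matU, u y), ((-1, 1, -1, 0), u (u y)),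
    ((-1, 0, 0, -1), s (s y)), ((0, -1, 1, -1), s (s (u y))), ((1, -1, 1, 0), s (s (u (u y))))}"

text \<open>The generators of \<open>positive\<close> are \<open>-US\<close> and \<open>-U\<^sup>2S\<close>; no nonempty product of these two
  matrices is the identity.\<close>

inductive positive :: "mat2 \<Rightarrow> 'y \<Rightarrow> 'y \<Rightarrow> bool"
  where
    one: "y \<in> Y \<Longrightarrow> positive (1, 0, 0, 1) y y"
  | L: "positive (a, b, c, d) y z \<Longrightarrow> positive (a, b, a + c, b + d) y (s (s (u (s z))))"
  | R: "positive (a, b, c, d) y z \<Longrightarrow> positive (a + c, b + d, c, d) y (s (s (u (u (s z)))))"

lemma base_U: "base B y w \<Longrightarrow> y \<in> Y \<Longrightarrow> base (mmul matU B) y (u w)"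
  unfolding base_def by (elim insertE emptyE; simp add: u3 s4 u_closed s_closed u_s2)

lemma base_neg: "base B y w \<Longrightarrow> y \<in> Y \<Longrightarrow> base (mmul (-1, 0, 0, -1) B) y (s (s w))"
  unfolding base_def by (elim insertE emptyE; simp add: s4 u_closed s_closed)

lemma base_closed: "base B y w \<Longrightarrow> y \<in> Y \<Longrightarrow> w \<in> Y"
  unfolding base_def by (auto simp: u_closed s_closed)

lemma positive_closed: "positive N y z \<Longrightarrow> y \<in> Y \<and> z \<in> Y"
  by (induction rule: positive.induct) (auto simp: s_closed u_closed)

lemma positive_neg: "positive N y z \<Longrightarrow> positive N (s (s y)) (s (s z))"
proof (induction rule: positive.induct)
  case (L a b c d y z)
  then show ?case using positive.L [OF L.IH] positive_closed [OF L.hyps]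
    by (simp add: u_s2 s_closed u_closed)
next
  case (R a b c d y z)
  then show ?case using positive.R [OF R.IH] positive_closed [OF R.hyps]
    by (simp add: u_s2 s_closed u_closed)
qed (auto intro: positive.one s_closed)

lemma positive_nonneg: "positive (a, b, c, d) y z \<Longrightarrow> 0 \<le> a \<and> 0 \<le> b \<and> 0 \<le> c \<and> 0 \<le> d"
  by (induction "(a, b, c, d)" y z arbitrary: a b c d rule: positive.induct) auto

lemma positive_one: "positive (1, 0, 0, 1) y z \<Longrightarrow> z = y"
  by (erule positive.cases) (auto dest: positive_nonneg)

text \<open>Normal form in the amalgam of the cyclic groups of orders 4 and 6 over their common
  subgroup of order 2: at most one \<open>S\<close>, a positive product, a power of
  \<open>U\<close>. The central sign is absorbed by the power of \<open>U\<close>.\<close>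

definition normal :: "mat2 \<Rightarrow> 'y \<Rightarrow> 'y \<Rightarrow> bool"
  where "normal A y z \<longleftrightarrow> (\<exists>N B w z'. base B y w \<and> positive N w z' \<and>
    (A = mmul N B \<and> z = z' \<or> A = mmul matS (mmul N B) \<and> z = s z'))"

lemma normal_S:
  assumes "normal A y z" "y \<in> Y" shows "normal (mmul matS A) y (s z)"
proof -
  obtain N B w z' where *: "base B y w" "positive N w z'"
    "A = mmul N B \<and> z = z' \<or> A = mmul matS (mmul N B) \<and> z = s z'"
    using assms(1) by (auto simp: normal_def)
  have "mmul matS (mmul matS (mmul N B)) = mmul N (mmul (-1, 0, 0, -1) B)"
    by (cases N; cases B) auto
  then show ?thesis
    using * base_neg [OF *(1) assms(2)] positive_neg [OF *(2)] unfolding normal_def by metis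
qed

text \<open>With \<open>L = -US\<close> and \<open>R = -U^2 S\<close>, a further \<open>U\<close> on
  the left is absorbed by the first factor: \<open>US = -L\<close> if the form starts with
  \<open>S\<close>, otherwise \<open>UL = R\<close> or \<open>UR = S\<close>. If the product is
  empty, the power of \<open>U\<close> grows.\<close>

lemma normal_U:
  assumes "normal A y z" "y \<in> Y" shows "normal (mmul matU A) y (u z)"
proof -
  obtain N B w z' where *: "base B y w" "positive N w z'"
    and or: "A = mmul N B \<and> z = z' \<or> A = mmul matS (mmul N B) \<and> z = s z'"
    using assms(1) by (auto simp: normal_def)
  have Y: "z' \<in> Y" using positive_closed [OF *(2)] by simp
  obtain e f g h where N: "N = (e, f, g, h)" by (cases N)
  note negs = base_neg [OF *(1) assms(2)] positive_neg [OF *(2)]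
  from or show ?thesis
  proof (elim disjE conjE)
    assume A: "A = mmul matS (mmul N B)" "z = s z'"
    have "mmul matU A = mmul (e, f, e + g, f + h) (mmul (-1, 0, 0, -1) B)"
      by (cases B) (auto simp: A N algebra_simps)
    moreover have "positive (e, f, e + g, f + h) (s (s w)) (u z)"
      using positive.L [OF positive_neg [OF *(2) [unfolded N]]] Y
      by (simp add: A u_s2 s4 s_closed u_closed)
    ultimately show ?thesis using negs unfolding normal_def by blast
  next
    assume A: "A = mmul N B" "z = z'"
    from *(2) show ?thesis
    proof (cases rule: positive.cases)
      case one
      then show ?thesis using base_U [OF *(1) assms(2)] A base_closed [OF *(1) assms(2)]
        unfolding normal_def by (metis mmul_one(1) positive.one u_closed)
    next
      case (L a b c d v)
      have "mmul matU A = mmul (a + c, b + d, c, d) B"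
        by (cases B) (auto simp: A L algebra_simps)
      moreover have "u z = s (s (u (u (s v))))"
        using positive_closed [OF L(3)] by (simp add: A L u_s2 s_closed u_closed)
      ultimately show ?thesis using *(1) positive.R [OF L(3)] unfolding normal_def by metis
    next
      case (R a b c d v)
      have "mmul matU A = mmul matS (mmul (a, b, c, d) B)"
        by (cases B) (auto simp: A R algebra_simps)
      moreover have "u z = s v"
        using positive_closed [OF R(3)] by (simp add: A R u_s2 u3 s4 s_closed u_closed)
      ultimately show ?thesis using *(1) R(3) unfolding normal_def by metis
    qed
  qed
qed

lemma step_normal: "step A y z \<Longrightarrow> normal A y z"
proof (induction rule: step.induct)
  case (one y)
  then show ?case unfolding normal_def
    by (intro exI [of _ "(1, 0, 0, 1)"] exI [of _ y] conjI disjI1 positive.one) (simp_all add: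
        base_def)
next
  case (S A y z) then show ?case by (intro normal_S) (auto dest: step_closed)
next
  case (U A y z) then show ?case by (intro normal_U) (auto dest: step_closed)
qed

text \<open>Solving the normal form of the identity for its positive part leaves a power of
  \<open>U\<close>, or the inverse of \<open>S\<close> times such a power. Of these twelve matrices
  only the identity has nonnegative entries.\<close>

lemma step_one: assumes "step (1, 0, 0, 1) y z" shows "z = y"
proof -
  obtain N B w z' where *: "base B y w" "positive N w z'"
    and or: "(1, 0, 0, 1) = mmul N B \<and> z = z' \<or> (1, 0, 0, 1) = mmul matS (mmul N B) \<and> z = s z'"
    using step_normal [OF assms] by (auto simp: normal_def)
  obtain a b c d where N: "N = (a, b, c, d)" by (cases N)
  have nn: "0 \<le> a" "0 \<le> b" "0 \<le> c" "0 \<le> d" using positive_nonneg *(2) N by auto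
  have "B = (1, 0, 0, 1) \<and> w = y \<or> B = matU \<or> B = (-1, 1, -1, 0) \<or> B = (-1, 0, 0, -1) \<or>
      B = (0, -1, 1, -1) \<or> B = (1, -1, 1, 0)"
    using *(1) by (auto simp: base_def)
  then have "N = (1, 0, 0, 1) \<and> w = y \<and> z = z'"
    using or nn unfolding N by (elim disjE conjE; auto; linarith)
  then show ?thesis using positive_one *(2) by auto
qed

lemma step_exists: "A \<in> carrier SL2 \<Longrightarrow> y \<in> Y \<Longrightarrow> \<exists>z. step A y z"
  by (induction rule: SL2_induct) (auto intro: step.intros simp del: mmul.simps)

text \<open>A walk for the inverse matrix completes both given walks to walks of the identity, which
  \<open>step_one\<close> controls.\<close>

lemma step_unique:
  assumes "A \<in> carrier SL2" "step A y z" "step A y z'"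
  shows "z' = z"
proof -
  interpret SL2: group SL2 by (rule group_SL2)
  have 1: "mmul (inv\<^bsub>SL2\<^esub> A) A = (1, 0, 0, 1)" "mmul A (inv\<^bsub>SL2\<^esub> A) = (1, 0, 0, 1)"
    using SL2.l_inv [OF assms(1)] SL2.r_inv [OF assms(1)] by auto
  obtain v where v: "step (inv\<^bsub>SL2\<^esub> A) z v"
    using step_exists [OF SL2.inv_closed [OF assms(1)], of z] step_closed [OF assms(2)] by blast
  from step_trans [OF v assms(2)] have "v = y" using step_one 1 by simp
  with step_trans [OF assms(3) v [unfolded this]] show ?thesis using step_one 1 by simp
qed

definition act :: "mat2 \<Rightarrow> 'y \<Rightarrow> 'y"
  where "act A y = (THE z. step A y z)"

lemma step_act: "A \<in> carrier SL2 \<Longrightarrow> y \<in> Y \<Longrightarrow> step A y (act A y)"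
  unfolding act_def using step_exists step_unique by (metis theI)

lemma act_eqI: "A \<in> carrier SL2 \<Longrightarrow> step A y z \<Longrightarrow> act A y = z"
  using step_act step_unique step_closed by blast

lemma act_closed: "A \<in> carrier SL2 \<Longrightarrow> y \<in> Y \<Longrightarrow> act A y \<in> Y"
  using step_act step_closed by blast

lemma act_mult:
  assumes "A \<in> carrier SL2" "B \<in> carrier SL2" "y \<in> Y"
  shows "act (mmul A B) y = act A (act B y)"
  using assms group.is_monoid [OF group_SL2, THEN monoid.m_closed, OF assms(1,2)]
  by (intro act_eqI step_trans [of A "act B y"] step_act act_closed) auto

lemma act_one: "y \<in> Y \<Longrightarrow> act (1, 0, 0, 1) y = y"
  by (intro act_eqI step.one) auto

lemma act_S: "y \<in> Y \<Longrightarrow> act matS y = s y"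
  using step.S [OF step.one] by (intro act_eqI) auto

lemma act_U: "y \<in> Y \<Longrightarrow> act matU y = u y"
  using step.U [OF step.one] by (intro act_eqI) auto

end

section \<open>Automorphisms of the free group of rank two\<close>

abbreviation gx :: "2 word" where "gx \<equiv> gen 1"
abbreviation gy :: "2 word" where "gy \<equiv> gen 2"
abbreviation Aut2 :: "(2 word \<Rightarrow> 2 word) monoid" where "Aut2 \<equiv> AutoGroup F2"

interpretation F2: group F2
  by (rule group_free_group)

interpretation Aut2: group Aut2
  by (rule F2.AutoGroup)

lemma two_cases: "P (1::2) \<Longrightarrow> P 2 \<Longrightarrow> P i"
  using exhaust_2 [of i] by auto

lemma F2_hom_eqI:
  assumes "group G" "f \<in> hom F2 G" "g \<in> hom F2 G" "f gx = g gx" "f gy = g gy" "w \<in> carrier F2"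
  shows "f w = g w"
proof -
  have *: "f (gen i) = g (gen i)" for i using assms(4,5) by (rule two_cases)
  have "f w = lift_free G (\<lambda>i. f (gen i)) w"
    using assms by (intro free_group_universal(3)) (auto simp: hom_in_carrier [OF assms(2)])
  also have "\<dots> = g w"
    using assms by (intro free_group_universal(3) [symmetric])
      (auto simp: hom_in_carrier [OF assms(3)] *)
  finally show ?thesis .
qed

section \<open>Exponent sums and the Heisenberg coordinate of a word\<close>

definition heisenberg :: "(int \<times> int \<times> int) monoid"
  where "heisenberg = \<lparr>carrier = UNIV,
    monoid.mult = (\<lambda>(a, b, h) (a', b', h'). (a + a', b + b', h + h' + a * b')), one = (0, 0, 0)\<rparr>"

lemma group_heisenberg: "group heisenberg"
proof (rule groupI)
  fix g :: "int \<times> int \<times> int"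
  obtain a b h where "g = (a, b, h)" by (cases g)
  then show "\<exists>k\<in>carrier heisenberg. k \<otimes>\<^bsub>heisenberg\<^esub> g = \<one>\<^bsub>heisenberg\<^esub>"
    by (intro bexI [of _ "(- a, - b, a * b - h)"]) (auto simp: heisenberg_def)
qed (auto simp: heisenberg_def algebra_simps)

text \<open>To first order at the augmentation, the Fox derivatives of a word are determined by its
  exponent sums \<open>expx\<close> and \<open>expy\<close> and by the central coordinate \<open>area\<close> of its image in the
  Heisenberg group.\<close>

definition heis :: "2 word \<Rightarrow> int \<times> int \<times> int"
  where "heis = lift_free heisenberg (\<lambda>i. if i = 1 then (1, 0, 0) else (0, 1, 0))"

definition expx :: "2 word \<Rightarrow> int" where "expx w = fst (heis w)"
definition expy :: "2 word \<Rightarrow> int" where "expy w = fst (snd (heis w))"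
definition area :: "2 word \<Rightarrow> int" where "area w = snd (snd (heis w))"

lemma heis_hom: "heis \<in> hom F2 heisenberg"
  unfolding heis_def by (rule free_group_universal(1) [OF group_heisenberg]) (simp add:
      heisenberg_def)

lemma heis_gen: "heis gx = (1, 0, 0)" "heis gy = (0, 1, 0)"
  unfolding heis_def
  by (subst free_group_universal(2) [OF group_heisenberg], simp add: heisenberg_def, simp)+

lemma exp_gen [simp]: "expx gx = 1" "expx gy = 0" "expy gx = 0" "expy gy = 1" "area gx = 0"
    "area gy = 0"
  by (simp_all add: expx_def expy_def area_def heis_gen)

lemma exp_mult [simp]:
  assumes "u \<in> carrier F2" "v \<in> carrier F2"
  shows "expx (u \<otimes>\<^bsub>F2\<^esub> v) = expx u + expx v" "expy (u \<otimes>\<^bsub>F2\<^esub> v) = expy u + expy v"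
    "area (u \<otimes>\<^bsub>F2\<^esub> v) = area u + area v + expx u * expy v"
  using hom_mult [OF heis_hom assms]
  by (auto simp: expx_def expy_def area_def heisenberg_def split: prod.splits)

lemma exp_one [simp]: "expx \<one>\<^bsub>F2\<^esub> = 0" "expy \<one>\<^bsub>F2\<^esub> = 0" "area \<one>\<^bsub>F2\<^esub> = 0"
  using exp_mult [of "\<one>\<^bsub>F2\<^esub>" "\<one>\<^bsub>F2\<^esub>"] by simp_all

lemma exp_inv [simp]:
  assumes "u \<in> carrier F2"
  shows "expx (inv\<^bsub>F2\<^esub> u) = - expx u" "expy (inv\<^bsub>F2\<^esub> u) = - expy u"
    "area (inv\<^bsub>F2\<^esub> u) = expx u * expy u - area u"
proof -
  note * = exp_mult [OF assms F2.inv_closed [OF assms]]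
  show 1: "expx (inv\<^bsub>F2\<^esub> u) = - expx u" and 2: "expy (inv\<^bsub>F2\<^esub> u) = - expy u"
    using *(1,2) assms by simp_all
  show "area (inv\<^bsub>F2\<^esub> u) = expx u * expy u - area u"
    using *(3) assms by (simp add: 2)
qed

lemma expx_hom: "expx \<in> hom F2 integer_group" and expy_hom: "expy \<in> hom F2 integer_group"
  by (auto simp: hom_def)

lemma aut_hom: "\<phi> \<in> carrier Aut2 \<Longrightarrow> \<phi> \<in> hom F2 F2"
  by (simp add: AutoGroup_def auto_def)

lemma aut_group_hom: "\<phi> \<in> carrier Aut2 \<Longrightarrow> group_hom F2 F2 \<phi>"
  by (simp add: group_hom_def group_hom_axioms_def aut_hom group_free_group)

lemma aut_closed [simp]: "\<phi> \<in> carrier Aut2 \<Longrightarrow> w \<in> carrier F2 \<Longrightarrow> \<phi> w \<in> carrier F2"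
  using hom_in_carrier [OF aut_hom] by blast

lemma aut_mult: "\<phi> \<in> carrier Aut2 \<Longrightarrow> u \<in> carrier F2 \<Longrightarrow> v \<in> carrier F2 \<Longrightarrow>
    \<phi> (u \<otimes>\<^bsub>F2\<^esub> v) = \<phi> u \<otimes>\<^bsub>F2\<^esub> \<phi> v"
  using hom_mult [OF aut_hom] by blast

lemma aut_inv: "\<phi> \<in> carrier Aut2 \<Longrightarrow> u \<in> carrier F2 \<Longrightarrow> \<phi> (inv\<^bsub>F2\<^esub> u) = inv\<^bsub>F2\<^esub> \<phi> u"
  by (rule group_hom.hom_inv [OF aut_group_hom])

lemma aut_one: "\<phi> \<in> carrier Aut2 \<Longrightarrow> \<phi> \<one>\<^bsub>F2\<^esub> = \<one>\<^bsub>F2\<^esub>"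
  by (rule group_hom.hom_one [OF aut_group_hom])

lemma aut_bij: "\<phi> \<in> carrier Aut2 \<Longrightarrow> bij_betw \<phi> (carrier F2) (carrier F2)"
  by (simp add: AutoGroup_def auto_def Bij_def)

lemma Aut2_mult [simp]:
  "\<phi> \<in> carrier Aut2 \<Longrightarrow> \<psi> \<in> carrier Aut2 \<Longrightarrow> w \<in> carrier F2 \<Longrightarrow> (\<phi> \<otimes>\<^bsub>Aut2\<^esub> \<psi>) w = \<phi> (\<psi> w)"
  by (auto simp: AutoGroup_def BijGroup_def auto_def compose_def)

lemma Aut2_one [simp]: "w \<in> carrier F2 \<Longrightarrow> \<one>\<^bsub>Aut2\<^esub> w = w"
  by (simp add: AutoGroup_def BijGroup_def)

lemma Aut2_inv [simp]:
  assumes "\<phi> \<in> carrier Aut2" "w \<in> carrier F2"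
  shows "\<phi> ((inv\<^bsub>Aut2\<^esub> \<phi>) w) = w" "(inv\<^bsub>Aut2\<^esub> \<phi>) (\<phi> w) = w"
proof -
  have "\<phi> ((inv\<^bsub>Aut2\<^esub> \<phi>) w) = (\<phi> \<otimes>\<^bsub>Aut2\<^esub> inv\<^bsub>Aut2\<^esub> \<phi>) w"
    by (rule Aut2_mult [symmetric]) (use assms in auto)
  then show "\<phi> ((inv\<^bsub>Aut2\<^esub> \<phi>) w) = w" using assms by (simp add: Aut2.r_inv del: Aut2_mult)
  have "(inv\<^bsub>Aut2\<^esub> \<phi>) (\<phi> w) = (inv\<^bsub>Aut2\<^esub> \<phi> \<otimes>\<^bsub>Aut2\<^esub> \<phi>) w"
    by (rule Aut2_mult [symmetric]) (use assms in auto)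
  then show "(inv\<^bsub>Aut2\<^esub> \<phi>) (\<phi> w) = w" using assms by (simp add: Aut2.l_inv del: Aut2_mult)
qed

lemma aut_eqI:
  assumes "\<phi> \<in> carrier Aut2" "\<psi> \<in> carrier Aut2" "\<phi> gx = \<psi> gx" "\<phi> gy = \<psi> gy"
  shows "\<phi> = \<psi>"
proof -
  have ext: "\<phi> \<in> extensional (carrier F2)" "\<psi> \<in> extensional (carrier F2)"
    using assms(1,2) by (simp_all add: AutoGroup_def auto_def Bij_def)
  have "\<phi> w = \<psi> w" if "w \<in> carrier F2" for w
    by (rule F2_hom_eqI [OF group_free_group aut_hom [OF assms(1)] aut_hom [OF assms(2)]
        assms(3,4) that])
  with ext show ?thesis by (rule extensionalityI)
qed

text \<open>Restricted to the carrier because the elements of \<open>AutoGroup\<close> are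
  extensional functions.\<close>

definition endo :: "2 word \<Rightarrow> 2 word \<Rightarrow> 2 word \<Rightarrow> 2 word"
  where "endo p q = (\<lambda>w\<in>carrier F2. lift_free F2 (\<lambda>i. if i = 1 then p else q) w)"

lemma endo_hom:
  assumes "p \<in> carrier F2" "q \<in> carrier F2"
  shows "endo p q \<in> hom F2 F2" "endo p q gx = p" "endo p q gy = q"
proof -
  have c: "(if i = 1 then p else q) \<in> carrier F2" for i :: 2 using assms by simp
  note * = free_group_universal [OF group_free_group, of "\<lambda>i :: 2. if i = 1 then p else q", OF c]
  show "endo p q \<in> hom F2 F2"
    using hom_in_carrier [OF *(1)] hom_mult [OF *(1)] by (auto simp: endo_def hom_def)
  show "endo p q gx = p" "endo p q gy = q"
    using *(2) by (auto simp: endo_def)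
qed

lemma endo_auto:
  assumes pq: "p \<in> carrier F2" "q \<in> carrier F2" and rs: "r \<in> carrier F2" "s \<in> carrier F2"
    and "endo p q r = gx" "endo p q s = gy" "endo r s p = gx" "endo r s q = gy"
  shows "endo p q \<in> carrier Aut2"
proof -
  let ?f = "endo p q" and ?g = "endo r s"
  note f = endo_hom [OF pq] and g = endo_hom [OF rs]
  have fg: "?f (?g w) = w" if "w \<in> carrier F2" for w
    using F2_hom_eqI [OF group_free_group, of "?f \<circ> ?g" "\<lambda>w. w" w] that
      f g assms hom_compose [OF g(1) f(1)] by (auto simp: hom_def)
  have gf: "?g (?f w) = w" if "w \<in> carrier F2" for w
    using F2_hom_eqI [OF group_free_group, of "?g \<circ> ?f" "\<lambda>w. w" w] that
      f g assms hom_compose [OF f(1) g(1)] by (auto simp: hom_def)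
  have "bij_betw ?f (carrier F2) (carrier F2)"
    by (rule bij_betw_byWitness [of _ ?g])
      (use fg gf hom_in_carrier [OF f(1)] hom_in_carrier [OF g(1)] in auto)
  then show ?thesis using f(1) by (simp add: AutoGroup_def auto_def Bij_def endo_def)
qed

definition inn :: "2 word \<Rightarrow> 2 word \<Rightarrow> 2 word"
  where "inn g = (\<lambda>w\<in>carrier F2. g \<otimes>\<^bsub>F2\<^esub> w \<otimes>\<^bsub>F2\<^esub> inv\<^bsub>F2\<^esub> g)"

lemma inn_apply [simp]: "w \<in> carrier F2 \<Longrightarrow> inn g w = g \<otimes>\<^bsub>F2\<^esub> w \<otimes>\<^bsub>F2\<^esub> inv\<^bsub>F2\<^esub> g"
  by (simp add: inn_def)

lemma F2_cancel [simp]: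
  assumes "u \<in> carrier F2" "v \<in> carrier F2"
  shows "inv\<^bsub>F2\<^esub> u \<otimes>\<^bsub>F2\<^esub> (u \<otimes>\<^bsub>F2\<^esub> v) = v" "u \<otimes>\<^bsub>F2\<^esub> (inv\<^bsub>F2\<^esub> u \<otimes>\<^bsub>F2\<^esub> v) = v"
  using assms by (simp_all flip: F2.m_assoc)

lemma inn_closed [simp]:
  assumes g: "g \<in> carrier F2"
  shows "inn g \<in> carrier Aut2"
proof -
  have "inn g \<in> hom F2 F2"
    using g by (auto simp: hom_def F2.m_assoc)
  moreover have "bij_betw (inn g) (carrier F2) (carrier F2)"
    by (rule bij_betw_byWitness [of _ "inn (inv\<^bsub>F2\<^esub> g)"])
      (use g in \<open>auto simp: F2.m_assoc\<close>)
  ultimately show ?thesis by (simp add: AutoGroup_def auto_def Bij_def inn_def)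
qed

lemma inn_mult: "g \<in> carrier F2 \<Longrightarrow> h \<in> carrier F2 \<Longrightarrow> inn (g \<otimes>\<^bsub>F2\<^esub> h) = inn g \<otimes>\<^bsub>Aut2\<^esub> inn h"
  by (rule aut_eqI) (auto simp: F2.m_assoc F2.inv_mult_group)

lemma inn_one: "inn \<one>\<^bsub>F2\<^esub> = \<one>\<^bsub>Aut2\<^esub>"
  by (rule aut_eqI) auto

lemma aut_inn: "\<phi> \<in> carrier Aut2 \<Longrightarrow> g \<in> carrier F2 \<Longrightarrow>
    \<phi> \<otimes>\<^bsub>Aut2\<^esub> inn g = inn (\<phi> g) \<otimes>\<^bsub>Aut2\<^esub> \<phi>"
  by (rule aut_eqI) (auto simp: aut_mult aut_inv)

lemma inn_hom: "inn \<in> hom F2 Aut2"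
  by (auto simp: hom_def inn_mult)

section \<open>The action on the abelianization as an integer matrix\<close>

definition abmat :: "(2 word \<Rightarrow> 2 word) \<Rightarrow> mat2"
  where "abmat \<phi> = (expx (\<phi> gx), expx (\<phi> gy), expy (\<phi> gx), expy (\<phi> gy))"

lemma exp_aut:
  assumes "\<phi> \<in> carrier Aut2" "w \<in> carrier F2"
  shows "expx (\<phi> w) = expx (\<phi> gx) * expx w + expx (\<phi> gy) * expy w"
    "expy (\<phi> w) = expy (\<phi> gx) * expx w + expy (\<phi> gy) * expy w"
  by (rule F2_hom_eqI [OF group_integer_group, of "\<lambda>w. expx (\<phi> w)"
        "\<lambda>w. expx (\<phi> gx) * expx w + expx (\<phi> gy) * expy w"];
      use assms in \<open>simp add: hom_def aut_mult algebra_simps\<close>)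
     (rule F2_hom_eqI [OF group_integer_group, of "\<lambda>w. expy (\<phi> w)"
        "\<lambda>w. expy (\<phi> gx) * expx w + expy (\<phi> gy) * expy w"];
      use assms in \<open>simp add: hom_def aut_mult algebra_simps\<close>)

lemma mat_mult:
  "\<phi> \<in> carrier Aut2 \<Longrightarrow> \<psi> \<in> carrier Aut2 \<Longrightarrow> abmat (\<phi> \<otimes>\<^bsub>Aut2\<^esub> \<psi>) = mmul (abmat \<phi>) (abmat \<psi>)"
  by (simp add: abmat_def exp_aut [of \<phi> "\<psi> gx"] exp_aut [of \<phi> "\<psi> gy"])

lemma mat_one [simp]: "abmat \<one>\<^bsub>Aut2\<^esub> = (1, 0, 0, 1)"
  by (simp add: abmat_def)

lemma mat_inn [simp]: "g \<in> carrier F2 \<Longrightarrow> abmat (inn g) = (1, 0, 0, 1)"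
  by (simp add: abmat_def)

lemma coset_eq_powers:
  assumes "w \<in> carrier F2"
  shows "derived F2 (carrier F2) #>\<^bsub>F2\<^esub> w =
    ab_gen 1 [^]\<^bsub>abelianization F2\<^esub> expx w \<otimes>\<^bsub>abelianization F2\<^esub>
    ab_gen 2 [^]\<^bsub>abelianization F2\<^esub> expy w"
proof -
  interpret A: comm_group "abelianization F2"
    by (rule comm_group_abelianization [OF group_free_group])
  have "(\<lambda>w. ab_gen 1 [^]\<^bsub>abelianization F2\<^esub> expx w \<otimes>\<^bsub>abelianization F2\<^esub>
      ab_gen 2 [^]\<^bsub>abelianization F2\<^esub> expy w) \<in> hom F2 (abelianization F2)"
    by (rule homI) (auto simp: A.int_pow_mult A.m_ac)
  from F2_hom_eqI [OF A.is_group coset_hom this _ _ assms] show ?thesis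
    by (simp add: ab_gen_def [symmetric])
qed

lemma ab_matrix_rho:
  assumes "\<phi> \<in> carrier Aut2"
  shows "\<forall>j. ab_matrix (rho \<phi>) $ 1 $ j = expx (\<phi> (gen j)) \<and> ab_matrix (rho \<phi>) $ 2 $ j = expy (\<phi>
      (gen j))"
proof -
  let ?A = "abelianization F2" and ?D = "derived F2 (carrier F2)"
  have hom: "rho \<phi> \<in> hom ?A ?A"
    using rho_closed [OF assms] by (simp add: AutoGroup_def auto_def)
  have "\<phi> ` carrier F2 = carrier F2" using aut_bij [OF assms] by (simp add: bij_betw_def)
  then have D: "\<phi> ` ?D = ?D"
    using group_hom.derived_img [OF aut_group_hom [OF assms] subset_refl] by simp
  have Dsub: "?D \<subseteq> carrier F2" by (rule F2.derived_in_carrier) simp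
  have "\<phi> ` (?D #>\<^bsub>F2\<^esub> gen j) = (\<lambda>d. d \<otimes>\<^bsub>F2\<^esub> \<phi> (gen j)) ` (\<phi> ` ?D)" for j
    using Dsub by (force simp: r_coset_def aut_mult [OF assms])
  then have "rho \<phi> (ab_gen j) = ?D #>\<^bsub>F2\<^esub> \<phi> (gen j)" for j
    unfolding D by (simp add: rho_def r_coset_def flip: ab_gen_def) (auto simp: ab_gen_def
        r_coset_def)
  then have *: "rho \<phi> (ab_gen j) = ab_gen 1 [^]\<^bsub>?A\<^esub> expx (\<phi> (gen j)) \<otimes>\<^bsub>?A\<^esub>
      ab_gen 2 [^]\<^bsub>?A\<^esub> expy (\<phi> (gen j))" for j
    using coset_eq_powers [OF aut_closed [OF assms gen_closed]] by simp
  let ?B = "(\<chi> i j. if i = 1 then expx (\<phi> (gen j)) else expy (\<phi> (gen j))) :: int^2^2"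
  have "ab_matrix (rho \<phi>) = ?B"
    unfolding ab_matrix_def by (rule the1_equality [OF ab_matrix_ex1 [OF hom]]) (simp add: *)
  then show ?thesis by simp
qed

text \<open>Replaces the quotient group and the matrix chosen by \<open>THE\<close> with exponent
  sums of the images of the generators.\<close>

lemma Aut_plus_iff: "\<phi> \<in> Aut_plus \<longleftrightarrow> \<phi> \<in> carrier Aut2 \<and> abmat \<phi> \<in> carrier SL2"
proof (cases "\<phi> \<in> carrier Aut2")
  case True
  then show ?thesis
    using ab_matrix_rho [OF True] by (simp add: Aut_plus_def SL2Z_def det_2 abmat_def)
qed (simp add: Aut_plus_def)

section \<open>Nielsen reduction\<close>

abbreviation fmul :: "'a word \<Rightarrow> 'a word \<Rightarrow> 'a word" (infixr "\<odot>" 70)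
  where "u \<odot> v \<equiv> foldr push u v"

definition winv :: "'a word \<Rightarrow> 'a word"
  where "winv w = rev (map flip w)"

text \<open>The number of letters lost on each side in the product; for reduced words the difference
  of the lengths is even, so the division is exact.\<close>

definition canc :: "'a word \<Rightarrow> 'a word \<Rightarrow> nat"
  where "canc u v = (length u + length v - length (u \<odot> v)) div 2"

lemma length_winv [simp]: "length (winv w) = length w"
  by (simp add: winv_def)

lemma winv_append [simp]: "winv (u @ v) = winv v @ winv u"
  by (simp add: winv_def)

lemma winv_winv [simp]: "winv (winv u) = u"
  by (simp add: winv_def rev_map comp_def)

lemma winv_Nil_iff [simp]: "winv u = [] \<longleftrightarrow> u = []"
  by (simp add: winv_def)

lemma reduced_winv [simp]: "reduced (winv u) \<longleftrightarrow> reduced u"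
  using reduced_inverse [of u] reduced_inverse [of "winv u"] winv_winv [of u] by (auto simp: winv_def)

lemma reduced_append: "reduced (u @ v) \<Longrightarrow> reduced u \<and> reduced v"
  by (auto simp: reduced_def successively_append_iff)

lemma reduced_append3:
  "reduced (u @ v) \<Longrightarrow> reduced (v @ w) \<Longrightarrow> v \<noteq> [] \<Longrightarrow> reduced (u @ v @ w)"
  by (auto simp: reduced_def successively_append_iff)

lemma reduced_append_fmul: "reduced (u @ v) \<Longrightarrow> u \<odot> v = u @ v"
  using foldr_push_Nil [of "u @ v"] foldr_push_Nil [of v] reduced_append [of u v] by simp

lemma cancellation:
  assumes "reduced u" "reduced v"
  obtains u' c v' where "u = u' @ c" "v = winv c @ v'" "u \<odot> v = u' @ v'" "reduced (u' @ v')"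
    "length c = canc u v"
proof -
  have "\<exists>u' c v'. u = u' @ c \<and> v = winv c @ v' \<and> u \<odot> v = u' @ v'"
    using assms
  proof (induction u)
    case (Cons k u)
    then obtain u' c v' where *: "u = u' @ c" "v = winv c @ v'" "u \<odot> v = u' @ v'"
      by (auto simp: reduced_Cons)
    show ?case
    proof (cases "u' = []")
      case False
      then obtain l u'' where "u' = l # u''" by (cases u') auto
      then have "(k # u) \<odot> v = (k # u') @ v'" using * Cons.prems by (auto simp: reduced_Cons)
      then show ?thesis using * by (intro exI [of _ "k # u'"] exI [of _ c] exI [of _ v']) simp
    next
      case u': True
      show ?thesis
      proof (cases "v' \<noteq> [] \<and> hd v' = flip k")
        case True
        then obtain v'' where "v' = flip k # v''" by (cases v') auto
        then show ?thesis using * u'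
          by (intro exI [of _ "[]"] exI [of _ "k # c"] exI [of _ v'']) (simp add: winv_def)
      next
        case False
        then show ?thesis using * u'
          by (intro exI [of _ "[k]"] exI [of _ c] exI [of _ v'], cases v') auto
      qed
    qed
  qed (simp add: winv_def)
  then obtain u' c v' where *: "u = u' @ c" "v = winv c @ v'" "u \<odot> v = u' @ v'" by blast
  moreover have "reduced (u \<odot> v)" by (rule reduced_foldr_push [OF assms(2)])
  moreover have "length c = canc u v" unfolding canc_def *(3) unfolding *(1,2) by simp
  ultimately show ?thesis using that by metis
qed

lemma length_fmul:
  assumes "reduced u" "reduced v"
  shows "length (u \<odot> v) + 2 * canc u v = length u + length v"
  by (rule cancellation [OF assms]) (simp add: canc_def)

text \<open>The cancelled suffix of \<open>w\<close> is the inverse of a prefix. If it reached the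
  middle, the middle letter would be its own inverse (odd length), or the two middle letters would
  cancel (even length).\<close>

lemma canc_self:
  assumes w: "reduced w" "w \<noteq> []"
  shows "2 * canc w w < length w"
proof (rule ccontr)
  assume neg: "\<not> ?thesis"
  obtain u' c v' where *: "w = u' @ c" "w = winv c @ v'" "length c = canc w w"
    using cancellation [OF w(1) w(1)] by metis
  let ?k = "length c" and ?n = "length w"
  have mirror: "w ! i = flip (w ! (?n - 1 - i))" if "i < ?k" for i
  proof -
    have "w ! i = winv c ! i" using that *(2) by (metis length_winv nth_append)
    also have "\<dots> = flip (c ! (?k - 1 - i))" using that by (simp add: winv_def rev_nth)
    also have "c ! (?k - 1 - i) = w ! (length u' + (?k - 1 - i))"
      by (subst *(1), subst nth_append_length_plus) simp
    also have "length u' + (?k - 1 - i) = ?n - 1 - i" using that arg_cong [OF *(1), of length] by simp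
    finally show ?thesis .
  qed
  have n: "?n \<le> 2 * ?k" "0 < ?n" using neg w(2) unfolding *(3) by auto
  show False
  proof (cases "odd ?n")
    case True
    then obtain j where j: "?n = 2 * j + 1" by (elim oddE)
    then have "j < ?k" "?n - 1 - j = j" using n by auto
    then show False using mirror [of j] by simp
  next
    case False
    then obtain i where "?n = 2 * i" by (auto elim: evenE)
    then obtain j where j: "?n = 2 * Suc j" using n(2) by (cases i) auto
    then have "j < ?k" "?n - 1 - j = Suc j" "Suc j < ?n" using n(1) by auto
    moreover have "w ! Suc j \<noteq> flip (w ! j)"
      using w(1) \<open>Suc j < ?n\<close> unfolding reduced_def successively_conv_nth by blast
    ultimately show False using mirror [of j] flip_flip by metis
  qed
qed

text \<open>Nielsen's condition on the letters \<open>l\<close>: in \<open>X k \<odot> X l \<odot> X m\<close> the two cancellations do not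
  exhaust \<open>X l\<close>, so every letter of a reduced word leaves a trace in the product.\<close>

lemma nielsen_length:
  fixes X :: "'a \<times> bool \<Rightarrow> 'b word"
  assumes red: "\<And>l. reduced (X l)"
    and single: "\<And>k l. l \<noteq> flip k \<Longrightarrow> canc (X k) (X l) < length (X k)"
    and triple: "\<And>k l m. l \<noteq> flip k \<Longrightarrow> m \<noteq> flip l \<Longrightarrow>
      canc (X k) (X l) + canc (X l) (X m) < length (X l)"
    and w: "reduced w"
  shows "length w \<le> length (foldr (\<lambda>l. fmul (X l)) w [])"
proof -
  let ?P = "\<lambda>w. foldr (\<lambda>l. fmul (X l)) w []"
  have ne: "X l \<noteq> []" for l
    using single [of l l] by auto
  \<comment> \<open>\<open>q\<close> is the suffix of \<open>X l\<close> cancelled by the next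
    factor and \<open>p\<close> is what survives. A further factor on the left eats into
    \<open>p\<close> without exhausting it, so \<open>u\<close> gains at least one letter per
    factor.\<close>
  have "\<exists>p u q. ?P (l # w) = p @ u \<and> X l = p @ q \<and> p \<noteq> [] \<and> length w \<le> length u \<and> reduced (p @ u) \<and>
      length q = (case w of [] \<Rightarrow> 0 | k # _ \<Rightarrow> canc (X l) (X k))" if "reduced (l # w)" for l w
    using that
  proof (induction w arbitrary: l)
    case Nil
    show ?case using ne red
      by (intro exI [of _ "X l"] exI [of _ "[]"]) (auto simp: foldr_push_Nil)
  next
    case (Cons k w)
    then have "reduced (k # w)" and kl: "k \<noteq> flip l" by (auto simp: reduced_Cons)
    then obtain p u q where IH: "?P (k # w) = p @ u" "X k = p @ q" "p \<noteq> []" "length w \<le> length u"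
      "reduced (p @ u)" "length q = (case w of [] \<Rightarrow> 0 | m # _ \<Rightarrow> canc (X k) (X m))"
      using Cons.IH by blast
    obtain g c h where g: "X l = g @ c" "X k = winv c @ h" "reduced (g @ h)"
      "length c = canc (X l) (X k)" using cancellation [OF red red] by metis
    have "length c < length p"
    proof (cases w)
      case Nil
      have "canc (X l) (X k) < length (X k)" using triple [OF kl, of k] by simp
      then show ?thesis using g(4) IH(2,6) Nil by simp
    next
      case (Cons m w')
      have "m \<noteq> flip k" using \<open>reduced (k # w)\<close> Cons by (simp add: reduced_Cons)
      from triple [OF kl this] show ?thesis using g(4) IH(2,6) Cons by simp
    qed
    then obtain p' where p': "p = winv c @ p'" "h = p' @ q" "p' \<noteq> []"
    proof -
      have "p @ q = winv c @ h" using g(2) IH(2) by simp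
      then consider us where "p = winv c @ us" "us @ q = h" | us where "p @ us = winv c"
        unfolding append_eq_append_conv2 by blast
      then show ?thesis
      proof cases
        case 1
        then show ?thesis using \<open>length c < length p\<close> by (intro that [of us]) auto
      next
        case 2
        then have "length p + length us = length c" by (metis length_append length_winv)
        then show ?thesis using \<open>length c < length p\<close> by simp
      qed
    qed
    have "reduced (g @ p' @ u)"
      using g(3) p' IH(5) reduced_append reduced_append3 [of g p' u] by (metis append_assoc)
    moreover have "?P (l # k # w) = g @ p' @ u"
    proof -
      have "?P (l # k # w) = (g @ c) \<odot> (winv c @ p' @ u)" using IH(1) g(1) p'(1) by simp
      also have "\<dots> = g \<odot> (c \<odot> (winv c @ p' @ u))" by simp
      also have "winv c @ p' @ u = winv c \<odot> (p' @ u)"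
        using IH(5) p'(1) by (intro reduced_append_fmul [symmetric]) simp
      also have "c \<odot> (winv c \<odot> (p' @ u)) = (c \<odot> winv c) \<odot> (p' @ u)"
        using IH(5) p'(1) reduced_append by (intro foldr_push_assoc [symmetric]) fastforce
      also have "c \<odot> winv c = []"
        using foldr_push_inverse [of "winv c"] by (simp add: winv_winv [unfolded winv_def] winv_def)
      also have "g \<odot> ([] \<odot> (p' @ u)) = g @ p' @ u"
        using \<open>reduced (g @ p' @ u)\<close> by (simp add: reduced_append_fmul)
      finally show ?thesis .
    qed
    moreover have "g \<noteq> []" using single [OF kl] g by auto
    moreover have "length (k # w) \<le> length (p' @ u)" using IH(4) p'(3) by (cases p') auto
    ultimately show ?case using g(1,4) by (intro exI [of _ g] exI [of _ "p' @ u"] exI [of _ c]) simp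
  qed
  note main = this
  show ?thesis
  proof (cases w)
    case (Cons l v)
    then obtain p u where "?P w = p @ u" "p \<noteq> []" "length v \<le> length u"
      using main [of l v] w by blast
    then show ?thesis using Cons by (cases p) (auto simp del: foldr.simps)
  qed simp
qed

lemma F2_carrier: "w \<in> carrier F2 \<longleftrightarrow> reduced w"
  by (simp add: free_group_def)

lemma F2_mult: "u \<otimes>\<^bsub>F2\<^esub> v = u \<odot> v"
  by (simp add: free_group_def)

lemma F2_one: "\<one>\<^bsub>F2\<^esub> = []"
  by (simp add: free_group_def)

lemma F2_inv: "reduced w \<Longrightarrow> inv\<^bsub>F2\<^esub> w = winv w"
  by (rule F2.inv_equality)
    (simp_all add: F2_carrier F2_mult F2_one winv_def foldr_push_inverse reduced_inverse)

lemma winv_fmul: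
  fixes u v :: "2 word"
  assumes "reduced u" "reduced v"
  shows "winv (u \<odot> v) = winv v \<odot> winv u"
  using F2.inv_mult_group [of u v] assms
  by (simp add: F2_carrier F2_mult F2_inv reduced_foldr_push)

text \<open>A pair of least total length satisfies Nielsen's condition. By
  \<open>nielsen_length\<close> each generator, having length one, is then a single letter
  \<open>X l\<close>. Closure under simultaneous conjugation takes the place of the usual
  tie-breaking order on words.\<close>

lemma nielsen:
  fixes Q :: "(2 word \<times> 2 word) set"
  assumes red: "\<And>p q. (p, q) \<in> Q \<Longrightarrow> reduced p \<and> p \<noteq> []"
    and swap: "\<And>p q. (p, q) \<in> Q \<Longrightarrow> (q, p) \<in> Q"
    and inverse: "\<And>p q. (p, q) \<in> Q \<Longrightarrow> (p, winv q) \<in> Q"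
    and mult: "\<And>p q. (p, q) \<in> Q \<Longrightarrow> (p, p \<odot> q) \<in> Q"
    and conj: "\<And>p q g. (p, q) \<in> Q \<Longrightarrow> reduced g \<Longrightarrow>
      (g \<odot> p \<odot> winv g, g \<odot> q \<odot> winv g) \<in> Q"
    and gen: "\<And>p q i. (p, q) \<in> Q \<Longrightarrow>
      \<exists>w \<in> carrier F2. lift_free F2 (\<lambda>i. if i = 1 then p else q) w = gen i"
    and ne: "Q \<noteq> {}"
  shows "(gx, gy) \<in> Q"
proof -
  obtain p q where pq: "(p, q) \<in> Q"
    and min: "\<And>p' q'. (p', q') \<in> Q \<Longrightarrow> length p + length q \<le> length p' + length q'"
    using arg_min_nat_lemma [of "\<lambda>z. z \<in> Q" _ "\<lambda>(p, q). length p + length q"] ne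
    by (metis (no_types, lifting) case_prod_conv ex_in_conv surj_pair)
  define X where "X = (\<lambda>l :: 2 \<times> bool. let g = if fst l = 1 then p else q in if snd l then g
      else winv g)"
  have X_flip: "X (flip l) = winv (X l)" for l
    by (simp add: X_def Let_def flip_def)
  have XQ: "(X k, X l) \<in> Q" if "fst k \<noteq> fst l" for k l
  proof -
    have 1: "(winv p', q') \<in> Q" if "(p', q') \<in> Q" for p' q' using that inverse swap by blast
    have "fst k = 1 \<and> fst l = 2 \<or> fst k = 2 \<and> fst l = 1"
      using that exhaust_2 by metis
    then show ?thesis using pq by (elim disjE) (auto simp: X_def Let_def intro: 1 inverse swap)
  qed
  have other: "\<exists>k :: 2 \<times> bool. fst k \<noteq> fst l" for l :: "2 \<times> bool"
    by (rule exI [of _ "(fst l + 1, True)"]) simp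
  have X: "reduced (X l)" "X l \<noteq> []" for l
    using red XQ other [of l] swap by metis+
  have M: "length (X k) + length (X l) = length p + length q" if "fst k \<noteq> fst l" for k l
  proof -
    have "fst k = 1 \<and> fst l = 2 \<or> fst k = 2 \<and> fst l = 1"
      using that exhaust_2 by metis
    then show ?thesis by (elim disjE) (auto simp: X_def Let_def)
  qed
  \<comment> \<open>Otherwise replacing one member of the pair by the product, while keeping the
    other, would shorten the pair.\<close>
  have half: "2 * canc (X k) (X l) \<le> length (X k)" "2 * canc (X k) (X l) \<le> length (X l)"
    if kl: "fst k \<noteq> fst l" for k l
  proof -
    have "fst (flip l) \<noteq> fst (flip k)" using kl by (simp add: flip_def)
    from mult [OF XQ [OF this]] have "(winv (X l), winv (X k \<odot> X l)) \<in> Q"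
      by (simp add: winv_fmul X X_flip)
    from min [OF this] show "2 * canc (X k) (X l) \<le> length (X l)"
      using length_fmul [OF X(1) X(1), of k l] M [OF kl] by simp
    from min [OF mult [OF XQ [OF kl]]] show "2 * canc (X k) (X l) \<le> length (X k)"
      using length_fmul [OF X(1) X(1), of k l] M [OF kl] by simp
  qed
  have same: "k = l" if "l \<noteq> flip k" "fst k = fst l" for k l :: "2 \<times> bool"
    using that by (auto simp: flip_def prod_eq_iff)
  have self: "2 * canc (X l) (X l) < length (X l)" for l
    by (rule canc_self [OF X])
  have single: "canc (X k) (X l) < length (X k)" if "l \<noteq> flip k" for k l
  proof (cases "fst k = fst l")
    case True
    then show ?thesis using same [OF that] self [of l] by simp
  next
    case False
    have "length (X k) > 0" using X by simp
    then show ?thesis using half [OF False] by linarith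
  qed
  \<comment> \<open>Failure means that both neighbours cancel exactly half of
    \<open>X l = winv c @ c'\<close>, where \<open>c\<close> and \<open>c'\<close> are distinct of
    equal length. This excludes \<open>m = flip k\<close> and leaves \<open>m = k\<close>, with
    \<open>X k = winv c' @ t @ c\<close>. The pair \<open>X l\<close>,
    \<open>X k \<odot> X l\<close>, conjugated by \<open>c'\<close>, becomes
    \<open>c' \<odot> winv c\<close>, \<open>t\<close>, which is shorter.\<close>
  have triple: "canc (X k) (X l) + canc (X l) (X m) < length (X l)"
    if lk: "l \<noteq> flip k" and ml: "m \<noteq> flip l" for k l m
  proof (rule ccontr)
    assume neg: "\<not> ?thesis"
    have kl: "fst k \<noteq> fst l"
    proof
      assume "fst k = fst l"
      then have "k = l" using same lk by blast
      moreover have "2 * canc (X l) (X m) \<le> length (X l)"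
        using half(1) [of l m] self [of l] same [OF ml] by (cases "fst l = fst m") auto
      ultimately show False using self [of l] neg by simp
    qed
    have lm: "fst l \<noteq> fst m"
    proof
      assume "fst l = fst m"
      then have "l = m" using same ml by blast
      then show False using self [of l] half(2) [OF kl] neg by simp
    qed
    have eq: "2 * canc (X k) (X l) = length (X l)" "2 * canc (X l) (X m) = length (X l)"
      using half(2) [OF kl] half(1) [OF lm] neg by auto
    obtain e c w2 where 1: "X k = e @ c" "X l = winv c @ w2" "length c = canc (X k) (X l)"
      using cancellation [OF X(1) X(1)] by metis
    obtain w1 c' f where 2: "X l = w1 @ c'" "X m = winv c' @ f" "length c' = canc (X l) (X m)"
      using cancellation [OF X(1) X(1)] by metis
    have len: "length c' = length c" using eq 1(3) 2(3) by simp
    have "length w1 = length (winv c)" using arg_cong [OF 2(1), of length] eq 1(3) 2(3) by simp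
    then have Xl: "X l = winv c @ c'" using 1(2) 2(1) by simp
    have c0: "c \<noteq> []" using Xl X(2) [of l] len by auto
    have "c \<noteq> c'"
    proof
      assume "c = c'"
      then have "winv c \<odot> c = winv c @ c" using reduced_append_fmul X(1) [of l] Xl by simp
      then show False using foldr_push_inverse [of c] c0 by (simp add: winv_def)
    qed
    have "m \<noteq> flip k"
    proof
      assume "m = flip k"
      then have "winv c @ winv e = winv c' @ f" using 1(1) 2(2) X_flip by simp
      then have "winv c = winv c'" using len by simp
      then show False using \<open>c \<noteq> c'\<close> winv_winv by metis
    qed
    moreover have "fst k = fst m" using kl lm exhaust_2 by metis
    ultimately have "m = k" using same by blast
    then have "e @ c = winv c' @ f" using 1(1) 2(2) by simp
    moreover have "length e \<ge> length (winv c')"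
      using half(1) [OF kl] arg_cong [OF 1(1), of length] 1(3) len by simp
    ultimately have ec: "e @ c = winv c' @ f" "length c' \<le> length e" by simp_all
    have "take (length c') e = take (length c') (e @ c)" using ec(2) by simp
    also have "\<dots> = winv c'" unfolding ec(1) by simp
    finally obtain t where e: "e = winv c' @ t" by (metis append_take_drop_id)
    have r: "reduced c" "reduced c'" "reduced t" "reduced (t @ c)" "reduced (winv c' @ t @ c)"
        "reduced (winv c @ c')"
      using X(1) [of k] 1(1) e X(1) [of l] Xl reduced_append
      by (metis append_assoc reduced_winv)+
    have Xk': "X k = inv\<^bsub>F2\<^esub> c' \<otimes>\<^bsub>F2\<^esub> (t \<otimes>\<^bsub>F2\<^esub> c)" and Xl': "X l = inv\<^bsub>F2\<^esub> c \<otimes>\<^bsub>F2\<^esub> c'"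
      using r by (simp_all add: F2_inv F2_mult 1(1) e Xl reduced_append_fmul)
    have "(X l, X k \<odot> X l) \<in> Q"
    proof -
      have "fst (flip l) \<noteq> fst (flip k)" using kl by (simp add: flip_def)
      from mult [OF XQ [OF this]] have "(winv (X l), winv (X k \<odot> X l)) \<in> Q"
        by (simp add: winv_fmul X X_flip)
      then show ?thesis using inverse swap winv_winv by metis
    qed
    from conj [OF this r(2)]
    have "(c' \<odot> X l \<odot> winv c', c' \<odot> (X k \<odot> X l) \<odot> winv c') \<in> Q" .
    moreover have "c' \<odot> (X k \<odot> X l) \<odot> winv c' = t"
    proof -
      have "c' \<otimes>\<^bsub>F2\<^esub> (((inv\<^bsub>F2\<^esub> c' \<otimes>\<^bsub>F2\<^esub> (t \<otimes>\<^bsub>F2\<^esub> c)) \<otimes>\<^bsub>F2\<^esub> (inv\<^bsub>F2\<^esub> c \<otimes>\<^bsub>F2\<^esub> c')) \<otimes>\<^bsub>F2\<^esub> inv\<^bsub>F2\<^esub>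
          c') = t"
        using r by (simp add: F2.m_assoc F2_carrier [symmetric])
      then show ?thesis using r(2) by (simp add: Xk' Xl' F2_mult F2_inv)
    qed
    moreover have "c' \<odot> X l \<odot> winv c' = c' \<odot> winv c"
    proof -
      have "c' \<otimes>\<^bsub>F2\<^esub> ((inv\<^bsub>F2\<^esub> c \<otimes>\<^bsub>F2\<^esub> c') \<otimes>\<^bsub>F2\<^esub> inv\<^bsub>F2\<^esub> c') = c' \<otimes>\<^bsub>F2\<^esub> inv\<^bsub>F2\<^esub> c"
        using r by (simp add: F2.m_assoc F2_carrier [symmetric])
      then show ?thesis using r(1,2) by (simp add: Xl' F2_mult F2_inv)
    qed
    moreover have "length (c' \<odot> winv c) \<le> 2 * length c"
      using length_fmul [of c' "winv c"] r len by simp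
    ultimately have "length p + length q \<le> 2 * length c + length t"
      using min by fastforce
    moreover have "length (X k) = length t + 2 * length c" using 1(1) e len by simp
    moreover have "0 < length (X l)" using X(2) by simp
    ultimately show False using M [OF kl] by linarith
  qed
  have "\<exists>l. gen i = X l" for i
  proof -
    obtain w :: "2 word" where w: "reduced w" "lift_free F2 (\<lambda>i. if i = 1 then p else q) w = gen i"
      using gen [OF pq] by (blast intro: F2_carrier [THEN iffD1])
    have rpq: "reduced p" "reduced q" using red pq swap by blast+
    have "lift_free F2 (\<lambda>i. if i = 1 then p else q) w = foldr (\<lambda>l. fmul (X l)) w []"
      unfolding lift_free_def F2_one F2_mult
      by (intro foldr_cong) (auto simp: X_def Let_def F2_inv rpq)
    with w(2) have g: "gen i = foldr (\<lambda>l. fmul (X l)) w []" by simp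
    have "length w \<le> 1"
      using nielsen_length [of X, OF X(1) single triple w(1)] g [symmetric] by (simp add: gen_def)
    then show ?thesis
    proof (cases w)
      case Nil
      then show ?thesis using g by (simp add: gen_def)
    next
      case (Cons l w')
      then have "gen i = X l \<odot> []" using g \<open>length w \<le> 1\<close> by simp
      then show ?thesis using foldr_push_Nil X(1) by metis
    qed
  qed
  then obtain k l where kl: "gx = X k" "gy = X l" by metis
  have "fst k \<noteq> fst l"
  proof
    assume "fst k = fst l"
    then have "l = k \<or> l = flip k" by (auto simp: flip_def prod_eq_iff)
    then have "gy = gx \<or> gy = winv gx" using kl X_flip by metis
    then show False by (auto simp: gen_def winv_def flip_def)
  qed
  then show ?thesis using XQ kl by metis
qed

section \<open>Automorphisms acting trivially on the abelianization\<close>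

definition autS :: "2 word \<Rightarrow> 2 word" where "autS = endo (inv\<^bsub>F2\<^esub> gy) gx"
definition autU :: "2 word \<Rightarrow> 2 word" where "autU = endo (inv\<^bsub>F2\<^esub> gy) (gx \<otimes>\<^bsub>F2\<^esub> gy)"
text \<open>An automorphism of determinant -1, needed because exchanging the two entries of a basis
  changes the sign of the determinant.\<close>

definition autE :: "2 word \<Rightarrow> 2 word" where "autE = endo gx (inv\<^bsub>F2\<^esub> gy)"

lemma endo_apply:
  assumes "p \<in> carrier F2" "q \<in> carrier F2"
  shows "endo p q gx = p" "endo p q gy = q"
    "u \<in> carrier F2 \<Longrightarrow> v \<in> carrier F2 \<Longrightarrow> endo p q (u \<otimes>\<^bsub>F2\<^esub> v) = endo p q u \<otimes>\<^bsub>F2\<^esub> endo p q v"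
    "u \<in> carrier F2 \<Longrightarrow> endo p q (inv\<^bsub>F2\<^esub> u) = inv\<^bsub>F2\<^esub> endo p q u"
  using endo_hom [OF assms] hom_mult [OF endo_hom(1) [OF assms]]
    group_hom.hom_inv [of F2 F2 "endo p q"]
  by (auto simp: group_hom_def group_hom_axioms_def group_free_group)

lemma autS_closed [simp]: "autS \<in> carrier Aut2"
  unfolding autS_def by (rule endo_auto [of _ _ gy "inv\<^bsub>F2\<^esub> gx"]) (simp_all add: endo_apply)

lemma autU_closed [simp]: "autU \<in> carrier Aut2"
  unfolding autU_def by (rule endo_auto [of _ _ "gy \<otimes>\<^bsub>F2\<^esub> gx" "inv\<^bsub>F2\<^esub> gx"])
    (simp_all add: endo_apply F2.inv_mult_group F2.m_assoc)

lemma autE_closed [simp]: "autE \<in> carrier Aut2"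
  unfolding autE_def by (rule endo_auto [of _ _ gx "inv\<^bsub>F2\<^esub> gy"]) (simp_all add: endo_apply)

lemma aut_gens [simp]: "autS gx = inv\<^bsub>F2\<^esub> gy" "autS gy = gx"
    "autU gx = inv\<^bsub>F2\<^esub> gy" "autU gy = gx \<otimes>\<^bsub>F2\<^esub> gy" "autE gx = gx" "autE gy = inv\<^bsub>F2\<^esub> gy"
  by (simp_all add: autS_def autU_def autE_def endo_apply)

lemma mat_gens [simp]: "abmat autS = matS" "abmat autU = matU" "abmat autE = (1, 0, 0, -1)"
  by (simp_all add: abmat_def)

text \<open>Defined by generation, so that facts can be proved along words before it is known that
  every automorphism of determinant one arises.\<close>

inductive_set special :: "(2 word \<Rightarrow> 2 word) set"
  where
    one: "\<one>\<^bsub>Aut2\<^esub> \<in> special"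
  | S: "\<phi> \<in> special \<Longrightarrow> autS \<otimes>\<^bsub>Aut2\<^esub> \<phi> \<in> special"
  | U: "\<phi> \<in> special \<Longrightarrow> autU \<otimes>\<^bsub>Aut2\<^esub> \<phi> \<in> special"
  | inn: "\<phi> \<in> special \<Longrightarrow> g \<in> carrier F2 \<Longrightarrow> inn g \<otimes>\<^bsub>Aut2\<^esub> \<phi> \<in> special"

lemma special_closed: "\<phi> \<in> special \<Longrightarrow> \<phi> \<in> carrier Aut2"
  by (induction rule: special.induct) auto

lemma special_mult: "\<phi> \<in> special \<Longrightarrow> \<psi> \<in> special \<Longrightarrow> \<phi> \<otimes>\<^bsub>Aut2\<^esub> \<psi> \<in> special"
  by (induction rule: special.induct)
    (auto simp: special_closed Aut2.m_assoc intro: special.intros)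

lemma special_gens: "autS \<in> special" "autU \<in> special" "g \<in> carrier F2 \<Longrightarrow> inn g \<in> special"
  using special.S [OF special.one] special.U [OF special.one] special.inn [OF special.one, of g]
  by auto

lemma special_surj:
  assumes "A \<in> carrier SL2"
  obtains \<phi> where "\<phi> \<in> special" "abmat \<phi> = A"
proof -
  have "\<exists>\<phi>\<in>special. abmat \<phi> = A" using assms
  proof (induction rule: SL2_induct)
    case one
    then show ?case using special.one mat_one by blast
  next
    case (S A)
    then obtain \<phi> where "\<phi> \<in> special" "abmat \<phi> = A" by blast
    then show ?case using special.S [of \<phi>] by (intro bexI [of _ "autS \<otimes>\<^bsub>Aut2\<^esub> \<phi>"]) (auto simp:
        mat_mult special_closed)
  next
    case (U A)
    then obtain \<phi> where "\<phi> \<in> special" "abmat \<phi> = A" by blast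
    then show ?case using special.U [of \<phi>] by (intro bexI [of _ "autU \<otimes>\<^bsub>Aut2\<^esub> \<phi>"]) (auto simp:
        mat_mult special_closed)
  qed
  then show ?thesis using that by blast
qed

section \<open>Outer automorphism classes and their matrices\<close>

definition Inn :: "(2 word \<Rightarrow> 2 word) set"
  where "Inn = inn ` carrier F2"

lemma Inn_normal: "Inn \<lhd> Aut2"
  unfolding Aut2.normal_inv_iff
proof (intro conjI ballI)
  show "subgroup Inn Aut2"
    unfolding Inn_def using group_hom.img_is_subgroup [of F2 Aut2 inn] inn_hom
    by (simp add: group_hom_def group_hom_axioms_def)
next
  fix \<phi> i assume \<phi>: "\<phi> \<in> carrier Aut2" and "i \<in> Inn"
  then obtain g where "g \<in> carrier F2" "i = inn g" by (auto simp: Inn_def)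
  then show "\<phi> \<otimes>\<^bsub>Aut2\<^esub> i \<otimes>\<^bsub>Aut2\<^esub> inv\<^bsub>Aut2\<^esub> \<phi> \<in> Inn"
    using \<phi> by (simp add: aut_inn Aut2.m_assoc Inn_def)
qed

interpretation Inn: normal Inn Aut2
  by (rule Inn_normal)

definition Out2 :: "(2 word \<Rightarrow> 2 word) set monoid"
  where "Out2 = Aut2 Mod Inn"

interpretation Out: group Out2
  unfolding Out2_def by (rule Inn.factorgroup_is_group)

definition out :: "(2 word \<Rightarrow> 2 word) \<Rightarrow> (2 word \<Rightarrow> 2 word) set"
  where "out \<phi> = Inn #>\<^bsub>Aut2\<^esub> \<phi>"

lemma out_hom: "out \<in> hom Aut2 Out2"
  unfolding out_def Out2_def by (rule Inn.r_coset_hom_Mod)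

lemma out_closed [simp]: "\<phi> \<in> carrier Aut2 \<Longrightarrow> out \<phi> \<in> carrier Out2"
  using hom_in_carrier [OF out_hom] .

lemma out_mult [simp]: "\<phi> \<in> carrier Aut2 \<Longrightarrow> \<psi> \<in> carrier Aut2 \<Longrightarrow>
    out \<phi> \<otimes>\<^bsub>Out2\<^esub> out \<psi> = out (\<phi> \<otimes>\<^bsub>Aut2\<^esub> \<psi>)"
  using hom_mult [OF out_hom] by simp

lemma out_inn [simp]: "g \<in> carrier F2 \<Longrightarrow> out (inn g) = \<one>\<^bsub>Out2\<^esub>"
  using Inn.rcos_const [OF Aut2.is_group, of "inn g"]
  by (simp add: Inn_def out_def Out2_def FactGroup_def)

lemma out_one [simp]: "out \<one>\<^bsub>Aut2\<^esub> = \<one>\<^bsub>Out2\<^esub>"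
  using out_inn [of "\<one>\<^bsub>F2\<^esub>"] by (simp add: inn_one del: out_inn)

lemma out_eq_one: "\<phi> \<in> carrier Aut2 \<Longrightarrow> out \<phi> = \<one>\<^bsub>Out2\<^esub> \<Longrightarrow> \<phi> \<in> Inn"
  using Aut2.rcos_self [OF _ Inn.subgroup_axioms, of \<phi>]
  by (simp add: out_def Out2_def FactGroup_def)

text \<open>For the lifts, \<open>U^3 = S^2\<close> holds only up to an inner automorphism, which is
  why the presentation is applied to \<open>Out2\<close>.\<close>

lemma aut_relations:
  "autS \<otimes>\<^bsub>Aut2\<^esub> (autS \<otimes>\<^bsub>Aut2\<^esub> (autS \<otimes>\<^bsub>Aut2\<^esub> autS)) = \<one>\<^bsub>Aut2\<^esub>"
  "autU \<otimes>\<^bsub>Aut2\<^esub> (autU \<otimes>\<^bsub>Aut2\<^esub> autU) =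
    inn (inv\<^bsub>F2\<^esub> (gx \<otimes>\<^bsub>F2\<^esub> gy)) \<otimes>\<^bsub>Aut2\<^esub> (autS \<otimes>\<^bsub>Aut2\<^esub> autS)"
  by (rule aut_eqI; simp add: aut_inv aut_mult F2.inv_mult_group F2.m_assoc)+

text \<open>Left multiplication by the classes of the two lifts. The action of \<open>SL2\<close>
  obtained from it shows that the outer class of a product of lifts depends on its matrix
  alone.\<close>

interpretation Out: SU_action "carrier Out2"
  "\<lambda>C. out autS \<otimes>\<^bsub>Out2\<^esub> C" "\<lambda>C. out autU \<otimes>\<^bsub>Out2\<^esub> C"
proof
  fix C assume C: "C \<in> carrier Out2"
  then show "out autS \<otimes>\<^bsub>Out2\<^esub> C \<in> carrier Out2"
    "out autU \<otimes>\<^bsub>Out2\<^esub> C \<in> carrier Out2"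
    by simp_all
  let ?m = "\<lambda>a b. a \<otimes>\<^bsub>Out2\<^esub> b"
  have "?m (out autS) (?m (out autS) (?m (out autS) (?m (out autS) C))) =
      ?m (?m (out autS) (?m (out autS) (?m (out autS) (out autS)))) C"
    using C by (simp only: Out.m_assoc out_closed autS_closed Out.m_closed)
  also have "\<dots> = C"
    using C by (simp add: aut_relations(1))
  finally show "?m (out autS) (?m (out autS) (?m (out autS) (?m (out autS) C))) = C" .
  have "?m (out autU) (?m (out autU) (?m (out autU) C)) =
      ?m (?m (out autU) (?m (out autU) (out autU))) C"
    using C by (simp only: Out.m_assoc out_closed autU_closed Out.m_closed)
  also have "\<dots> = ?m (out (inn (inv\<^bsub>F2\<^esub> (gx \<otimes>\<^bsub>F2\<^esub> gy)) \<otimes>\<^bsub>Aut2\<^esub> (autS \<otimes>\<^bsub>Aut2\<^esub> autS))) C"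
    by (simp only: out_mult autU_closed Aut2.m_closed aut_relations(2))
  also have "\<dots> = ?m (?m (out autS) (out autS)) C"
    by (simp del: out_mult flip: out_mult)
  also have "\<dots> = ?m (out autS) (?m (out autS) C)"
    using C by (simp only: Out.m_assoc out_closed autS_closed)
  finally show "?m (out autU) (?m (out autU) (?m (out autU) C)) = ?m (out autS) (?m (out autS) C)" .
qed

lemma special_act:
  "\<phi> \<in> special \<Longrightarrow> abmat \<phi> \<in> carrier SL2 \<and> Out.act (abmat \<phi>) (out \<one>\<^bsub>Aut2\<^esub>) = out \<phi>"
proof (induction rule: special.induct)
  case one
  show ?case using Out.act_one [of "out \<one>\<^bsub>Aut2\<^esub>"] by simp
next
  case (S \<phi>)
  interpret SL2: group SL2 by (rule group_SL2)
  have "mmul matS (abmat \<phi>) \<in> carrier SL2" using S SL2.m_closed [OF matS_closed] by auto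
  then show ?case
    using S by (simp add: mat_mult special_closed Out.act_mult [OF matS_closed] Out.act_S
        del: mmul.simps SL2_carrier)
next
  case (U \<phi>)
  interpret SL2: group SL2 by (rule group_SL2)
  have "mmul matU (abmat \<phi>) \<in> carrier SL2" using U SL2.m_closed [OF matU_closed] by auto
  then show ?case
    using U by (simp add: mat_mult special_closed Out.act_mult [OF matU_closed] Out.act_U
        del: mmul.simps SL2_carrier)
next
  case (inn \<phi> g)
  have "out (inn g \<otimes>\<^bsub>Aut2\<^esub> \<phi>) = out (inn g) \<otimes>\<^bsub>Out2\<^esub> out \<phi>"
    using inn by (simp add: special_closed del: out_inn)
  also have "\<dots> = out \<phi>" using inn by (simp add: special_closed)
  finally show ?case using inn by (simp add: mat_mult special_closed)
qed

lemma special_inner: "\<phi> \<in> special \<Longrightarrow> abmat \<phi> = (1, 0, 0, 1) \<Longrightarrow> \<phi> \<in> Inn"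
  using special_act [of \<phi>] Out.act_one [of "out \<one>\<^bsub>Aut2\<^esub>"] special_closed [of \<phi>]
  by (intro out_eq_one) auto

text \<open>Nielsen reduction carries the image of the basis back to the basis by special
  automorphisms. Hence \<open>\<phi>\<close> is inverse to a special automorphism; that one has
  trivial matrix too, and is inner by \<open>special_inner\<close>.\<close>

theorem mat_kernel:
  assumes \<phi>: "\<phi> \<in> carrier Aut2" and mat: "abmat \<phi> = (1, 0, 0, 1)"
  shows "\<phi> \<in> Inn"
proof -
  define P where "P = {\<phi> \<otimes>\<^bsub>Aut2\<^esub> \<theta> | \<theta>. \<theta> \<in> special}"
  \<comment> \<open>The images of the basis under products of \<open>\<phi>\<close> with special
    automorphisms, with and without a final \<open>autE\<close>; the latter makes the set closed
    under exchanging the entries.\<close>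
  define Q where "Q = {(\<psi> gx, \<psi> gy) | \<psi>. \<psi> \<in> P \<or> (\<exists>\<psi>'\<in>P. \<psi> = \<psi>' \<otimes>\<^bsub>Aut2\<^esub> autE)}"
  have P_closed: "\<psi> \<in> carrier Aut2" if "\<psi> \<in> P" for \<psi>
    using that \<phi> by (auto simp: P_def special_closed)
  have P_mult: "\<psi> \<otimes>\<^bsub>Aut2\<^esub> \<theta> \<in> P" if "\<psi> \<in> P" "\<theta> \<in> special" for \<psi> \<theta>
    using that \<phi> by (auto simp: P_def special_closed special_mult Aut2.m_assoc)
  have QI: "(p, q) \<in> Q" if "\<psi> \<in> P" "p = \<psi> gx" "q = \<psi> gy" for \<psi> p q
    using that unfolding Q_def by blast
  have QI': "(p, q) \<in> Q" if "\<psi> \<in> P" "p = \<psi> gx" "q = inv\<^bsub>F2\<^esub> \<psi> gy" for \<psi> p q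
    unfolding Q_def using that P_closed [OF that(1)]
    by (intro CollectI exI [of _ "\<psi> \<otimes>\<^bsub>Aut2\<^esub> autE"]) (auto simp: aut_inv)
  have QE: "(\<exists>\<psi>\<in>P. p = \<psi> gx \<and> q = \<psi> gy) \<or> (\<exists>\<psi>\<in>P. p = \<psi> gx \<and> q = inv\<^bsub>F2\<^esub> \<psi> gy)"
    if "(p, q) \<in> Q" for p q
    using that P_closed unfolding Q_def by (fastforce simp: aut_inv)
  \<comment> \<open>\<open>t\<close> multiplies the second basis element by the first from the left.
    \<open>t'\<close> does the same for a pair with inverted second entry, since
    \<open>x y^-1 = (y x^-1)^-1\<close>.\<close>
  define t where "t = autS \<otimes>\<^bsub>Aut2\<^esub> (autS \<otimes>\<^bsub>Aut2\<^esub> (inn gy \<otimes>\<^bsub>Aut2\<^esub> (autU \<otimes>\<^bsub>Aut2\<^esub> (autU \<otimes>\<^bsub>Aut2\<^esub> autS))))"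
  define t' where "t' = autS \<otimes>\<^bsub>Aut2\<^esub> (autS \<otimes>\<^bsub>Aut2\<^esub> (autS \<otimes>\<^bsub>Aut2\<^esub> autU))"
  have t: "t \<in> special" "t' \<in> special" and S2: "autS \<otimes>\<^bsub>Aut2\<^esub> (autS \<otimes>\<^bsub>Aut2\<^esub> autS) \<in> special"
    unfolding t_def t'_def by (intro special_mult special_gens gen_closed)+
  have t_gens: "t gx = gx" "t gy = gx \<otimes>\<^bsub>F2\<^esub> gy" "t' gx = gx" "t' gy = gy \<otimes>\<^bsub>F2\<^esub> inv\<^bsub>F2\<^esub> gx"
    unfolding t_def t'_def by (simp_all add: aut_inv aut_mult F2.inv_mult_group F2.m_assoc)
  have "(gx, gy) \<in> Q"
  proof (rule nielsen)
    fix p q assume Q: "(p, q) \<in> Q"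
    have "\<exists>\<psi>\<in>carrier Aut2. p = \<psi> gx \<and> q = \<psi> gy"
      using Q P_closed unfolding Q_def by auto
    then obtain \<psi> where \<psi>: "\<psi> \<in> carrier Aut2" "p = \<psi> gx" "q = \<psi> gy" by blast
    have "p \<noteq> \<one>\<^bsub>F2\<^esub>"
    proof
      assume "p = \<one>\<^bsub>F2\<^esub>"
      then have "gx = (inv\<^bsub>Aut2\<^esub> \<psi>) \<one>\<^bsub>F2\<^esub>"
        using Aut2_inv(2) [OF \<psi>(1) gen_closed, of 1] \<psi> by simp
      also have "\<dots> = \<one>\<^bsub>F2\<^esub>" using \<psi>(1) by (simp add: aut_one)
      finally have "gx = \<one>\<^bsub>F2\<^esub>" .
      then show False by (simp add: gen_def F2_one)
    qed
    then show "reduced p \<and> p \<noteq> []" using \<psi> by (simp add: F2_carrier [symmetric] F2_one)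
    have "lift_free F2 (\<lambda>i. if i = 1 then p else q) w = \<psi> w" if "w \<in> carrier F2" for w
      using \<psi> that exhaust_2
      by (intro free_group_universal(3) [symmetric]) (auto simp: group_free_group aut_hom)
    then show "\<exists>w\<in>carrier F2. lift_free F2 (\<lambda>i. if i = 1 then p else q) w = gen i" for i
      using \<psi> by (intro bexI [of _ "(inv\<^bsub>Aut2\<^esub> \<psi>) (gen i)"]) auto
    from QE [OF Q] show "(q, p) \<in> Q"
    proof (elim disjE bexE conjE)
      fix \<psi> assume "\<psi> \<in> P" "p = \<psi> gx" "q = \<psi> gy"
      then show ?thesis
        using P_closed by (intro QI' [OF P_mult [OF _ S2]]) (auto simp: aut_inv)
    qed (auto intro!: QI [OF P_mult [OF _ special_gens(1)]] simp: P_closed aut_inv)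
    from QE [OF Q] show "(p, winv q) \<in> Q"
    proof (elim disjE bexE conjE)
      fix \<psi> assume *: "\<psi> \<in> P" "p = \<psi> gx" "q = \<psi> gy"
      then have "reduced q" using P_closed by (simp add: F2_carrier [symmetric])
      then show ?thesis using * by (intro QI') (auto simp: F2_inv)
    next
      fix \<psi> assume *: "\<psi> \<in> P" "p = \<psi> gx" "q = inv\<^bsub>F2\<^esub> \<psi> gy"
      then have "reduced (\<psi> gy)" using P_closed by (simp add: F2_carrier [symmetric])
      then show ?thesis using * by (intro QI) (auto simp: F2_inv)
    qed
    from QE [OF Q] show "(p, p \<odot> q) \<in> Q"
    proof (elim disjE bexE conjE)
      fix \<psi> assume *: "\<psi> \<in> P" "p = \<psi> gx" "q = \<psi> gy"
      then show ?thesis using t t_gens P_closed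
        by (intro QI [OF P_mult [OF _ t(1)]]) (auto simp: aut_mult special_closed simp flip: F2_mult)
    next
      fix \<psi> assume *: "\<psi> \<in> P" "p = \<psi> gx" "q = inv\<^bsub>F2\<^esub> \<psi> gy"
      then show ?thesis using t t_gens P_closed
        by (intro QI' [OF P_mult [OF _ t(2)]])
          (auto simp: aut_mult aut_inv special_closed F2.inv_mult_group simp flip: F2_mult)
    qed
    fix g :: "2 word" assume "reduced g"
    then have g: "g \<in> carrier F2" "winv g = inv\<^bsub>F2\<^esub> g" by (simp_all add: F2_carrier F2_inv)
    from QE [OF Q] show "(g \<odot> p \<odot> winv g, g \<odot> q \<odot> winv g) \<in> Q"
    proof (elim disjE bexE conjE)
      fix \<psi> assume *: "\<psi> \<in> P" "p = \<psi> gx" "q = \<psi> gy"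
      note [simp] = P_closed [OF *(1)]
      let ?h = "(inv\<^bsub>Aut2\<^esub> \<psi>) g"
      have "\<psi> \<otimes>\<^bsub>Aut2\<^esub> inn ?h \<in> P" using *(1) g by (intro P_mult special_gens) auto
      then show ?thesis unfolding g(2) F2_mult [symmetric] using * g
        by (elim QI) (simp_all add: aut_mult aut_inv F2.m_assoc)
    next
      fix \<psi> assume *: "\<psi> \<in> P" "p = \<psi> gx" "q = inv\<^bsub>F2\<^esub> \<psi> gy"
      note [simp] = P_closed [OF *(1)]
      let ?h = "(inv\<^bsub>Aut2\<^esub> \<psi>) g"
      have "\<psi> \<otimes>\<^bsub>Aut2\<^esub> inn ?h \<in> P" using *(1) g by (intro P_mult special_gens) auto
      then show ?thesis unfolding g(2) F2_mult [symmetric] using * g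
        by (elim QI') (simp_all add: aut_mult aut_inv F2.m_assoc F2.inv_mult_group)
    qed
  next
    have "\<phi> \<in> P" using special.one \<phi> unfolding P_def by force
    then show "Q \<noteq> {}" using QI by blast
  qed
  then consider \<psi> where "\<psi> \<in> P" "gx = \<psi> gx" "gy = \<psi> gy" |
      \<psi> where "\<psi> \<in> P" "gx = \<psi> gx" "gy = inv\<^bsub>F2\<^esub> \<psi> gy"
    using QE by blast
  then show ?thesis
  proof cases
    case 1
    then have "\<psi> = \<one>\<^bsub>Aut2\<^esub>" using P_closed by (intro aut_eqI) auto
    then obtain \<theta> where \<theta>: "\<theta> \<in> special" "\<phi> \<otimes>\<^bsub>Aut2\<^esub> \<theta> = \<one>\<^bsub>Aut2\<^esub>" using 1 by (auto simp: P_def)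
    then have "abmat \<theta> = (1, 0, 0, 1)"
      using mat_mult [OF \<phi> special_closed [OF \<theta>(1)]] mat by simp
    then have "\<theta> \<in> Inn" using special_inner \<theta> by blast
    moreover have "\<phi> = inv\<^bsub>Aut2\<^esub> \<theta>"
      using Aut2.inv_equality [OF \<theta>(2)] \<phi> \<theta>(1) special_closed by simp
    ultimately show ?thesis by (simp add: Inn.m_inv_closed)
  next
    case 2
    then obtain \<theta> where \<theta>: "\<theta> \<in> special" "\<psi> = \<phi> \<otimes>\<^bsub>Aut2\<^esub> \<theta>" by (auto simp: P_def)
    have m: "abmat \<psi> = abmat \<theta>" using mat_mult [OF \<phi> special_closed [OF \<theta>(1)]] mat \<theta>(2) by simp
    have "\<psi> gy = inv\<^bsub>F2\<^esub> gy" using 2 P_closed by (metis F2.inv_inv aut_closed gen_closed)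
    \<comment> \<open>Here the determinant would be -1, although \<open>\<theta>\<close> is
      special.\<close>
    then have "abmat \<psi> = (1, 0, 0, -1)" using 2(2) by (simp add: abmat_def)
    then show ?thesis using special_act [OF \<theta>(1)] m by simp
  qed
qed

section \<open>The retraction onto the finite group\<close>

text \<open>The stabilizer, under composition, of the standard map from Z^2 onto Z/m x Z/n; each row
  preserves one coordinate.\<close>

definition Delta :: "nat \<Rightarrow> nat \<Rightarrow> mat2 set"
  where "Delta m n = {(a, b, c, d). a * d - b * c = 1 \<and>
    int m dvd a - 1 \<and> int m dvd b \<and> int n dvd c \<and> int n dvd d - 1}"

definition Gam :: "nat \<Rightarrow> nat \<Rightarrow> (2 word \<Rightarrow> 2 word) set"
  where "Gam m n = {\<phi> \<in> carrier Aut2. abmat \<phi> \<in> Delta m n}"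

abbreviation GG :: "nat \<Rightarrow> nat \<Rightarrow> (2 word \<Rightarrow> 2 word) monoid"
  where "GG m n \<equiv> Aut2\<lparr>carrier := Gam m n\<rparr>"

lemma Delta_subset: "Delta m n \<subseteq> carrier SL2"
  by (auto simp: Delta_def)

lemma Delta_subgroup: "subgroup (Delta m n) SL2"
proof (rule group.subgroupI [OF group_SL2])
  show "Delta m n \<subseteq> carrier SL2" by (rule Delta_subset)
  have "(1, 0, 0, 1) \<in> Delta m n" by (simp add: Delta_def)
  then show "Delta m n \<noteq> {}" by blast
next
  fix A assume A: "A \<in> Delta m n"
  obtain a b c d where Aeq: "A = (a, b, c, d)" by (cases A)
  have *: "a * d - b * c = 1" "int m dvd a - 1" "int m dvd b" "int n dvd c" "int n dvd d - 1"
    using A by (auto simp: Delta_def Aeq)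
  \<comment> \<open>The inverse has \<open>a\<close> and \<open>d\<close> exchanged; the determinant
    transfers the congruence from \<open>a\<close> to \<open>d\<close> modulo \<open>m\<close> and
    from \<open>d\<close> to \<open>a\<close> modulo \<open>n\<close>.\<close>
  have "d - 1 = b * c - (a - 1) * d" "a - 1 = b * c - (d - 1) * a"
    using *(1) by (simp_all add: algebra_simps)
  then have "int m dvd d - 1" "int n dvd a - 1"
    using * by (metis dvd_diff dvd_mult2, metis dvd_diff dvd_mult dvd_mult2)
  then show "inv\<^bsub>SL2\<^esub> A \<in> Delta m n"
    using * A Delta_subset by (subst inv_SL2) (auto simp: Aeq Delta_def algebra_simps)
next
  fix A B assume A: "A \<in> Delta m n" and B: "B \<in> Delta m n"
  obtain a b c d where Aeq: "A = (a, b, c, d)" by (cases A)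
  obtain a' b' c' d' where Beq: "B = (a', b', c', d')" by (cases B)
  have "A \<otimes>\<^bsub>SL2\<^esub> B \<in> carrier SL2"
    using A B Delta_subset by (intro monoid.m_closed [OF group.is_monoid [OF group_SL2]]) auto
  moreover have "a * a' + b * c' - 1 = (a - 1) * a' + (a' - 1) + b * c'"
    "c * b' + d * d' - 1 = c * b' + (d - 1) * d' + (d' - 1)" by (simp_all add: algebra_simps)
  moreover have "int m dvd (a - 1) * a' + (a' - 1) + b * c'" "int m dvd a * b' + b * d'"
    "int n dvd c * a' + d * c'" "int n dvd c * b' + (d - 1) * d' + (d' - 1)"
    using A B by (auto simp: Aeq Beq Delta_def intro!: dvd_add)
  ultimately show "A \<otimes>\<^bsub>SL2\<^esub> B \<in> Delta m n"
    by (simp only: Aeq Beq Delta_def SL2_mult mmul.simps SL2_carrier mem_Collect_eq prod.case)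
qed

lemma abmat_inv:
  assumes "\<phi> \<in> carrier Aut2" "abmat \<phi> \<in> carrier SL2"
  shows "abmat (inv\<^bsub>Aut2\<^esub> \<phi>) = inv\<^bsub>SL2\<^esub> (abmat \<phi>)"
proof -
  interpret SL2: group SL2 by (rule group_SL2)
  let ?A = "abmat \<phi>" and ?B = "abmat (inv\<^bsub>Aut2\<^esub> \<phi>)"
  have "mmul ?B ?A = (1, 0, 0, 1)"
    using mat_mult [of "inv\<^bsub>Aut2\<^esub> \<phi>" \<phi>] assms(1) Aut2.l_inv by simp
  then have "mmul (mmul ?B ?A) (inv\<^bsub>SL2\<^esub> ?A) = inv\<^bsub>SL2\<^esub> ?A" by simp
  moreover have "mmul ?A (inv\<^bsub>SL2\<^esub> ?A) = (1, 0, 0, 1)" using SL2.r_inv [OF assms(2)] by simp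
  ultimately show ?thesis by (simp add: mmul_assoc)
qed

lemma Gam_subgroup: "subgroup (Gam m n) Aut2"
proof (rule Aut2.subgroupI)
  have "\<one>\<^bsub>Aut2\<^esub> \<in> Gam m n" by (simp add: Gam_def Delta_def)
  then show "Gam m n \<noteq> {}" by blast
next
  fix \<phi> assume "\<phi> \<in> Gam m n"
  then have \<phi>: "\<phi> \<in> carrier Aut2" "abmat \<phi> \<in> Delta m n" by (simp_all add: Gam_def)
  then show "inv\<^bsub>Aut2\<^esub> \<phi> \<in> Gam m n"
    using subgroup.m_inv_closed [OF Delta_subgroup \<phi>(2)] abmat_inv [OF \<phi>(1) subsetD [OF
        Delta_subset \<phi>(2)]]
    by (simp add: Gam_def)
next
  fix \<phi> \<psi> assume "\<phi> \<in> Gam m n" "\<psi> \<in> Gam m n"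
  then show "\<phi> \<otimes>\<^bsub>Aut2\<^esub> \<psi> \<in> Gam m n"
    using subgroup.m_closed [OF Delta_subgroup, of "abmat \<phi>" m n "abmat \<psi>"] by (simp add:
        Gam_def mat_mult)
qed (auto simp: Gam_def)

lemma group_GG: "group (GG m n)"
  by (rule subgroup.subgroup_is_group [OF Gam_subgroup Aut2.is_group])

text \<open>The first-order coefficient in the Fox derivative of a power:
  \<open>1 + x + ... + x^(t-1)\<close> is \<open>t + choose2 t (x - 1)\<close> modulo the square of
  the augmentation ideal. The formula is also right for negative \<open>t\<close>.\<close>

definition choose2 :: "int \<Rightarrow> int"
  where "choose2 t = t * (t - 1) div 2"

lemma choose2: "2 * choose2 t = t * (t - 1)"
  by (simp add: choose2_def)

lemma choose2_simps [simp]: "choose2 0 = 0" "choose2 1 = 0"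
  by (simp_all add: choose2_def)

lemma choose2_add: "choose2 (s + t) = choose2 s + choose2 t + s * t"
proof -
  have "2 * choose2 (s + t) = 2 * (choose2 s + choose2 t + s * t)"
    by (simp only: choose2 distrib_left) (simp add: algebra_simps)
  then show ?thesis by simp
qed

lemma choose2_mult: "choose2 (s * t) = t * choose2 s + s\<^sup>2 * choose2 t"
proof -
  have "2 * choose2 (s * t) = t * (2 * choose2 s) + s\<^sup>2 * (2 * choose2 t)"
    by (simp only: choose2) (simp add: algebra_simps power2_eq_square)
  then show ?thesis by simp
qed

text \<open>A map that is additive only modulo \<open>m\<close> becomes a homomorphism into
  \<open>integer_mod_group m\<close>, so checking the generators suffices.\<close>

lemma dvd_hom_F2:
  fixes f :: "2 word \<Rightarrow> int"
  assumes "f gx = 0" "f gy = 0"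
    and "\<And>u v. u \<in> carrier F2 \<Longrightarrow> v \<in> carrier F2 \<Longrightarrow> int m dvd f (u \<otimes>\<^bsub>F2\<^esub> v) - f u - f v"
    and "w \<in> carrier F2" and "m > 0"
  shows "int m dvd f w"
proof -
  have "(\<lambda>w. f w mod int m) \<in> hom F2 (integer_mod_group m)"
  proof (rule homI)
    fix u v assume "u \<in> carrier F2" "v \<in> carrier F2"
    from assms(3) [OF this] have "f (u \<otimes>\<^bsub>F2\<^esub> v) mod int m = (f u + f v) mod int m"
      by (simp add: mod_eq_dvd_iff algebra_simps)
    then show "f (u \<otimes>\<^bsub>F2\<^esub> v) mod int m = (f u mod int m) \<otimes>\<^bsub>integer_mod_group m\<^esub> (f v mod int m)"
      by (simp add: mod_simps)
  qed (use assms(5) in \<open>simp add: carrier_integer_mod_group\<close>)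
  moreover have "(\<lambda>w. 0) \<in> hom F2 (integer_mod_group m)" by (simp add: hom_def)
  ultimately have "f w mod int m = 0"
    using F2_hom_eqI [OF group_integer_mod_group, of "\<lambda>w. f w mod int m" m "\<lambda>w. 0" w] assms by simp
  then show ?thesis by presburger
qed

text \<open>The chain rule for Fox derivatives to first order. Neither side is additive in
  \<open>w\<close>, but both deviate from additivity by the same product modulo \<open>m\<close> (or
  \<open>n\<close>), because \<open>\<phi>\<close> preserves the corresponding exponent sum there.
  The expression \<open>expx w * expy w - area w\<close> is the area with the two generators
  exchanged.\<close>

lemma area_aut:
  assumes \<phi>: "\<phi> \<in> Gam m n" and w: "w \<in> carrier F2" and pos: "m > 0" "n > 0"
  shows "int m dvd area (\<phi> w) - (expx w * area (\<phi> gx) + choose2 (expx w) * expy (\<phi> gx)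
      + expy w * area (\<phi> gy) + area w * expy (\<phi> gy))" (is ?thesis1)
    and "int n dvd (expx (\<phi> w) * expy (\<phi> w) - area (\<phi> w))
      - (expx w * (expx (\<phi> gx) * expy (\<phi> gx) - area (\<phi> gx))
         + (expx w * expy w - area w) * expx (\<phi> gx)
         + expy w * (expx (\<phi> gy) * expy (\<phi> gy) - area (\<phi> gy))
         + choose2 (expy w) * expx (\<phi> gy))" (is ?thesis2)
proof -
  have \<phi>': "\<phi> \<in> carrier Aut2" and dvd: "int m dvd expx (\<phi> gx) - 1" "int m dvd expx (\<phi> gy)"
      "int n dvd expy (\<phi> gx)" "int n dvd expy (\<phi> gy) - 1"
    using \<phi> by (auto simp: Gam_def Delta_def abmat_def)
  have dx: "int m dvd expx (\<phi> u) - expx u" and dy: "int n dvd expy (\<phi> u) - expy u"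
    if u: "u \<in> carrier F2" for u
  proof -
    have "expx (\<phi> u) - expx u = (expx (\<phi> gx) - 1) * expx u + expx (\<phi> gy) * expy u"
      "expy (\<phi> u) - expy u = expy (\<phi> gx) * expx u + (expy (\<phi> gy) - 1) * expy u"
      unfolding exp_aut [OF \<phi>' u] by (simp_all add: algebra_simps)
    then show "int m dvd expx (\<phi> u) - expx u" "int n dvd expy (\<phi> u) - expy u"
      using dvd by simp_all
  qed
  show ?thesis1
  proof (rule dvd_hom_F2 [OF _ _ _ w pos(1)])
    fix u v assume uv: "u \<in> carrier F2" "v \<in> carrier F2"
    have "area (\<phi> (u \<otimes>\<^bsub>F2\<^esub> v)) = area (\<phi> u) + area (\<phi> v) + expx (\<phi> u) * expy (\<phi> v)"
      using uv \<phi>' by (simp add: aut_mult)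
    then show "int m dvd area (\<phi> (u \<otimes>\<^bsub>F2\<^esub> v)) - (expx (u \<otimes>\<^bsub>F2\<^esub> v) * area (\<phi> gx)
        + choose2 (expx (u \<otimes>\<^bsub>F2\<^esub> v)) * expy (\<phi> gx) + expy (u \<otimes>\<^bsub>F2\<^esub> v) * area (\<phi> gy)
        + area (u \<otimes>\<^bsub>F2\<^esub> v) * expy (\<phi> gy))
      - (area (\<phi> u) - (expx u * area (\<phi> gx) + choose2 (expx u) * expy (\<phi> gx)
        + expy u * area (\<phi> gy) + area u * expy (\<phi> gy)))
      - (area (\<phi> v) - (expx v * area (\<phi> gx) + choose2 (expx v) * expy (\<phi> gx)
        + expy v * area (\<phi> gy) + area v * expy (\<phi> gy)))" (is "int m dvd ?d")
    proof -
      assume *: "area (\<phi> (u \<otimes>\<^bsub>F2\<^esub> v)) = area (\<phi> u) + area (\<phi> v) + expx (\<phi> u) * expy (\<phi> v)"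
      have "?d = (expx (\<phi> u) - expx u) * expy (\<phi> v)"
        unfolding * exp_aut(2) [OF \<phi>' uv(2)] using uv by (simp add: choose2_add algebra_simps)
      then show ?thesis using dx [OF uv(1)] by simp
    qed
  qed simp_all
  show ?thesis2
  proof (rule dvd_hom_F2 [OF _ _ _ w pos(2)])
    fix u v assume uv: "u \<in> carrier F2" "v \<in> carrier F2"
    let ?k = "\<lambda>w. expx w * expy w - area w"
    let ?f = "\<lambda>w. ?k (\<phi> w) - (expx w * ?k (\<phi> gx) + ?k w * expx (\<phi> gx)
        + expy w * ?k (\<phi> gy) + choose2 (expy w) * expx (\<phi> gy))"
    have k: "?k (u \<otimes>\<^bsub>F2\<^esub> v) = ?k u + ?k v + expy u * expx v"
      if "u \<in> carrier F2" "v \<in> carrier F2" for u v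
      using that by (simp add: algebra_simps)
    have k\<phi>: "?k (\<phi> (u \<otimes>\<^bsub>F2\<^esub> v)) = ?k (\<phi> u) + ?k (\<phi> v) + expy (\<phi> u) * expx (\<phi> v)"
      using k [of "\<phi> u" "\<phi> v"] uv \<phi>' by (simp only: aut_mult aut_closed)
    have c: "choose2 (expy (u \<otimes>\<^bsub>F2\<^esub> v)) = choose2 (expy u) + choose2 (expy v) + expy u * expy v"
      using uv by (simp add: choose2_add)
    have e: "expx (u \<otimes>\<^bsub>F2\<^esub> v) = expx u + expx v" "expy (u \<otimes>\<^bsub>F2\<^esub> v) = expy u + expy v"
      using uv by simp_all
    have gen: "P + Q + y' * x' - ((xu + xv) * kx + (ku + kv + yu * xv) * ax + (yu + yv) * ky
        + (cu + cv + yu * yv) * ay) - (P - (xu * kx + ku * ax + yu * ky + cu * ay))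
        - (Q - (xv * kx + kv * ax + yv * ky + cv * ay)) = y' * x' - yu * (ax * xv + ay * yv)"
      for P Q y' x' xu xv kx ku kv yu ax yv ky cu cv ay :: int by (simp add: algebra_simps)
    have "?f (u \<otimes>\<^bsub>F2\<^esub> v) - ?f u - ?f v = expy (\<phi> u) * expx (\<phi> v)
        - expy u * (expx (\<phi> gx) * expx v + expx (\<phi> gy) * expy v)"
      unfolding k\<phi> k [OF uv] c unfolding e by (rule gen)
    also have "\<dots> = (expy (\<phi> u) - expy u) * expx (\<phi> v)"
      unfolding exp_aut(1) [OF \<phi>' uv(2), symmetric] by (simp add: algebra_simps)
    finally show "int n dvd ?f (u \<otimes>\<^bsub>F2\<^esub> v) - ?f u - ?f v" using dy [OF uv(1)] by simp
  qed simp_all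
qed

text \<open>\<open>retr \<phi>\<close> is the determinant of the Fox Jacobian of \<open>\<phi>\<close>, reduced modulo the square of the
  augmentation ideal \<open>I\<close> of \<open>\<int>[\<int>/m \<times> \<int>/n]\<close>; the first and the second entry are the two
  coordinates of its component in \<open>I/I\<^sup>2 = \<int>/m \<times> \<int>/n\<close>.\<close>

definition fox :: "int \<Rightarrow> int \<Rightarrow> int \<Rightarrow> int \<Rightarrow> int \<Rightarrow> int \<Rightarrow> int \<Rightarrow> int \<Rightarrow> int"
  where "fox a1 b1 a2 b2 c1 h1 c2 h2 = a1 * h2 + b2 * c1 - b1 * c2 - a2 * h1"

text \<open>Every letter contributes to the Fox derivative of a word \<open>w\<close> the exponents
  of the letters before it. So the coefficients of \<open>x - 1\<close> in the derivatives by
  \<open>x\<close> and \<open>y\<close> are \<open>choose2 (expx w)\<close> and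
  \<open>area w\<close>; those of \<open>y - 1\<close>, used in \<open>retr2\<close>, are
  \<open>expx w * expy w - area w\<close> and \<open>choose2 (expy w)\<close>.\<close>

definition retr1 :: "(2 word \<Rightarrow> 2 word) \<Rightarrow> int"
  where "retr1 \<phi> = fox (expx (\<phi> gx)) (expy (\<phi> gx)) (expx (\<phi> gy)) (expy (\<phi> gy))
    (choose2 (expx (\<phi> gx))) (area (\<phi> gx)) (choose2 (expx (\<phi> gy))) (area (\<phi> gy))"

definition retr2 :: "(2 word \<Rightarrow> 2 word) \<Rightarrow> int"
  where "retr2 \<phi> = fox (expx (\<phi> gx)) (expy (\<phi> gx)) (expx (\<phi> gy)) (expy (\<phi> gy))
    (expx (\<phi> gx) * expy (\<phi> gx) - area (\<phi> gx)) (choose2 (expy (\<phi> gx)))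
    (expx (\<phi> gy) * expy (\<phi> gy) - area (\<phi> gy)) (choose2 (expy (\<phi> gy)))"

text \<open>The divisibility hypotheses say that, over the dual numbers modulo \<open>m\<close>, the
  Jacobian of a product is the product of the Jacobians. The constant terms have determinant 1, so
  multiplicativity of the determinant becomes additivity of its first-order coefficient.\<close>

lemma fox_mult:
  assumes "a1 * b2 - b1 * a2 = 1" "a1' * b2' - b1' * a2' = 1"
    and "m dvd C1 - (a1' * c1 + c1' * a1 + b1' * c2 + h1' * a2)"
    and "m dvd C2 - (a2' * c1 + c2' * a1 + b2' * c2 + h2' * a2)"
    and "m dvd H1 - (a1' * h1 + c1' * b1 + b1' * h2 + h1' * b2)"
    and "m dvd H2 - (a2' * h1 + c2' * b1 + b2' * h2 + h2' * b2)"
  shows "m dvd fox (a1 * a1' + a2 * b1') (b1 * a1' + b2 * b1') (a1 * a2' + a2 * b2') (b1 * a2' +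
      b2 * b2')
      C1 H1 C2 H2 - (fox a1 b1 a2 b2 c1 h1 c2 h2 + fox a1' b1' a2' b2' c1' h1' c2' h2')"
proof -
  have ex: "\<exists>y. X = Y + m * y" if "m dvd X - Y" for X Y
    using that by (metis add.commute diff_add_cancel dvdE)
  obtain y1 y2 z1 z2 where eqs: "C1 = a1' * c1 + c1' * a1 + b1' * c2 + h1' * a2 + m * y1"
    "C2 = a2' * c1 + c2' * a1 + b2' * c2 + h2' * a2 + m * y2"
    "H1 = a1' * h1 + c1' * b1 + b1' * h2 + h1' * b2 + m * z1"
    "H2 = a2' * h1 + c2' * b1 + b2' * h2 + h2' * b2 + m * z2"
    using assms(3-6) [THEN ex] by blast
  have "fox (a1 * a1' + a2 * b1') (b1 * a1' + b2 * b1') (a1 * a2' + a2 * b2') (b1 * a2' + b2 *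
      b2') C1 H1 C2 H2
    = (a1' * b2' - b1' * a2') * fox a1 b1 a2 b2 c1 h1 c2 h2
      + (a1 * b2 - b1 * a2) * fox a1' b1' a2' b2' c1' h1' c2' h2'
      + m * fox (a1 * a1' + a2 * b1') (b1 * a1' + b2 * b1') (a1 * a2' + a2 * b2') (b1 * a2' + b2
          * b2') y1 z1 y2 z2"
    unfolding eqs fox_def by (simp add: algebra_simps)
  then show ?thesis using assms(1,2) by simp
qed

text \<open>The chain rule for the coefficient that depends on exponents only. \<open>h\<close> may
  be arbitrary as its factor \<open>b\<close> vanishes modulo \<open>m\<close>; the term produces
  the shape of the hypotheses of \<open>fox_mult\<close>.\<close>

lemma choose2_comb1:
  assumes "m dvd a - 1" "m dvd b"
  shows "m dvd choose2 (a * s + b * t) - (s * choose2 a + choose2 s * a + t * choose2 b + h * b)"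
proof -
  have "choose2 (a * s + b * t) - (s * choose2 a + choose2 s * a + t * choose2 b + h * b)
    = (a - 1) * (a * choose2 s) + b * (b * choose2 t + a * s * t - h)"
    unfolding choose2_add choose2_mult by (simp add: algebra_simps power2_eq_square)
  then show ?thesis using assms by simp
qed

lemma choose2_comb2:
  assumes "m dvd a" "m dvd b - 1"
  shows "m dvd choose2 (a * s + b * t) - (s * choose2 a + h * a + t * choose2 b + choose2 t * b)"
proof -
  have "choose2 (a * s + b * t) - (s * choose2 a + h * a + t * choose2 b + choose2 t * b)
    = (b - 1) * (b * choose2 t) + a * (a * choose2 s + b * s * t - h)"
    unfolding choose2_add choose2_mult by (simp add: algebra_simps power2_eq_square)
  then show ?thesis using assms by simp
qed

lemma retr_mult:
  assumes \<phi>: "\<phi> \<in> Gam m n" and \<psi>: "\<psi> \<in> Gam m n" and pos: "m > 0" "n > 0"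
  shows "int m dvd retr1 (\<phi> \<otimes>\<^bsub>Aut2\<^esub> \<psi>) - (retr1 \<phi> + retr1 \<psi>)"
    and "int n dvd retr2 (\<phi> \<otimes>\<^bsub>Aut2\<^esub> \<psi>) - (retr2 \<phi> + retr2 \<psi>)"
proof -
  have c: "\<phi> \<in> carrier Aut2" "\<psi> \<in> carrier Aut2"
    and dvd: "int m dvd expx (\<phi> gx) - 1" "int m dvd expx (\<phi> gy)"
      "int n dvd expy (\<phi> gx)" "int n dvd expy (\<phi> gy) - 1"
    and det: "expx (\<phi> gx) * expy (\<phi> gy) - expy (\<phi> gx) * expx (\<phi> gy) = 1"
      "expx (\<psi> gx) * expy (\<psi> gy) - expy (\<psi> gx) * expx (\<psi> gy) = 1"
    using \<phi> \<psi> by (auto simp: Gam_def Delta_def abmat_def algebra_simps)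
  have w: "\<psi> gx \<in> carrier F2" "\<psi> gy \<in> carrier F2" using c by simp_all
  note e = exp_aut [OF c(1) w(1)] exp_aut [OF c(1) w(2)]
  have \<phi>\<psi>: "(\<phi> \<otimes>\<^bsub>Aut2\<^esub> \<psi>) gx = \<phi> (\<psi> gx)" "(\<phi> \<otimes>\<^bsub>Aut2\<^esub> \<psi>) gy = \<phi> (\<psi> gy)" using c by simp_all
  note a1 = area_aut(1) [OF \<phi> w(1) pos] area_aut(1) [OF \<phi> w(2) pos]
  note a2 = area_aut(2) [OF \<phi> w(1) pos] area_aut(2) [OF \<phi> w(2) pos]
  show "int m dvd retr1 (\<phi> \<otimes>\<^bsub>Aut2\<^esub> \<psi>) - (retr1 \<phi> + retr1 \<psi>)"
    unfolding retr1_def \<phi>\<psi> e by (intro fox_mult det choose2_comb1 dvd a1)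
  show "int n dvd retr2 (\<phi> \<otimes>\<^bsub>Aut2\<^esub> \<psi>) - (retr2 \<phi> + retr2 \<psi>)"
    unfolding retr2_def \<phi>\<psi> e
    by (intro fox_mult det choose2_comb2 dvd a2 [unfolded e])
qed

text \<open>Over the abelianization, the Jacobian of conjugation by \<open>g\<close> is
  \<open>g\<close> times the identity plus a matrix of rank one; by the fundamental formula of Fox
  calculus its determinant is exactly \<open>g\<close>.\<close>

lemma retr_inn:
  assumes "g \<in> carrier F2"
  shows "retr1 (inn g) = expx g" "retr2 (inn g) = expy g"
  using assms by (simp_all add: retr1_def retr2_def fox_def algebra_simps)

definition retr :: "nat \<Rightarrow> nat \<Rightarrow> (2 word \<Rightarrow> 2 word) \<Rightarrow> int \<times> int"
  where "retr m n \<phi> = (retr1 \<phi> mod int m, retr2 \<phi> mod int n)"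

abbreviation ZZ :: "nat \<Rightarrow> nat \<Rightarrow> (int \<times> int) monoid"
  where "ZZ m n \<equiv> integer_mod_group m \<times>\<times> integer_mod_group n"

lemma comm_group_ZZ: "comm_group (ZZ m n)"
proof (rule group.group_comm_groupI [OF DirProd_group])
  fix x y :: "int \<times> int"
  show "x \<otimes>\<^bsub>ZZ m n\<^esub> y = y \<otimes>\<^bsub>ZZ m n\<^esub> x"
    by (cases x; cases y) (simp add: add.commute)
qed simp_all

lemma retr_hom:
  assumes "m > 0" "n > 0"
  shows "retr m n \<in> hom (GG m n) (ZZ m n)"
proof (rule homI)
  fix \<phi> \<psi> assume "\<phi> \<in> carrier (GG m n)" "\<psi> \<in> carrier (GG m n)"
  then have "\<phi> \<in> Gam m n" "\<psi> \<in> Gam m n" by simp_all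
  from retr_mult [OF this assms]
  show "retr m n (\<phi> \<otimes>\<^bsub>GG m n\<^esub> \<psi>) = retr m n \<phi> \<otimes>\<^bsub>ZZ m n\<^esub> retr m n \<psi>"
    by (simp add: retr_def mod_eq_dvd_iff mod_simps)
qed (use assms in \<open>simp add: retr_def carrier_integer_mod_group\<close>)

section \<open>Reduction to congruence subgroups of the modular group\<close>

lemma derived_in_kernel:
  assumes "group G" "comm_group H" "h \<in> hom G H"
  shows "derived G (carrier G) \<subseteq> kernel G H h"
proof -
  interpret h: group_hom G H h
    using assms by (simp add: group_hom_def group_hom_axioms_def comm_group.axioms)
  have "h ` derived G (carrier G) = derived H (h ` carrier G)"
    by (rule h.derived_img [symmetric]) simp
  also have "\<dots> = {\<one>\<^bsub>H\<^esub>}"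
    by (rule comm_group.derived_eq_singleton [OF assms(2)]) auto
  finally show ?thesis
    using h.G.derived_in_carrier [OF subset_refl] by (auto simp: kernel_def)
qed

lemma abmat_hom: "abmat \<in> hom (GG m n) SL2"
proof (rule homI)
  fix \<phi> assume "\<phi> \<in> carrier (GG m n)"
  then have "abmat \<phi> \<in> Delta m n" by (simp add: Gam_def)
  then show "abmat \<phi> \<in> carrier SL2" by (rule subsetD [OF Delta_subset])
qed (auto simp: Gam_def mat_mult)

lemma Gam_lift:
  assumes "A \<in> Delta m n"
  obtains \<phi> where "\<phi> \<in> Gam m n" "abmat \<phi> = A"
proof -
  obtain \<phi> where "\<phi> \<in> special" "abmat \<phi> = A"
    by (rule special_surj [OF subsetD [OF Delta_subset assms]])
  then show ?thesis using assms special_closed [of \<phi>] by (intro that [of \<phi>]) (simp_all add: Gam_def)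
qed

lemma abmat_image: "abmat ` Gam m n = Delta m n"
proof
  show "Delta m n \<subseteq> abmat ` Gam m n"
  proof
    fix A assume "A \<in> Delta m n"
    then show "A \<in> abmat ` Gam m n" by (elim Gam_lift) blast
  qed
qed (auto simp: Gam_def)

lemma inn_Gam: "g \<in> carrier F2 \<Longrightarrow> inn g \<in> Gam m n"
  by (simp add: Gam_def Delta_def)

text \<open>Conjugate elements agree in the abelianization, so \<open>inn v\<close> and
  \<open>inn (\<phi> v)\<close> have the same class. Lifts of the transvections
  \<open>(1, m, 0, 1)\<close> and \<open>(1, 0, n, 1)\<close> then give \<open>X^m Y = Y\<close> and
  \<open>X Y^n = X\<close> for the classes \<open>X\<close>, \<open>Y\<close> of the two
  generators.\<close>

lemma inn_derived:
  assumes w: "w \<in> carrier F2" and dvd: "int m dvd expx w" "int n dvd expy w"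
  shows "inn w \<in> derived (GG m n) (carrier (GG m n))"
proof -
  interpret GG: group "GG m n" by (rule group_GG)
  let ?D = "derived (GG m n) (carrier (GG m n))"
  interpret D: normal ?D "GG m n" by (rule GG.derived_self_is_normal)
  define B where "B = abelianization (GG m n)"
  interpret B: comm_group B unfolding B_def by (rule comm_group_abelianization [OF group_GG])
  define q where "q \<phi> = ?D #>\<^bsub>GG m n\<^esub> \<phi>" for \<phi>
  have q: "q \<in> hom (GG m n) B"
    unfolding q_def B_def abelianization_def by (rule D.r_coset_hom_Mod)
  interpret q: group_hom "GG m n" B q
    using q by (simp add: group_hom_def group_hom_axioms_def group_GG B.is_group)
  have inn: "inn \<in> hom F2 (GG m n)"
    by (rule homI) (simp_all add: inn_Gam inn_mult)
  have qi: "q \<circ> inn \<in> hom F2 B" by (rule hom_compose [OF inn q])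
  define X where "X = q (inn gx)"
  define Y where "Y = q (inn gy)"
  have XY: "X \<in> carrier B" "Y \<in> carrier B"
    unfolding X_def Y_def by (intro q.hom_closed; simp add: inn_Gam)+
  have formula: "q (inn v) = X [^]\<^bsub>B\<^esub> expx v \<otimes>\<^bsub>B\<^esub> Y [^]\<^bsub>B\<^esub> expy v" if "v \<in> carrier F2" for v
  proof -
    have "(\<lambda>v. X [^]\<^bsub>B\<^esub> expx v \<otimes>\<^bsub>B\<^esub> Y [^]\<^bsub>B\<^esub> expy v) \<in> hom F2 B"
      by (rule homI) (auto simp: XY B.int_pow_mult B.m_ac)
    from F2_hom_eqI [OF B.is_group qi this _ _ that] show ?thesis
      using XY by (simp add: X_def [symmetric] Y_def [symmetric] B.int_pow_1)
  qed
  have inv: "q (inn (\<phi> v)) = q (inn v)" if \<phi>: "\<phi> \<in> Gam m n" and v: "v \<in> carrier F2" for \<phi> v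
  proof -
    have \<phi>c: "\<phi> \<in> carrier Aut2" using \<phi> by (simp add: Gam_def)
    then have c: "\<phi> \<in> carrier (GG m n)" "inn v \<in> carrier (GG m n)" "inn (\<phi> v) \<in> carrier (GG m n)"
      using \<phi> v by (simp_all add: inn_Gam)
    have "\<phi> \<otimes>\<^bsub>GG m n\<^esub> inn v = inn (\<phi> v) \<otimes>\<^bsub>GG m n\<^esub> \<phi>"
      using \<phi>c v by (simp add: aut_inn)
    then have "q \<phi> \<otimes>\<^bsub>B\<^esub> q (inn v) = q (inn (\<phi> v)) \<otimes>\<^bsub>B\<^esub> q \<phi>"
      using c by (metis q.hom_mult)
    moreover have qc: "q \<phi> \<in> carrier B" "q (inn v) \<in> carrier B" "q (inn (\<phi> v)) \<in> carrier B"
      using c by (auto intro!: q.hom_closed)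
    ultimately have "q (inn (\<phi> v)) \<otimes>\<^bsub>B\<^esub> q \<phi> = q (inn v) \<otimes>\<^bsub>B\<^esub> q \<phi>"
      by (simp only: B.m_comm)
    then show ?thesis using qc by simp
  qed
  obtain \<phi> where \<phi>: "\<phi> \<in> Gam m n" "abmat \<phi> = (1, int m, 0, 1)"
    by (rule Gam_lift [of "(1, int m, 0, 1)" m n]) (simp add: Delta_def)
  obtain \<psi> where \<psi>: "\<psi> \<in> Gam m n" "abmat \<psi> = (1, 0, int n, 1)"
    by (rule Gam_lift [of "(1, 0, int n, 1)" m n]) (simp add: Delta_def)
  have c: "\<phi> \<in> carrier Aut2" "\<psi> \<in> carrier Aut2" using \<phi> \<psi> by (simp_all add: Gam_def)
  have "X [^]\<^bsub>B\<^esub> int m \<otimes>\<^bsub>B\<^esub> Y = Y"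
    using inv [OF \<phi>(1), of gy] formula [of "\<phi> gy"] \<phi>(2) c XY
    by (simp add: abmat_def Y_def [symmetric] B.int_pow_1)
  then have Xm: "X [^]\<^bsub>B\<^esub> int m = \<one>\<^bsub>B\<^esub>"
    using XY by simp
  have "X \<otimes>\<^bsub>B\<^esub> Y [^]\<^bsub>B\<^esub> int n = X"
    using inv [OF \<psi>(1), of gx] formula [of "\<psi> gx"] \<psi>(2) c XY
    by (simp add: abmat_def X_def [symmetric] B.int_pow_1)
  then have Yn: "Y [^]\<^bsub>B\<^esub> int n = \<one>\<^bsub>B\<^esub>"
    using XY by simp
  obtain k l where kl: "expx w = int m * k" "expy w = int n * l" using dvd by (auto elim!: dvdE)
  have "q (inn w) = \<one>\<^bsub>B\<^esub>"
    unfolding formula [OF w] kl using XY by (simp add: B.int_pow_pow [symmetric] Xm Yn B.int_pow_one)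
  then have "?D #>\<^bsub>GG m n\<^esub> inn w = ?D"
    by (simp add: q_def B_def abelianization_def FactGroup_def)
  then show ?thesis
    using GG.rcos_self [OF _ D.subgroup_axioms, of "inn w"] by (simp add: inn_Gam w)
qed

text \<open>Only the abelianization of \<open>Delta m n\<close> enters, in the form of a surjection
  \<open>c\<close> with kernel inside the commutators. An element killed by \<open>retr\<close> and
  by \<open>c\<close> agrees, up to a product of commutators, with an inner automorphism of trivial
  retraction, and \<open>inn_derived\<close> applies to the latter.\<close>

theorem gamma_abelianization:
  assumes pos: "m > 0" "n > 0" and T: "comm_group T"
    and c: "c \<in> hom (SL2\<lparr>carrier := Delta m n\<rparr>) T" and surj: "c ` Delta m n = carrier T"
    and ker: "\<And>A. A \<in> Delta m n \<Longrightarrow> c A = \<one>\<^bsub>T\<^esub> \<Longrightarrow> A \<in> derived SL2 (Delta m n)"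
  shows "abelianization (GG m n) \<cong> ZZ m n \<times>\<times> T"
proof -
  interpret GG: group "GG m n" by (rule group_GG)
  interpret T: comm_group T by (rule T)
  interpret ZZ: comm_group "ZZ m n" by (rule comm_group_ZZ)
  interpret R: group_hom "GG m n" "ZZ m n" "retr m n"
    using retr_hom [OF pos] by (simp add: group_hom_def group_hom_axioms_def group_GG ZZ.is_group)
  interpret M: group_hom "GG m n" SL2 abmat
    using abmat_hom by (simp add: group_hom_def group_hom_axioms_def group_GG group_SL2)
  let ?h = "\<lambda>\<phi>. (retr m n \<phi>, c (abmat \<phi>))"
  have GD: "abmat \<phi> \<in> Delta m n" if "\<phi> \<in> Gam m n" for \<phi> using that by (simp add: Gam_def)
  have h: "?h \<in> hom (GG m n) (ZZ m n \<times>\<times> T)"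
  proof (rule homI)
    fix \<phi> assume "\<phi> \<in> carrier (GG m n)"
    then show "?h \<phi> \<in> carrier (ZZ m n \<times>\<times> T)"
      using R.hom_closed [of \<phi>] GD surj by auto
  next
    fix \<phi> \<psi> assume *: "\<phi> \<in> carrier (GG m n)" "\<psi> \<in> carrier (GG m n)"
    have "c (abmat \<phi> \<otimes>\<^bsub>SL2\<^esub> abmat \<psi>) = c (abmat \<phi>) \<otimes>\<^bsub>T\<^esub> c (abmat \<psi>)"
      using hom_mult [OF c, of "abmat \<phi>" "abmat \<psi>"] * GD by simp
    then show "?h (\<phi> \<otimes>\<^bsub>GG m n\<^esub> \<psi>) = ?h \<phi> \<otimes>\<^bsub>ZZ m n \<times>\<times> T\<^esub> ?h \<psi>"
      unfolding mult_DirProd R.hom_mult [OF *] M.hom_mult [OF *] by simp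
  qed
  interpret h: group_hom "GG m n" "ZZ m n \<times>\<times> T" ?h
    using h by (simp add: group_hom_def group_hom_axioms_def group_GG DirProd_group T.is_group)
  have h_surj: "?h ` carrier (GG m n) = carrier (ZZ m n \<times>\<times> T)"
  proof
    show "carrier (ZZ m n \<times>\<times> T) \<subseteq> ?h ` carrier (GG m n)"
    proof
      fix z assume "z \<in> carrier (ZZ m n \<times>\<times> T)"
      then obtain i j t where z: "z = ((i, j), t)" "(i, j) \<in> carrier (ZZ m n)" "t \<in> carrier T"
        by (cases z) auto
      have "t \<in> c ` Delta m n" using z(3) surj by simp
      then obtain A where A: "A \<in> Delta m n" "c A = t" by (rule imageE) simp
      obtain \<theta> where \<theta>: "\<theta> \<in> Gam m n" "abmat \<theta> = A" by (rule Gam_lift [OF A(1)])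
      \<comment> \<open>A factor \<open>inn w\<close> leaves the matrix alone and shifts the
        retraction by the exponents of \<open>w\<close>.\<close>
      define w where "w = gx [^]\<^bsub>F2\<^esub> (i - retr1 \<theta>) \<otimes>\<^bsub>F2\<^esub> gy [^]\<^bsub>F2\<^esub> (j - retr2 \<theta>)"
      have w: "w \<in> carrier F2" by (simp add: w_def)
      interpret ex: group_hom F2 integer_group expx
        using expx_hom by (simp add: group_hom_def group_hom_axioms_def group_free_group)
      interpret ey: group_hom F2 integer_group expy
        using expy_hom by (simp add: group_hom_def group_hom_axioms_def group_free_group)
      have e: "expx w = i - retr1 \<theta>" "expy w = j - retr2 \<theta>"
        unfolding w_def by (simp_all add: ex.hom_int_pow ey.hom_int_pow)
      have "retr m n (inn w \<otimes>\<^bsub>GG m n\<^esub> \<theta>) = retr m n (inn w) \<otimes>\<^bsub>ZZ m n\<^esub> retr m n \<theta>"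
        using \<theta> w by (intro R.hom_mult) (simp_all add: inn_Gam)
      also have "\<dots> = (i, j)"
        using z(2) pos w e by (simp add: retr_def retr_inn mod_simps carrier_integer_mod_group)
      finally have "retr m n (inn w \<otimes>\<^bsub>GG m n\<^esub> \<theta>) = (i, j)" .
      moreover have "abmat (inn w \<otimes>\<^bsub>GG m n\<^esub> \<theta>) = A"
        using \<theta> w by (simp add: mat_mult Gam_def)
      moreover have "inn w \<otimes>\<^bsub>GG m n\<^esub> \<theta> \<in> carrier (GG m n)"
        using \<theta> w by (intro GG.m_closed) (simp_all add: inn_Gam)
      ultimately show "z \<in> ?h ` carrier (GG m n)"
        using A(2) z(1) by (intro image_eqI [of _ _ "inn w \<otimes>\<^bsub>GG m n\<^esub> \<theta>"]) simp_all
    qed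
  qed (use h.hom_closed in blast)
  let ?D = "derived (GG m n) (carrier (GG m n))"
  have comm: "comm_group (ZZ m n \<times>\<times> T)"
  proof (rule group.group_comm_groupI [OF DirProd_group])
    fix x y assume "x \<in> carrier (ZZ m n \<times>\<times> T)" "y \<in> carrier (ZZ m n \<times>\<times> T)"
    then show "x \<otimes>\<^bsub>ZZ m n \<times>\<times> T\<^esub> y = y \<otimes>\<^bsub>ZZ m n \<times>\<times> T\<^esub> x"
      by (auto simp: T.m_comm add.commute)
  qed (simp_all add: T.is_group DirProd_group)
  have "kernel (GG m n) (ZZ m n \<times>\<times> T) ?h = ?D"
  proof
    show "?D \<subseteq> kernel (GG m n) (ZZ m n \<times>\<times> T) ?h"
      by (rule derived_in_kernel [OF group_GG comm h])
    show "kernel (GG m n) (ZZ m n \<times>\<times> T) ?h \<subseteq> ?D"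
    proof
      fix \<phi> assume "\<phi> \<in> kernel (GG m n) (ZZ m n \<times>\<times> T) ?h"
      then have \<phi>: "\<phi> \<in> carrier (GG m n)" "retr m n \<phi> = \<one>\<^bsub>ZZ m n\<^esub>" "c (abmat \<phi>) = \<one>\<^bsub>T\<^esub>"
        by (auto simp: kernel_def)
      then have "abmat \<phi> \<in> derived SL2 (abmat ` carrier (GG m n))"
        using ker GD abmat_image by simp
      also have "\<dots> = abmat ` ?D" by (rule M.derived_img) simp
      finally obtain \<kappa> where \<kappa>: "\<kappa> \<in> ?D" "abmat \<kappa> = abmat \<phi>" by auto
      have Dsub: "subgroup ?D (GG m n)" by (rule GG.derived_is_subgroup) simp
      have \<kappa>c: "\<kappa> \<in> carrier (GG m n)" using \<kappa>(1) subgroup.subset [OF Dsub] by blast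
      define \<delta> where "\<delta> = \<phi> \<otimes>\<^bsub>GG m n\<^esub> inv\<^bsub>GG m n\<^esub> \<kappa>"
      have \<delta>: "\<delta> \<in> carrier (GG m n)" unfolding \<delta>_def using \<phi>(1) \<kappa>c by blast
      have "abmat \<delta> = \<one>\<^bsub>SL2\<^esub>"
        unfolding \<delta>_def M.hom_mult [OF \<phi>(1) GG.inv_closed [OF \<kappa>c]] M.hom_inv [OF \<kappa>c] \<kappa>(2)
        by (rule M.H.r_inv [OF M.hom_closed [OF \<phi>(1)]])
      then have "\<delta> \<in> Inn" using mat_kernel [of \<delta>] \<delta> by (simp add: Gam_def)
      then obtain w where w: "w \<in> carrier F2" "\<delta> = inn w" by (auto simp: Inn_def)
      have "retr m n \<kappa> = \<one>\<^bsub>ZZ m n\<^esub>"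
        using derived_in_kernel [OF group_GG comm_group_ZZ retr_hom [OF pos]] \<kappa>(1)
        by (auto simp: kernel_def)
      then have "retr m n \<delta> = \<one>\<^bsub>ZZ m n\<^esub>"
        unfolding \<delta>_def R.hom_mult [OF \<phi>(1) GG.inv_closed [OF \<kappa>c]] R.hom_inv [OF \<kappa>c] \<phi>(2)
        by (simp only: ZZ.inv_one ZZ.l_one ZZ.one_closed)
      then have "int m dvd expx w" "int n dvd expy w"
        using w by (simp_all add: retr_def retr_inn dvd_eq_mod_eq_0)
      then have "\<delta> \<in> ?D" unfolding w(2) by (rule inn_derived [OF w(1)])
      moreover have "\<phi> = \<delta> \<otimes>\<^bsub>GG m n\<^esub> \<kappa>"
        unfolding \<delta>_def using \<phi>(1) \<kappa>c by (simp only: GG.m_assoc GG.inv_closed GG.l_inv GG.r_one)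
      ultimately show "\<phi> \<in> ?D" using subgroup.m_closed [OF Dsub] \<kappa>(1) by blast
    qed
  qed
  then show ?thesis
    using h.FactGroup_iso [OF h_surj] unfolding abelianization_def by simp
qed

section \<open>Level structures and cocycles\<close>

text \<open>The point \<open>(a, b, c, d)\<close> stands for the map \<open>\<int>\<^sup>2 \<rightarrow> \<int>/m \<times> \<int>/n\<close> with rows \<open>(a, b)\<close> and \<open>(c,
  d)\<close>; the modular group acts from the left through composition with inverses.\<close>

fun lact :: "nat \<Rightarrow> nat \<Rightarrow> mat2 \<Rightarrow> mat2 \<Rightarrow> mat2"
  where "lact m n (p, q, r, t) (a, b, c, d) =
    ((a * t - b * r) mod int m, (b * p - a * q) mod int m,
     (c * t - d * r) mod int n, (d * p - c * q) mod int n)"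

text \<open>\<open>1 mod int n\<close> covers \<open>n = 1\<close>, where the representative of 1 is
  0.\<close>

definition base_point :: "nat \<Rightarrow> nat \<Rightarrow> mat2"
  where "base_point m n = (1 mod int m, 0, 0, 1 mod int n)"

definition orb :: "nat \<Rightarrow> nat \<Rightarrow> mat2 set"
  where "orb m n = (\<lambda>A. lact m n A (base_point m n)) ` carrier SL2"

lemma mod_linear: "((x mod k) * t - (y mod k) * r) mod k = (x * t - y * r) mod (k :: int)"
proof -
  have "(x mod k) * t - (y mod k) * r - (x * t - y * r) = k * ((y div k) * r - (x div k) * t)"
    by (simp add: minus_mult_div_eq_mod [symmetric] algebra_simps)
  then show ?thesis by (simp add: mod_eq_dvd_iff)
qed

lemma lact_mult: "lact m n (mmul A B) x = lact m n A (lact m n B x)"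
proof -
  obtain a b c d where A: "A = (a, b, c, d)" by (cases A)
  obtain a' b' c' d' where B: "B = (a', b', c', d')" by (cases B)
  obtain p q r t where x: "x = (p, q, r, t)" by (cases x)
  have "p * (c * b' + d * d') - q * (c * a' + d * c') = (p * d' - q * c') * d - (q * a' - p * b') * c"
    "q * (a * a' + b * c') - p * (a * b' + b * d') = (q * a' - p * b') * a - (p * d' - q * c') * b"
    for p q by (simp_all add: algebra_simps)
  then show ?thesis unfolding A B x by (simp only: lact.simps mmul.simps mod_linear)
qed

lemma lact_base: "lact m n (p, q, r, t) (base_point m n) =
    (t mod int m, (- q) mod int m, (- r) mod int n, p mod int n)"
  using mod_linear [of 1 "int m" t 0 r] mod_linear [of 0 "int m" p 1 q]
    mod_linear [of 0 "int n" t 1 r] mod_linear [of 1 "int n" p 0 q]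
  by (simp add: base_point_def)

lemma base_in_orb: "base_point m n \<in> orb m n"
proof -
  have "lact m n (1, 0, 0, 1) (base_point m n) = base_point m n"
    by (simp add: lact_base) (simp add: base_point_def)
  then show ?thesis unfolding orb_def by (intro image_eqI [of _ _ "(1, 0, 0, 1)"]) simp_all
qed

lemma lact_one: "x \<in> orb m n \<Longrightarrow> lact m n (1, 0, 0, 1) x = x"
  unfolding orb_def by (elim imageE) (simp only: lact_mult [symmetric] mmul_one)

lemma SL2_closed: "A \<in> carrier SL2 \<Longrightarrow> B \<in> carrier SL2 \<Longrightarrow> mmul A B \<in> carrier SL2"
  using monoid.m_closed [OF group.is_monoid [OF group_SL2]] by (simp only: SL2_mult)

lemma lact_closed: "A \<in> carrier SL2 \<Longrightarrow> x \<in> orb m n \<Longrightarrow> lact m n A x \<in> orb m n"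
  unfolding orb_def
  by (elim imageE) (simp only: lact_mult [symmetric], intro imageI SL2_closed)

lemma lact_base_iff:
  assumes "A \<in> carrier SL2"
  shows "lact m n A (base_point m n) = base_point m n \<longleftrightarrow> A \<in> Delta m n"
proof -
  obtain p q r t where A: "A = (p, q, r, t)" by (cases A)
  have det: "p * t - q * r = 1" using assms A by simp
  have "lact m n A (base_point m n) = base_point m n \<longleftrightarrow>
      int m dvd t - 1 \<and> int m dvd q \<and> int n dvd r \<and> int n dvd p - 1"
    unfolding A lact_base
    by (simp add: base_point_def mod_eq_dvd_iff mod_eq_0_iff_dvd)
  moreover have "p - 1 = q * r - p * (t - 1)" "t - 1 = q * r - t * (p - 1)"
    using det by (simp_all add: algebra_simps)
  then have "int m dvd q \<Longrightarrow> int m dvd t - 1 \<longleftrightarrow> int m dvd p - 1"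
    "int n dvd r \<Longrightarrow> int n dvd p - 1 \<longleftrightarrow> int n dvd t - 1"
    by (metis dvd_diff dvd_mult dvd_mult2)+
  ultimately show ?thesis using det by (auto simp: A Delta_def)
qed

text \<open>\<open>\<sigma>\<close> and \<open>\<tau>\<close> prescribe a cocycle on
  \<open>S\<close> and \<open>U\<close>; the two relations are what the skew product with
  \<open>T\<close> needs in order to be an \<open>SU_action\<close>.\<close>

locale cocycle = comm_group T for T :: "'t monoid" (structure) +
  fixes m n :: nat and \<sigma> \<tau> :: "mat2 \<Rightarrow> 't"
  assumes \<sigma>_closed: "x \<in> orb m n \<Longrightarrow> \<sigma> x \<in> carrier T"
    and \<tau>_closed: "x \<in> orb m n \<Longrightarrow> \<tau> x \<in> carrier T"
    and rel1: "\<And>x. x \<in> orb m n \<Longrightarrow> \<sigma> (lact m n matS (lact m n matS (lact m n matS x))) \<otimes>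
      (\<sigma> (lact m n matS (lact m n matS x)) \<otimes> (\<sigma> (lact m n matS x) \<otimes> \<sigma> x)) = \<one>"
    and rel2: "\<And>x. x \<in> orb m n \<Longrightarrow> \<tau> (lact m n matU (lact m n matU x)) \<otimes> (\<tau> (lact m n matU x) \<otimes> \<tau> x) =
      \<sigma> (lact m n matS x) \<otimes> \<sigma> x"
begin

abbreviation "X \<equiv> orb m n"
abbreviation "lS \<equiv> lact m n matS"
abbreviation "lU \<equiv> lact m n matU"

lemma lS_closed: "x \<in> X \<Longrightarrow> lS x \<in> X" and lU_closed: "x \<in> X \<Longrightarrow> lU x \<in> X"
  by (rule lact_closed [OF matS_closed], assumption, rule lact_closed [OF matU_closed])

sublocale Y: SU_action "X \<times> carrier T" "\<lambda>(x, t). (lS x, \<sigma> x \<otimes> t)" "\<lambda>(x, t). (lU x, \<tau> x \<otimes> t)"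
proof
  fix y assume "y \<in> X \<times> carrier T"
  then obtain x t where y: "y = (x, t)" "x \<in> X" "t \<in> carrier T" by (cases y) auto
  note c = y(2,3) lS_closed lU_closed \<sigma>_closed \<tau>_closed
  show "(\<lambda>(x, t). (lS x, \<sigma> x \<otimes> t)) y \<in> X \<times> carrier T" "(\<lambda>(x, t). (lU x, \<tau> x \<otimes> t)) y \<in> X \<times> carrier T"
    using c by (simp_all only: y prod.case mem_Times_iff fst_conv snd_conv m_closed simp_thms)
  have S4: "lS (lS (lS (lS x))) = x"
    using lact_one [OF y(2)] by (simp only: lact_mult [symmetric]) simp
  have SU: "lU (lU (lU x)) = lS (lS x)"
    by (simp only: lact_mult [symmetric]) simp
  have *: "a \<otimes> (b \<otimes> (c \<otimes> (d \<otimes> t))) = (a \<otimes> (b \<otimes> (c \<otimes> d))) \<otimes> t"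
    if "a \<in> carrier T" "b \<in> carrier T" "c \<in> carrier T" "d \<in> carrier T" for a b c d
    using that y(3) by (simp add: m_assoc)
  have "\<sigma> (lS (lS (lS x))) \<otimes> (\<sigma> (lS (lS x)) \<otimes> (\<sigma> (lS x) \<otimes> (\<sigma> x \<otimes> t))) = t"
    using y(3) by (subst *) (simp_all only: c rel1 l_one)
  then show "(\<lambda>(x, t). (lS x, \<sigma> x \<otimes> t)) ((\<lambda>(x, t). (lS x, \<sigma> x \<otimes> t))
      ((\<lambda>(x, t). (lS x, \<sigma> x \<otimes> t)) ((\<lambda>(x, t). (lS x, \<sigma> x \<otimes> t)) y))) = y"
    by (simp only: y prod.case S4)
  have "\<tau> (lU (lU x)) \<otimes> (\<tau> (lU x) \<otimes> (\<tau> x \<otimes> t)) = (\<tau> (lU (lU x)) \<otimes> (\<tau> (lU x) \<otimes> \<tau> x)) \<otimes> t"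
    by (simp only: c m_assoc m_closed)
  also have "\<dots> = \<sigma> (lS x) \<otimes> (\<sigma> x \<otimes> t)"
    by (simp only: rel2 [OF y(2)] c m_assoc)
  finally show "(\<lambda>(x, t). (lU x, \<tau> x \<otimes> t)) ((\<lambda>(x, t). (lU x, \<tau> x \<otimes> t)) ((\<lambda>(x, t). (lU x, \<tau> x \<otimes>
      t)) y)) =
      (\<lambda>(x, t). (lS x, \<sigma> x \<otimes> t)) ((\<lambda>(x, t). (lS x, \<sigma> x \<otimes> t)) y)"
    by (simp only: y prod.case SU)
qed

text \<open>The action on the skew product commutes with translations of \<open>T\<close>, so its
  second component is determined by the value at the identity; that factor is the cocycle
  \<open>C\<close>.\<close>

lemma act_translate:
  assumes "A \<in> carrier SL2" "x \<in> X"
  shows "\<exists>c\<in>carrier T. \<forall>t\<in>carrier T. Y.act A (x, t) = (lact m n A x, c \<otimes> t)"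
  using assms(1)
proof (induction rule: SL2_induct)
  case one
  have "Y.act (1, 0, 0, 1) (x, t) = (lact m n (1, 0, 0, 1) x, \<one> \<otimes> t)" if "t \<in> carrier T" for t
    using that assms Y.act_one [of "(x, t)"] lact_one [of x] by (simp only: mem_Times_iff
        fst_conv snd_conv simp_thms l_one)
  then show ?case by (intro bexI [of _ \<one>] ballI) simp_all
next
  case (S A)
  then obtain c where c: "c \<in> carrier T" "\<And>t. t \<in> carrier T \<Longrightarrow> Y.act A (x, t) = (lact m n A x, c \<otimes> t)"
    by (elim bexE) simp
  have A: "lact m n A x \<in> X" by (rule lact_closed [OF S(1) assms(2)])
  have "Y.act (mmul matS A) (x, t) = (lact m n (mmul matS A) x, (\<sigma> (lact m n A x) \<otimes> c) \<otimes> t)"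
    if t: "t \<in> carrier T" for t
  proof -
    have "Y.act (mmul matS A) (x, t) = Y.act matS (Y.act A (x, t))"
      by (rule Y.act_mult [OF matS_closed S(1)]) (use t assms in \<open>simp only: mem_Times_iff
          fst_conv snd_conv simp_thms\<close>)
    also have "\<dots> = (lS (lact m n A x), \<sigma> (lact m n A x) \<otimes> (c \<otimes> t))"
      unfolding c(2) [OF t] by (subst Y.act_S) (use t A c in simp_all)
    finally show ?thesis using t c(1) \<sigma>_closed [OF A] by (simp only: lact_mult m_assoc)
  qed
  then show ?case using c(1) \<sigma>_closed [OF A] by (intro bexI [of _ "\<sigma> (lact m n A x) \<otimes> c"] ballI)
      simp_all
next
  case (U A)
  then obtain c where c: "c \<in> carrier T" "\<And>t. t \<in> carrier T \<Longrightarrow> Y.act A (x, t) = (lact m n A x, c \<otimes> t)"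
    by (elim bexE) simp
  have A: "lact m n A x \<in> X" by (rule lact_closed [OF U(1) assms(2)])
  have "Y.act (mmul matU A) (x, t) = (lact m n (mmul matU A) x, (\<tau> (lact m n A x) \<otimes> c) \<otimes> t)"
    if t: "t \<in> carrier T" for t
  proof -
    have "Y.act (mmul matU A) (x, t) = Y.act matU (Y.act A (x, t))"
      by (rule Y.act_mult [OF matU_closed U(1)]) (use t assms in \<open>simp only: mem_Times_iff
          fst_conv snd_conv simp_thms\<close>)
    also have "\<dots> = (lU (lact m n A x), \<tau> (lact m n A x) \<otimes> (c \<otimes> t))"
      unfolding c(2) [OF t] by (subst Y.act_U) (use t A c in simp_all)
    finally show ?thesis using t c(1) \<tau>_closed [OF A] by (simp only: lact_mult m_assoc)
  qed
  then show ?case using c(1) \<tau>_closed [OF A] by (intro bexI [of _ "\<tau> (lact m n A x) \<otimes> c"] ballI)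
      simp_all
qed

definition C :: "mat2 \<Rightarrow> mat2 \<Rightarrow> 't"
  where "C A x = snd (Y.act A (x, \<one>))"

lemma act_C:
  assumes "A \<in> carrier SL2" "x \<in> X"
  shows "C A x \<in> carrier T" "t \<in> carrier T \<Longrightarrow> Y.act A (x, t) = (lact m n A x, C A x \<otimes> t)"
proof -
  obtain c where c: "c \<in> carrier T" "\<forall>t\<in>carrier T. Y.act A (x, t) = (lact m n A x, c \<otimes> t)"
    using act_translate [OF assms] by (elim bexE)
  then have "C A x = c" by (simp add: C_def)
  with c show "C A x \<in> carrier T" "t \<in> carrier T \<Longrightarrow> Y.act A (x, t) = (lact m n A x, C A x \<otimes> t)"
    by simp_all
qed

lemma C_S: "x \<in> X \<Longrightarrow> C matS x = \<sigma> x"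
  unfolding C_def by (subst Y.act_S) (simp_all add: \<sigma>_closed)

lemma C_U: "x \<in> X \<Longrightarrow> C matU x = \<tau> x"
  unfolding C_def by (subst Y.act_U) (simp_all add: \<tau>_closed)

lemma C_one: "x \<in> X \<Longrightarrow> C (1, 0, 0, 1) x = \<one>"
  unfolding C_def by (subst Y.act_one) simp_all

lemma C_mult:
  assumes "A \<in> carrier SL2" "B \<in> carrier SL2" "x \<in> X"
  shows "C (mmul A B) x = C A (lact m n B x) \<otimes> C B x"
proof -
  have "Y.act (mmul A B) (x, \<one>) = Y.act A (Y.act B (x, \<one>))"
    by (rule Y.act_mult [OF assms(1,2)]) (use assms in simp)
  also have "Y.act B (x, \<one>) = (lact m n B x, C B x)"
    using act_C [OF assms(2,3)] by simp
  also have "Y.act A (lact m n B x, C B x) = (lact m n A (lact m n B x), C A (lact m n B x) \<otimes> C B x)"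
    by (rule act_C(2) [OF assms(1) lact_closed [OF assms(2,3)] act_C(1) [OF assms(2,3)]])
  finally show ?thesis by (simp add: C_def)
qed

text \<open>On the stabilizer of the base point the cocycle rule \<open>C_mult\<close> is plain
  multiplicativity.\<close>

definition c :: "mat2 \<Rightarrow> 't"
  where "c A = C A (base_point m n)"

lemma Delta_D: "A \<in> Delta m n \<Longrightarrow> A \<in> carrier SL2 \<and> lact m n A (base_point m n) = base_point m n"
  using lact_base_iff [of A m n] subsetD [OF Delta_subset, of A m n] by simp

lemma c_hom: "c \<in> hom (SL2\<lparr>carrier := Delta m n\<rparr>) T"
proof (rule homI)
  fix A assume "A \<in> carrier (SL2\<lparr>carrier := Delta m n\<rparr>)"
  then show "c A \<in> carrier T" using act_C(1) base_in_orb Delta_D unfolding c_def by simp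
next
  fix A B assume "A \<in> carrier (SL2\<lparr>carrier := Delta m n\<rparr>)" "B \<in> carrier (SL2\<lparr>carrier := Delta m n\<rparr>)"
  then show "c (A \<otimes>\<^bsub>SL2\<lparr>carrier := Delta m n\<rparr>\<^esub> B) = c A \<otimes> c B"
    using C_mult [of A B "base_point m n"] base_in_orb Delta_D [of A] Delta_D [of B] by (simp
        add: c_def)
qed

end

section \<open>The abelianization of a stabilizer\<close>

text \<open>One shape for all stabilizers: \<open>q = 1\<close> when the stabilizer is free, and
  \<open>q = 4, 3, 2\<close> for the exceptional ones, whose abelianizations have cyclic
  torsion.\<close>

definition TT :: "nat \<Rightarrow> nat \<Rightarrow> (int \<times> (nat \<Rightarrow> int)) monoid"
  where "TT q r = integer_mod_group q \<times>\<times> Z_power r"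

definition tvec :: "nat \<Rightarrow> nat \<Rightarrow> int \<Rightarrow> (nat \<Rightarrow> int) \<Rightarrow> int \<times> (nat \<Rightarrow> int)"
  where "tvec q r i f = (i mod int q, restrict f {..<r})"

lemma tvec_mult: "tvec q r i f \<otimes>\<^bsub>TT q r\<^esub> tvec q r i' f' = tvec q r (i + i') (\<lambda>l. f l + f' l)"
  by (auto simp: tvec_def TT_def Z_power_def mod_simps)

lemma tvec_one: "\<one>\<^bsub>TT q r\<^esub> = tvec q r 0 (\<lambda>_. 0)"
  by (auto simp: tvec_def TT_def Z_power_def)

lemma tvec_closed: "q > 0 \<Longrightarrow> tvec q r i f \<in> carrier (TT q r)"
  by (auto simp: tvec_def TT_def Z_power_def carrier_integer_mod_group)

lemma tvec_eqI: "i mod int q = i' mod int q \<Longrightarrow> (\<And>l. l < r \<Longrightarrow> f l = f' l) \<Longrightarrow> tvec q r i f = tvec q r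
    i' f'"
  by (auto simp: tvec_def)

lemma TT_carrier: "t \<in> carrier (TT q r) \<Longrightarrow> q > 0 \<Longrightarrow> t = tvec q r (fst t) (snd t)"
  by (cases t) (auto simp: tvec_def TT_def Z_power_def carrier_integer_mod_group fun_eq_iff
      PiE_def extensional_def)

lemma comm_group_TT: "comm_group (TT q r)"
proof (rule group.group_comm_groupI)
  show "group (TT q r)" unfolding TT_def Z_power_def by (intro DirProd_group) simp_all
  fix x y :: "int \<times> (nat \<Rightarrow> int)"
  show "x \<otimes>\<^bsub>TT q r\<^esub> y = y \<otimes>\<^bsub>TT q r\<^esub> x"
    by (cases x; cases y) (auto simp: TT_def Z_power_def add.commute)
qed

fun coord :: "int \<times> int \<times> nat \<Rightarrow> nat \<Rightarrow> int"
  where "coord (i, k, j) l = (if l = j then k else 0)"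

definition val :: "nat \<Rightarrow> nat \<Rightarrow> int \<times> int \<times> nat \<Rightarrow> int \<times> (nat \<Rightarrow> int)"
  where "val q r z = tvec q r (fst z) (coord z)"

lemma TT_hom:
  assumes D: "comm_group D" and q: "q > 0" and e: "e \<in> carrier D" "e [^]\<^bsub>D\<^esub> int q = \<one>\<^bsub>D\<^esub>"
    and l: "\<And>j. j < r \<Longrightarrow> l j \<in> carrier D"
  obtains \<beta> where "\<beta> \<in> hom (TT q r) D"
    "\<And>i k j. j < r \<or> k = 0 \<Longrightarrow> \<beta> (val q r (i, k, j)) =
       e [^]\<^bsub>D\<^esub> i \<otimes>\<^bsub>D\<^esub> (if j < r then l j else \<one>\<^bsub>D\<^esub>) [^]\<^bsub>D\<^esub> k"
proof -
  interpret D: comm_group D by (rule D)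
  define \<beta> where "\<beta> t = e [^]\<^bsub>D\<^esub> fst t \<otimes>\<^bsub>D\<^esub> finprod D (\<lambda>j. l j [^]\<^bsub>D\<^esub> snd t j) {..<r}" for t ::
      "int \<times> (nat \<Rightarrow> int)"
  have emod: "e [^]\<^bsub>D\<^esub> (i mod int q) = e [^]\<^bsub>D\<^esub> i" for i
  proof -
    have "e [^]\<^bsub>D\<^esub> i = e [^]\<^bsub>D\<^esub> (int q * (i div int q) + i mod int q)" by simp
    also have "\<dots> = e [^]\<^bsub>D\<^esub> (i mod int q)"
      unfolding D.int_pow_mult [OF e(1)] D.int_pow_pow [OF e(1), symmetric] e(2)
      using e(1) by (simp add: D.int_pow_one)
    finally show ?thesis ..
  qed
  have \<beta>_vec: "\<beta> (tvec q r i f) = e [^]\<^bsub>D\<^esub> i \<otimes>\<^bsub>D\<^esub> finprod D (\<lambda>j. l j [^]\<^bsub>D\<^esub> f j) {..<r}" for i f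
    unfolding \<beta>_def tvec_def fst_conv snd_conv emod
    by (intro arg_cong2 [of _ _ _ _ "(\<otimes>\<^bsub>D\<^esub>)"] refl D.finprod_cong') (auto simp: l)
  have "\<beta> \<in> hom (TT q r) D"
  proof (rule homI)
    fix t assume "t \<in> carrier (TT q r)"
    then show "\<beta> t \<in> carrier D" using e l by (auto simp: \<beta>_def)
  next
    fix s t assume "s \<in> carrier (TT q r)" "t \<in> carrier (TT q r)"
    then obtain i f i' f' where st: "s = tvec q r i f" "t = tvec q r i' f'" using TT_carrier q
        by metis
    have "finprod D (\<lambda>j. l j [^]\<^bsub>D\<^esub> (f j + f' j)) {..<r} =
        finprod D (\<lambda>j. l j [^]\<^bsub>D\<^esub> f j \<otimes>\<^bsub>D\<^esub> l j [^]\<^bsub>D\<^esub> f' j) {..<r}"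
      by (rule D.finprod_cong') (auto simp: l D.int_pow_mult)
    also have "\<dots> = finprod D (\<lambda>j. l j [^]\<^bsub>D\<^esub> f j) {..<r} \<otimes>\<^bsub>D\<^esub> finprod D (\<lambda>j. l j [^]\<^bsub>D\<^esub> f' j) {..<r}"
      by (rule D.finprod_multf) (auto simp: l)
    finally show "\<beta> (s \<otimes>\<^bsub>TT q r\<^esub> t) = \<beta> s \<otimes>\<^bsub>D\<^esub> \<beta> t"
      using e(1) l unfolding st tvec_mult \<beta>_vec
      by (simp add: D.int_pow_mult D.m_ac D.finprod_closed Pi_def)
  qed
  moreover have "\<beta> (val q r (i, k, j)) =
      e [^]\<^bsub>D\<^esub> i \<otimes>\<^bsub>D\<^esub> (if j < r then l j else \<one>\<^bsub>D\<^esub>) [^]\<^bsub>D\<^esub> k" if "j < r \<or> k = 0" for i k j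
  proof -
    have "finprod D (\<lambda>j'. l j' [^]\<^bsub>D\<^esub> coord (i, k, j) j') {..<r} =
        finprod D (\<lambda>j'. if j = j' then l j' [^]\<^bsub>D\<^esub> k else \<one>\<^bsub>D\<^esub>) {..<r}"
      by (rule D.finprod_cong') (auto simp: l)
    also have "\<dots> = (if j < r then l j else \<one>\<^bsub>D\<^esub>) [^]\<^bsub>D\<^esub> k"
    proof (cases "j < r")
      case True
      then show ?thesis by (subst D.finprod_singleton) (auto simp: l)
    next
      case False
      then show ?thesis by (subst D.finprod_one_eqI) (auto simp: D.int_pow_one)
    qed
    finally show ?thesis by (simp add: val_def \<beta>_vec)
  qed
  ultimately show ?thesis using that by blast
qed

lemma TT_generated:
  assumes q: "q > 0" and H: "subgroup H (TT q r)"
    and gen: "q = 1 \<or> tvec q r 1 (\<lambda>_. 0) \<in> H" "\<And>j. j < r \<Longrightarrow> val q r (0, 1, j) \<in> H"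
  shows "H = carrier (TT q r)"
proof
  interpret T: comm_group "TT q r" by (rule comm_group_TT)
  show "H \<subseteq> carrier (TT q r)" by (rule subgroup.subset [OF H])
  have 1: "tvec q r i (\<lambda>_. 0) \<in> H" for i
  proof (cases "q = 1")
    case True
    then have "tvec q r i (\<lambda>_. 0) = \<one>\<^bsub>TT q r\<^esub>" unfolding tvec_one by (intro tvec_eqI) auto
    then show ?thesis using subgroup.one_closed [OF H] by simp
  next
    case False
    have "(\<lambda>i. tvec q r i (\<lambda>_. 0)) \<in> hom integer_group (TT q r)"
      by (rule homI) (simp_all add: tvec_closed q tvec_mult)
    from hom_int_pow [OF this, of 1 i] have "tvec q r i (\<lambda>_. 0) = tvec q r 1 (\<lambda>_. 0) [^]\<^bsub>TT q r\<^esub> i"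
      by (simp add: T.is_group)
    then show ?thesis using T.subgroup_int_pow_closed [OF H] gen(1) False by simp
  qed
  have 2: "val q r (0, k, j) \<in> H" if "j < r" for k j
  proof -
    have "(\<lambda>k. val q r (0, k, j)) \<in> hom integer_group (TT q r)"
      unfolding val_def by (rule homI) (auto simp: tvec_closed q tvec_mult intro!: tvec_eqI)
    from hom_int_pow [OF this, of 1 k] have "val q r (0, k, j) = val q r (0, 1, j) [^]\<^bsub>TT q r\<^esub> k"
      by (simp add: T.is_group)
    then show ?thesis using T.subgroup_int_pow_closed [OF H] gen(2) [OF that] by simp
  qed
  show "carrier (TT q r) \<subseteq> H"
  proof
    fix t assume "t \<in> carrier (TT q r)"
    then obtain i f where t: "t = tvec q r i f" using TT_carrier q by metis
    have "tvec q r i (\<lambda>l. if l < k then f l else 0) \<in> H" if "k \<le> r" for k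
      using that
    proof (induction k)
      case 0
      show ?case using 1 by simp
    next
      case (Suc k)
      have "tvec q r i (\<lambda>l. if l < Suc k then f l else 0) =
          tvec q r i (\<lambda>l. if l < k then f l else 0) \<otimes>\<^bsub>TT q r\<^esub> val q r (0, f k, k)"
        unfolding val_def tvec_mult by (rule tvec_eqI) auto
      then show ?case using subgroup.m_closed [OF H] Suc 2 [of k "f k"] by simp
    qed
    from this [OF order_refl] have "tvec q r i (\<lambda>l. if l < r then f l else 0) \<in> H" .
    moreover have "tvec q r i (\<lambda>l. if l < r then f l else 0) = t" unfolding t by (rule tvec_eqI) auto
    ultimately show "t \<in> H" by simp
  qed
qed

text \<open>Schreier generator: out along the transversal to \<open>x\<close>, then
  \<open>A\<close>, then back along the transversal.\<close>

definition loop :: "nat \<Rightarrow> nat \<Rightarrow> (mat2 \<Rightarrow> mat2) \<Rightarrow> mat2 \<Rightarrow> mat2 \<Rightarrow> mat2"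
  where "loop m n g A x = mmul (minv (g (lact m n A x))) (mmul A (g x))"

text \<open>Walks from the base point over edges of trivial label. A transversal made of such walks
  has trivial cocycle, so a loop has the label of the edge that it closes up.\<close>

inductive reach :: "nat \<Rightarrow> nat \<Rightarrow> (mat2 \<Rightarrow> int \<times> int \<times> nat) \<Rightarrow> (mat2 \<Rightarrow> int \<times> int \<times> nat) \<Rightarrow>
    mat2 \<Rightarrow> mat2 \<Rightarrow> bool" for m n \<sigma> \<tau>
  where
    one: "reach m n \<sigma> \<tau> (1, 0, 0, 1) (base_point m n)"
  | S: "reach m n \<sigma> \<tau> A x \<Longrightarrow> \<sigma> x = (0, 0, j) \<Longrightarrow> reach m n \<sigma> \<tau> (mmul matS A) (lact m n matS x)"
  | U: "reach m n \<sigma> \<tau> A x \<Longrightarrow> \<tau> x = (0, 0, j) \<Longrightarrow> reach m n \<sigma> \<tau> (mmul matU A) (lact m n matU x)"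

lemma minv_SL2:
  assumes "A \<in> carrier SL2"
  shows "minv A \<in> carrier SL2" "mmul (minv A) A = (1, 0, 0, 1)" "mmul A (minv A) = (1, 0, 0, 1)"
  using assms by (cases A; simp add: algebra_simps)+

lemma loop_closed:
  assumes A: "A \<in> carrier SL2" and x: "x \<in> orb m n"
    and g: "\<And>y. y \<in> orb m n \<Longrightarrow> g y \<in> carrier SL2 \<and> lact m n (g y) (base_point m n) = y"
  shows "loop m n g A x \<in> Delta m n"
proof -
  note y = lact_closed [OF A x]
  have SL: "loop m n g A x \<in> carrier SL2" unfolding loop_def
    using g [OF x] g [OF y] by (intro SL2_closed minv_SL2 A) simp_all
  have "lact m n (loop m n g A x) (base_point m n) =
      lact m n (minv (g (lact m n A x))) (lact m n A x)"
    by (simp only: loop_def lact_mult g [OF x])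
  also have "\<dots> = lact m n (minv (g (lact m n A x))) (lact m n (g (lact m n A x)) (base_point m n))"
    by (simp only: g [OF y])
  also have "\<dots> = base_point m n"
    by (simp only: lact_mult [symmetric] minv_SL2 [OF conjunct1 [OF g [OF y]]] lact_one [OF
        base_in_orb])
  finally show ?thesis using lact_base_iff [OF SL] by simp
qed

text \<open>Here \<open>(i, k, j)\<close> encodes the element of \<open>\<int>/q \<times> \<int>\<^sup>r\<close> with first entry \<open>i\<close> and with \<open>k\<close>
  times the \<open>j\<close>-th basis vector as second entry. The transversal \<open>g\<close> turns \<open>S\<close> and \<open>U\<close> into
  loops at the base point; the classes of \<open>E\<close> and \<open>L j\<close> define a homomorphism back to the
  abelianized stabilizer, which inverts the homomorphism induced by the cocycle.\<close>

theorem Delta_abelianization: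
  fixes \<sigma> \<tau> :: "mat2 \<Rightarrow> int \<times> int \<times> nat"
  assumes q: "q > 0"
    and rel1: "\<And>x l. x \<in> orb m n \<Longrightarrow> (let y = lact m n matS x; z = lact m n matS y; w = lact m n matS z
      in (fst (\<sigma> x) + fst (\<sigma> y) + fst (\<sigma> z) + fst (\<sigma> w)) mod int q = 0 \<and>
         coord (\<sigma> x) l + coord (\<sigma> y) l + coord (\<sigma> z) l + coord (\<sigma> w) l = 0)"
    and rel2: "\<And>x l. x \<in> orb m n \<Longrightarrow> (let y = lact m n matU x; z = lact m n matU y; w = lact m n matS x
      in (fst (\<tau> x) + fst (\<tau> y) + fst (\<tau> z)) mod int q = (fst (\<sigma> x) + fst (\<sigma> w)) mod int q \<and>
         coord (\<tau> x) l + coord (\<tau> y) l + coord (\<tau> z) l = coord (\<sigma> x) l + coord (\<sigma> w) l)"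
    and path: "\<And>x. x \<in> orb m n \<Longrightarrow> reach m n \<sigma> \<tau> (g x) x"
    and E: "E \<in> Delta m n" "E [^]\<^bsub>SL2\<^esub> int q = (1, 0, 0, 1)" and L: "\<And>j. j < r \<Longrightarrow> L j \<in> Delta m n"
    and \<sigma>: "\<And>x i k j. x \<in> orb m n \<Longrightarrow> \<sigma> x = (i, k, j) \<Longrightarrow> (j < r \<or> k = 0) \<and>
      loop m n g matS x = mmul (E [^]\<^bsub>SL2\<^esub> i) ((if j < r then L j else (1, 0, 0, 1)) [^]\<^bsub>SL2\<^esub> k)"
    and \<tau>: "\<And>x i k j. x \<in> orb m n \<Longrightarrow> \<tau> x = (i, k, j) \<Longrightarrow> (j < r \<or> k = 0) \<and>
      loop m n g matU x = mmul (E [^]\<^bsub>SL2\<^esub> i) ((if j < r then L j else (1, 0, 0, 1)) [^]\<^bsub>SL2\<^esub> k)"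
    and gen1: "q = 1 \<or> (\<exists>x j. x \<in> orb m n \<and> (\<sigma> x = (1, 0, j) \<or> \<tau> x = (1, 0, j)))"
    and gen2: "\<And>j. j < r \<Longrightarrow> \<exists>x. x \<in> orb m n \<and> \<sigma> x = (0, 1, j)"
  obtains c where "c \<in> hom (SL2\<lparr>carrier := Delta m n\<rparr>) (TT q r)" "c ` Delta m n = carrier (TT q r)"
    "\<And>A. A \<in> Delta m n \<Longrightarrow> c A = \<one>\<^bsub>TT q r\<^esub> \<Longrightarrow> A \<in> derived SL2 (Delta m n)"
proof -
  interpret SL2: group SL2 by (rule group_SL2)
  define vs where "vs x = val q r (\<sigma> x)" for x
  define vt where "vt x = val q r (\<tau> x)" for x
  interpret T: comm_group "TT q r" by (rule comm_group_TT)
  interpret K: cocycle "TT q r" m n vs vt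
  proof
    fix x assume x: "x \<in> orb m n"
    show "vs x \<in> carrier (TT q r)" "vt x \<in> carrier (TT q r)"
      by (simp_all add: vs_def vt_def val_def tvec_closed q)
    show "vs (lact m n matS (lact m n matS (lact m n matS x))) \<otimes>\<^bsub>TT q r\<^esub>
      (vs (lact m n matS (lact m n matS x)) \<otimes>\<^bsub>TT q r\<^esub> (vs (lact m n matS x) \<otimes>\<^bsub>TT q r\<^esub> vs x)) =
          \<one>\<^bsub>TT q r\<^esub>"
      unfolding vs_def val_def tvec_mult tvec_one
      by (rule tvec_eqI) (use rel1 [OF x] in \<open>simp_all add: Let_def ac_simps del: lact.simps
          coord.simps\<close>)
    show "vt (lact m n matU (lact m n matU x)) \<otimes>\<^bsub>TT q r\<^esub> (vt (lact m n matU x) \<otimes>\<^bsub>TT q r\<^esub> vt x) =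
      vs (lact m n matS x) \<otimes>\<^bsub>TT q r\<^esub> vs x"
      unfolding vs_def vt_def val_def tvec_mult
      by (rule tvec_eqI) (use rel2 [OF x] in \<open>simp_all add: Let_def ac_simps del: lact.simps
          coord.simps\<close>)
  qed
  have val0: "val q r (0, 0, j) = \<one>\<^bsub>TT q r\<^esub>" for j
    unfolding val_def tvec_one by (rule tvec_eqI) auto
  have reach: "A \<in> carrier SL2 \<and> x \<in> orb m n \<and> lact m n A (base_point m n) = x \<and> K.c A = \<one>\<^bsub>TT q r\<^esub>"
    if "reach m n \<sigma> \<tau> A x" for A x
    using that
  proof induction
    case one
    have "lact m n (1, 0, 0, 1) (base_point m n) = base_point m n" by (rule lact_one [OF base_in_orb])
    then show ?case using base_in_orb K.C_one [OF base_in_orb] unfolding K.c_def by simp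
  next
    case (S A x j)
    then have "K.c (mmul matS A) = \<one>\<^bsub>TT q r\<^esub>"
      unfolding K.c_def by (subst K.C_mult [OF matS_closed _ base_in_orb])
        (simp_all add: K.C_S vs_def val0 del: lact.simps SL2_carrier)
    then show ?case using S SL2_closed [OF matS_closed] lact_closed [OF matS_closed]
      by (simp add: lact_mult del: lact.simps SL2_carrier mmul.simps)
  next
    case (U A x j)
    then have "K.c (mmul matU A) = \<one>\<^bsub>TT q r\<^esub>"
      unfolding K.c_def by (subst K.C_mult [OF matU_closed _ base_in_orb])
        (simp_all add: K.C_U vt_def val0 del: lact.simps SL2_carrier)
    then show ?case using U SL2_closed [OF matU_closed] lact_closed [OF matU_closed]
      by (simp add: lact_mult del: lact.simps SL2_carrier mmul.simps)
  qed
  have g: "g x \<in> carrier SL2" "lact m n (g x) (base_point m n) = x" "K.c (g x) = \<one>\<^bsub>TT q r\<^esub>"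
    if "x \<in> orb m n" for x
    using reach [OF path [OF that]] by simp_all
  let ?loop = "loop m n g"
  have loop_Delta: "?loop A x \<in> Delta m n" if "A \<in> carrier SL2" "x \<in> orb m n" for A x
    by (rule loop_closed [OF that]) (simp only: g simp_thms)
  have c_loop: "K.c (?loop A x) = K.C A x" if A: "A \<in> carrier SL2" and x: "x \<in> orb m n" for A x
  proof -
    note y = lact_closed [OF A x]
    note l = K.Delta_D [OF loop_Delta [OF A x]]
    have "mmul (g (lact m n A x)) (?loop A x) = mmul A (g x)"
      by (simp only: loop_def mmul_assoc [symmetric] minv_SL2 [OF g(1) [OF y]] mmul_one)
    then have "K.C (mmul (g (lact m n A x)) (?loop A x)) (base_point m n) = K.C (mmul A (g x))
        (base_point m n)"
      by simp
    moreover have "K.C (mmul (g (lact m n A x)) (?loop A x)) (base_point m n) = K.c (?loop A x)"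
      using l g [OF y] K.act_C(1) [OF conjunct1 [OF l] base_in_orb]
      by (subst K.C_mult [OF g(1) [OF y] conjunct1 [OF l] base_in_orb]) (simp add: K.c_def del:
          lact.simps)
    moreover have "K.C (mmul A (g x)) (base_point m n) = K.C A x"
      using g [OF x] K.act_C(1) [OF A x]
      by (subst K.C_mult [OF A g(1) [OF x] base_in_orb]) (simp add: K.c_def del: lact.simps)
    ultimately show ?thesis by simp
  qed
  define G where "G = SL2\<lparr>carrier := Delta m n\<rparr>"
  have G: "group G" unfolding G_def by (rule subgroup.subgroup_is_group [OF Delta_subgroup group_SL2])
  interpret G: group G by (rule G)
  have Gc: "carrier G = Delta m n" "\<one>\<^bsub>G\<^esub> = (1, 0, 0, 1)" "A \<otimes>\<^bsub>G\<^esub> B = mmul A B" for A B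
    by (simp_all add: G_def)
  define D where "D = abelianization G"
  interpret D: comm_group D unfolding D_def by (rule comm_group_abelianization [OF G])
  define cls where "cls A = derived G (carrier G) #>\<^bsub>G\<^esub> A" for A
  interpret N: normal "derived G (carrier G)" G by (rule G.derived_self_is_normal)
  have cls_hom: "cls \<in> hom G D"
    unfolding cls_def D_def abelianization_def by (rule N.r_coset_hom_Mod)
  interpret cls: group_hom G D cls
    using cls_hom by (simp add: group_hom_def group_hom_axioms_def G D.is_group)
  have pow: "A [^]\<^bsub>SL2\<^esub> i = A [^]\<^bsub>G\<^esub> i" if "A \<in> Delta m n" for A and i :: int
    unfolding G_def by (rule SL2.int_pow_consistent [OF Delta_subgroup that])
  have one_Delta: "(1, 0, 0, 1) \<in> Delta m n" using G.one_closed by (simp add: Gc)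
  have "cls E [^]\<^bsub>D\<^esub> int q = \<one>\<^bsub>D\<^esub>"
    using cls.hom_int_pow [of E "int q"] E cls.hom_one by (simp add: Gc pow [symmetric])
  then obtain \<beta> where \<beta>: "\<beta> \<in> hom (TT q r) D"
    "\<And>i k j. j < r \<or> k = 0 \<Longrightarrow> \<beta> (val q r (i, k, j)) =
       cls E [^]\<^bsub>D\<^esub> i \<otimes>\<^bsub>D\<^esub> (if j < r then cls (L j) else \<one>\<^bsub>D\<^esub>) [^]\<^bsub>D\<^esub> k"
    using TT_hom [OF D.comm_group_axioms q, of "cls E" r "\<lambda>j. cls (L j)"] E(1) L cls.hom_closed Gc(1)
    by metis
  interpret \<beta>: group_hom "TT q r" D \<beta>
    using \<beta>(1) by (simp add: group_hom_def group_hom_axioms_def T.is_group D.is_group)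
  have cls_EL: "cls (mmul (E [^]\<^bsub>SL2\<^esub> i) ((if j < r then L j else (1, 0, 0, 1)) [^]\<^bsub>SL2\<^esub> k)) =
      cls E [^]\<^bsub>D\<^esub> i \<otimes>\<^bsub>D\<^esub> (if j < r then cls (L j) else \<one>\<^bsub>D\<^esub>) [^]\<^bsub>D\<^esub> k" for i k :: int and j
  proof -
    let ?M = "if j < r then L j else (1, 0, 0, 1)"
    have M: "?M \<in> Delta m n" using L one_Delta by simp
    then have "cls (mmul (E [^]\<^bsub>SL2\<^esub> i) (?M [^]\<^bsub>SL2\<^esub> k)) = cls (E [^]\<^bsub>G\<^esub> i) \<otimes>\<^bsub>D\<^esub> cls (?M [^]\<^bsub>G\<^esub> k)"
      using E(1) cls.hom_mult [of "E [^]\<^bsub>G\<^esub> i" "?M [^]\<^bsub>G\<^esub> k"] G.int_pow_closed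
      by (simp only: pow Gc)
    also have "\<dots> = cls E [^]\<^bsub>D\<^esub> i \<otimes>\<^bsub>D\<^esub> cls ?M [^]\<^bsub>D\<^esub> k"
      using E(1) M by (simp only: cls.hom_int_pow Gc)
    also have "cls ?M = (if j < r then cls (L j) else \<one>\<^bsub>D\<^esub>)"
      using cls.hom_one by (simp add: Gc)
    finally show ?thesis .
  qed
  have \<beta>_S: "\<beta> (vs x) = cls (?loop matS x)" and \<beta>_U: "\<beta> (vt x) = cls (?loop matU x)" if "x \<in> orb
      m n" for x
  proof -
    obtain i k j where z: "\<sigma> x = (i, k, j)" by (cases "\<sigma> x")
    from \<sigma> [OF that z] show "\<beta> (vs x) = cls (?loop matS x)"
      by (simp only: vs_def z \<beta>(2) cls_EL)
    obtain i k j where z: "\<tau> x = (i, k, j)" by (cases "\<tau> x")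
    from \<tau> [OF that z] show "\<beta> (vt x) = cls (?loop matU x)"
      by (simp only: vt_def z \<beta>(2) cls_EL)
  qed
  have loop_mult: "?loop (mmul B A) x = mmul (?loop B (lact m n A x)) (?loop A x)"
    if "A \<in> carrier SL2" "x \<in> orb m n" for A B x
  proof -
    let ?h = "g (lact m n A x)"
    have "mmul (?loop B (lact m n A x)) (?loop A x) =
      mmul (minv (g (lact m n B (lact m n A x)))) (mmul B (mmul (mmul ?h (minv ?h)) (mmul A (g x))))"
      by (simp only: loop_def mmul_assoc)
    then show ?thesis
      by (simp only: minv_SL2 [OF g(1) [OF lact_closed [OF that]]] mmul_one loop_def lact_mult
          mmul_assoc)
  qed
  \<comment> \<open>Both sides multiply in the same way along a word, by the cocycle rule and by
    \<open>loop_mult\<close>, and they agree on \<open>S\<close> and \<open>U\<close>.\<close>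
  have \<beta>_C: "\<beta> (K.C A x) = cls (?loop A x)" if A: "A \<in> carrier SL2" and x: "x \<in> orb m n" for A x
    using A
  proof (induction rule: SL2_induct)
    case one
    have "?loop (1, 0, 0, 1) x = (1, 0, 0, 1)"
      using minv_SL2 [OF g(1) [OF x]] by (simp only: loop_def lact_one [OF x] mmul_one)
    then show ?case using \<beta>.hom_one cls.hom_one by (simp only: K.C_one [OF x] Gc)
  next
    case (S A)
    note y = lact_closed [OF S(1) x]
    show ?case
      using S cls.hom_mult [of "?loop matS (lact m n A x)" "?loop A x"] loop_Delta [OF matS_closed y]
        loop_Delta [OF S(1) x] K.act_C(1) [OF S(1) x] K.\<sigma>_closed [OF y]
      by (simp only: K.C_mult [OF matS_closed S(1) x] loop_mult [OF S(1) x] K.C_S [OF y]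
          \<beta>.hom_mult \<beta>_S [OF y] Gc)
  next
    case (U A)
    note y = lact_closed [OF U(1) x]
    show ?case
      using U cls.hom_mult [of "?loop matU (lact m n A x)" "?loop A x"] loop_Delta [OF matU_closed y]
        loop_Delta [OF U(1) x] K.act_C(1) [OF U(1) x] K.\<tau>_closed [OF y]
      by (simp only: K.C_mult [OF matU_closed U(1) x] loop_mult [OF U(1) x] K.C_U [OF y]
          \<beta>.hom_mult \<beta>_U [OF y] Gc)
  qed
  have ker: "A \<in> derived SL2 (Delta m n)" if A: "A \<in> Delta m n" and c1: "K.c A = \<one>\<^bsub>TT q r\<^esub>" for A
  proof -
    let ?b = "base_point m n" and ?h = "g (base_point m n)"
    note Ad = K.Delta_D [OF A]
    have h: "?h \<in> Delta m n" using g [OF base_in_orb] lact_base_iff by blast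
    \<comment> \<open>At the base point the loop of \<open>A\<close> is conjugate to
      \<open>A\<close> by an element of \<open>Delta m n\<close>, so both have the same class in the
      abelianization.\<close>
    have eq: "mmul ?h (?loop A ?b) = mmul A ?h"
      using Ad by (simp only: loop_def mmul_assoc [symmetric] minv_SL2 [OF g(1) [OF
          base_in_orb]] mmul_one)
    have l: "?loop A ?b \<in> Delta m n" by (rule loop_Delta [OF conjunct1 [OF Ad] base_in_orb])
    have "cls (?loop A ?b) = \<one>\<^bsub>D\<^esub>"
      using \<beta>_C [OF conjunct1 [OF Ad] base_in_orb] c1 \<beta>.hom_one by (simp only: K.c_def)
    then have "cls ?h = cls A \<otimes>\<^bsub>D\<^esub> cls ?h"
      using arg_cong [OF eq, of cls] cls.hom_mult [of ?h "?loop A ?b"] cls.hom_mult [of A ?h] A h l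
        D.r_one [OF cls.hom_closed [of ?h]] by (simp only: Gc)
    then have "cls A = \<one>\<^bsub>D\<^esub>"
      using cls.hom_closed [of ?h] cls.hom_closed [of A] A h by (simp add: Gc)
    then have "derived G (carrier G) #>\<^bsub>G\<^esub> A = derived G (carrier G)"
      by (simp add: cls_def D_def abelianization_def FactGroup_def)
    then have "A \<in> derived G (carrier G)"
      using G.rcos_self [OF _ N.subgroup_axioms, of A] A by (simp add: Gc)
    then show ?thesis
      using SL2.derived_consistent [OF subset_refl Delta_subgroup] by (simp add: G_def)
  qed
  have surj: "K.c ` Delta m n = carrier (TT q r)"
  proof (rule TT_generated [OF q])
    interpret c: group_hom G "TT q r" K.c
      using K.c_hom by (simp add: group_hom_def group_hom_axioms_def G T.is_group G_def [symmetric])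
    show "subgroup (K.c ` Delta m n) (TT q r)"
      using c.img_is_subgroup by (simp add: Gc)
    have S: "vs x \<in> K.c ` Delta m n" if "x \<in> orb m n" for x
      using c_loop [OF matS_closed that] loop_Delta [OF matS_closed that] K.C_S [OF that] by
          (metis image_eqI)
    have U: "vt x \<in> K.c ` Delta m n" if "x \<in> orb m n" for x
      using c_loop [OF matU_closed that] loop_Delta [OF matU_closed that] K.C_U [OF that] by
          (metis image_eqI)
    have v1: "val q r (1, 0, j) = tvec q r 1 (\<lambda>_. 0)" for j
      unfolding val_def by (rule tvec_eqI) auto
    show "q = 1 \<or> tvec q r 1 (\<lambda>_. 0) \<in> K.c ` Delta m n"
      using gen1 S U v1 unfolding vs_def vt_def by metis
    show "val q r (0, 1, j) \<in> K.c ` Delta m n" if "j < r" for j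
      using gen2 [OF that] S unfolding vs_def by metis
  qed
  show ?thesis by (rule that [OF K.c_hom surj ker])
qed

section \<open>The number of level structures\<close>

text \<open>The set of primes is kept apart from the modulus, so that primes can be added one at a
  time while the modulus varies.\<close>

definition primitive_pairs :: "nat \<Rightarrow> nat set \<Rightarrow> (int \<times> int) set"
  where "primitive_pairs m S = {(a, b). a \<in> {0..<int m} \<and> b \<in> {0..<int m} \<and>
    (\<forall>p\<in>S. \<not> (int p dvd a \<and> int p dvd b))}"

lemma finite_primitive_pairs: "finite (primitive_pairs m S)"
  by (rule finite_subset [of _ "{0..<int m} \<times> {0..<int m}"]) (auto simp: primitive_pairs_def)

text \<open>A new prime \<open>p\<close> excludes the pairs divisible by \<open>p\<close>; division
  by \<open>p\<close> identifies these with the pairs for the modulus \<open>m div p\<close> and the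
  old primes.\<close>

lemma card_primitive_pairs:
  assumes "finite S" "m > 0" "\<And>p. p \<in> S \<Longrightarrow> prime p \<and> p dvd m"
  shows "real (card (primitive_pairs m S)) = real m ^ 2 * (\<Prod>p\<in>S. 1 - 1 / real p ^ 2)"
  using assms
proof (induction S arbitrary: m rule: finite_induct)
  case empty
  have "primitive_pairs m {} = {0..<int m} \<times> {0..<int m}" by (auto simp: primitive_pairs_def)
  then show ?case by (simp add: card_cartesian_product power2_eq_square)
next
  case (insert p S)
  define k where "k = m div p"
  have p: "prime p" "p dvd m" "p > 0" using insert.prems by (auto simp: prime_gt_0_nat)
  then have m: "m = p * k" "k > 0" using insert.prems(1) by (auto simp: k_def)
  have Sk: "prime q \<and> q dvd k" if "q \<in> S" for q
  proof -
    have q: "prime q" "q dvd p * k" "q \<noteq> p" using insert.prems(2) [of q] insert.hyps(2) that m by auto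
    then have "\<not> q dvd p" using p(1) primes_dvd_imp_eq by blast
    then show ?thesis using q prime_dvd_mult_iff by blast
  qed
  have dvd: "int q dvd int p * a \<longleftrightarrow> int q dvd a" if "q \<in> S" for q a
  proof -
    have q: "prime q" "q \<noteq> p" using insert.prems(2) [of q] insert.hyps(2) that by auto
    then have "\<not> q dvd p" using p(1) primes_dvd_imp_eq by blast
    then show ?thesis using q(1) by (simp add: prime_dvd_mult_iff)
  qed
  let ?f = "\<lambda>(a, b). (int p * a, int p * b)"
  have img: "?f ` primitive_pairs k S = {z \<in> primitive_pairs m S. int p dvd fst z \<and> int p dvd snd z}"
  proof (intro equalityI subsetI)
    fix z assume "z \<in> ?f ` primitive_pairs k S"
    then show "z \<in> {z \<in> primitive_pairs m S. int p dvd fst z \<and> int p dvd snd z}"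
      using p m by (auto simp: primitive_pairs_def dvd)
  next
    fix z assume z: "z \<in> {z \<in> primitive_pairs m S. int p dvd fst z \<and> int p dvd snd z}"
    then obtain a b where ab: "z = (int p * a, int p * b)" by (cases z) (auto elim!: dvdE)
    have "(a, b) \<in> primitive_pairs k S"
      using z p m unfolding ab by (auto simp: primitive_pairs_def dvd zero_le_mult_iff)
    then show "z \<in> ?f ` primitive_pairs k S" unfolding ab by (intro image_eqI [of _ _ "(a, b)"]) auto
  qed
  have inj: "inj_on ?f (primitive_pairs k S)" using p by (auto simp: inj_on_def)
  have split: "primitive_pairs m S = primitive_pairs m (insert p S) \<union> ?f ` primitive_pairs k S"
    unfolding img by (auto simp: primitive_pairs_def)
  have disj: "primitive_pairs m (insert p S) \<inter> ?f ` primitive_pairs k S = {}"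
    unfolding img by (auto simp: primitive_pairs_def)
  have "card (primitive_pairs m S) = card (primitive_pairs m (insert p S)) + card
      (primitive_pairs k S)"
    by (subst split, subst card_Un_disjoint [OF finite_primitive_pairs _ disj])
      (simp_all add: finite_primitive_pairs card_image [OF inj])
  moreover have "real (card (primitive_pairs m S)) = real m ^ 2 * (\<Prod>p\<in>S. 1 - 1 / real p ^ 2)"
    using insert.prems by (intro insert.IH) auto
  moreover have "real (card (primitive_pairs k S)) = real k ^ 2 * (\<Prod>p\<in>S. 1 - 1 / real p ^ 2)"
    using Sk m by (intro insert.IH) auto
  ultimately have "real (card (primitive_pairs m (insert p S))) =
      (real m ^ 2 - real k ^ 2) * (\<Prod>p\<in>S. 1 - 1 / real p ^ 2)"
    by (simp add: algebra_simps)
  also have "real m ^ 2 - real k ^ 2 = real m ^ 2 * (1 - 1 / real p ^ 2)"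
    using p(3) unfolding m by (simp add: field_simps power2_eq_square)
  finally show ?case using insert.hyps by simp
qed

text \<open>Take a common prime of \<open>b'\<close> and \<open>a + m k\<close>. If it divides
  \<open>a\<close>, it divides neither \<open>m\<close>, by primitivity, nor \<open>k\<close>; if it
  does not divide \<open>a\<close>, it divides \<open>k\<close>. Both are impossible.\<close>

lemma coprime_lift:
  fixes a b :: int
  assumes m: "m > 0" and prim: "\<And>p :: int. prime p \<Longrightarrow> p dvd m \<Longrightarrow> \<not> (p dvd a \<and> p dvd b)"
  obtains a' b' where "m dvd a' - a" "m dvd b' - b" "coprime a' b'"
proof -
  \<comment> \<open>A nonzero representative, so that only finitely many primes have to be
    avoided.\<close>
  define b' where "b' = (if b = 0 then m else b)"
  define k where "k = \<Prod>{p \<in> prime_factors b'. \<not> p dvd a}"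
  define a' where "a' = a + m * k"
  have b'0: "b' \<noteq> 0" and mb: "m dvd b' - b" using m by (auto simp: b'_def)
  have "coprime a' b'"
  proof (rule ccontr)
    assume "\<not> coprime a' b'"
    then have "gcd a' b' \<noteq> 0" "\<not> is_unit (gcd a' b')" using b'0 coprime_iff_gcd_eq_1 by auto
    then obtain p where p: "prime p" "p dvd gcd a' b'" using prime_divisor_exists by blast
    then have pa: "p dvd a'" and pb: "p dvd b'" by auto
    have pf: "p \<in> prime_factors b'" using p pb b'0 by (auto simp: in_prime_factors_iff)
    show False
    proof (cases "p dvd a")
      case True
      have "\<not> p dvd m"
      proof
        assume pm: "p dvd m"
        have "p dvd b' - (b' - b)" by (rule dvd_diff [OF pb dvd_trans [OF pm mb]])
        then show False using prim [OF p(1) pm] True by simp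
      qed
      moreover have "p dvd m * k" using pa True unfolding a'_def by (simp add: dvd_add_right_iff)
      ultimately have "p dvd k" using p(1) prime_dvd_mult_iff by blast
      then obtain q where "q \<in> prime_factors b'" "\<not> q dvd a" "p dvd q"
        unfolding k_def using p(1) by (auto simp: prime_dvd_prod_iff)
      then have "p = q" using p(1) by (intro primes_dvd_imp_eq) (auto simp: in_prime_factors_iff)
      with True \<open>\<not> q dvd a\<close> show False by simp
    next
      case False
      then have "p dvd k" unfolding k_def using pf by (intro dvd_prodI) auto
      then show False using pa False dvd_add_left_iff [OF dvd_mult, of p k a m] unfolding a'_def
          by simp
    qed
  qed
  with mb show ?thesis by (intro that [of a' b']) (auto simp: a'_def)
qed

text \<open>The fibre of the projection of \<open>orb m n\<close> to the first row.\<close>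

definition fibre :: "nat \<Rightarrow> int \<Rightarrow> int \<Rightarrow> (int \<times> int) set"
  where "fibre n a b = {(c, d). c \<in> {0..<int n} \<and> d \<in> {0..<int n} \<and> int n dvd a * d - b * c - 1}"

text \<open>Two completions of a unimodular row to determinant one differ by a multiple of that row,
  so a fibre has \<open>n\<close> elements.\<close>

lemma fibre_param:
  assumes n: "n > 0" "int n dvd a' - a" "int n dvd b' - b" and det: "a' * d0 - b' * c0 = 1"
  shows "bij_betw (\<lambda>k. ((c0 + k * a') mod int n, (d0 + k * b') mod int n)) {0..<int n} (fibre n a b)"
    (is "bij_betw ?f _ _")
  unfolding bij_betw_def
proof
  have fib: "(c, d) \<in> fibre n a b \<longleftrightarrow>
      c \<in> {0..<int n} \<and> d \<in> {0..<int n} \<and> int n dvd a' * d - b' * c - 1" for c d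
  proof -
    have eq: "a' * d - b' * c - 1 = (a * d - b * c - 1) + ((a' - a) * d - (b' - b) * c)"
      by (simp add: algebra_simps)
    have "int n dvd (a' - a) * d - (b' - b) * c" using n by simp
    then have "int n dvd a' * d - b' * c - 1 \<longleftrightarrow> int n dvd a * d - b * c - 1"
      unfolding eq by (rule dvd_add_left_iff)
    then show ?thesis by (simp add: fibre_def)
  qed
  show "inj_on ?f {0..<int n}"
  proof (rule inj_onI)
    fix k l assume k: "k \<in> {0..<int n}" "l \<in> {0..<int n}" and "?f k = ?f l"
    then have "int n dvd (c0 + k * a') - (c0 + l * a')" "int n dvd (d0 + k * b') - (d0 + l * b')"
      by (simp_all only: prod.inject mod_eq_dvd_iff)
    then have "int n dvd d0 * ((c0 + k * a') - (c0 + l * a')) - c0 * ((d0 + k * b') - (d0 + l * b'))"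
      by (intro dvd_diff [OF dvd_mult dvd_mult])
    also have "\<dots> = (a' * d0 - b' * c0) * (k - l)" by (simp add: algebra_simps)
    finally have "int n dvd k - l" using det by simp
    then show "k = l" using k by (metis atLeastLessThan_iff mod_eq_dvd_iff mod_pos_pos_trivial)
  qed
  show "?f ` {0..<int n} = fibre n a b"
  proof (intro equalityI subsetI)
    fix z assume "z \<in> ?f ` {0..<int n}"
    then obtain k where z: "z = ?f k" by blast
    let ?c = "c0 + k * a'" and ?d = "d0 + k * b'"
    have "int n dvd ?d mod int n - ?d" "int n dvd ?c mod int n - ?c"
      by (simp_all add: mod_eq_dvd_iff [symmetric])
    then have "int n dvd a' * (?d mod int n - ?d) - b' * (?c mod int n - ?c)"
      by (intro dvd_diff [OF dvd_mult dvd_mult])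
    moreover have "a' * (?d mod int n - ?d) - b' * (?c mod int n - ?c) =
        a' * (?d mod int n) - b' * (?c mod int n) - (a' * d0 - b' * c0)"
      by (simp add: algebra_simps)
    ultimately show "z \<in> fibre n a b" unfolding z fib using n(1) det by simp
  next
    fix z assume zf: "z \<in> fibre n a b"
    obtain c d where z: "z = (c, d)" by (cases z)
    with zf have cd: "c \<in> {0..<int n}" "d \<in> {0..<int n}" "int n dvd a' * d - b' * c - 1"
      by (simp_all add: fib)
    \<comment> \<open>Cramer's rule for \<open>(c, d) - (c0, d0) = k (a', b')\<close>, using
      \<open>a' * d0 - b' * c0 = 1\<close>.\<close>
    define k where "k = d0 * (c - c0) - c0 * (d - d0)"
    have 1: "(a' * d0 - b' * c0) * c - (c0 + k * a') = (a' * d0 - b' * c0 - 1) * c0 + c0 * (a' *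
        d - b' * c - 1)
        + c0 * (1 - (a' * d0 - b' * c0))"
      "(a' * d0 - b' * c0) * d - (d0 + k * b') = (a' * d0 - b' * c0 - 1) * d0 + d0 * (a' * d -
          b' * c - 1)
        + d0 * (1 - (a' * d0 - b' * c0))"
      unfolding k_def by (simp_all add: algebra_simps)
    have "c - (c0 + k * a') = c0 * (a' * d - b' * c - 1)" "d - (d0 + k * b') = d0 * (a' * d - b'
        * c - 1)"
      using 1 unfolding det by simp_all
    then have "int n dvd c - (c0 + k * a')" "int n dvd d - (d0 + k * b')" using cd(3) by simp_all
    then have "c mod int n = (c0 + k * a') mod int n" "d mod int n = (d0 + k * b') mod int n"
      by (simp_all add: mod_eq_dvd_iff)
    then have "z = ?f k" using cd by (simp add: z)
    also have "\<dots> = ?f (k mod int n)"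
    proof -
      have "(e + k * f) mod N = (e + (k mod N) * f) mod N" for e f N :: int
        by (metis mod_add_right_eq mod_mult_left_eq)
      then show ?thesis by blast
    qed
    finally show "z \<in> ?f ` {0..<int n}" using n(1) by (intro image_eqI [of _ _ "k mod int n"]) auto
  qed
qed

lemma primitive_pairs_prime:
  assumes "(a, b) \<in> primitive_pairs m {p. prime p \<and> p dvd m}" "prime (p :: int)" "p dvd int m"
  shows "\<not> (p dvd a \<and> p dvd b)"
proof -
  have p: "int (nat p) = p" "prime (nat p)"
    using assms(2) by (auto simp: prime_ge_0_int)
  have "int (nat p) dvd int m" using assms(3) p(1) by simp
  then have "nat p dvd m" by (simp only: int_dvd_int_iff)
  then have "\<not> (int (nat p) dvd a \<and> int (nat p) dvd b)"
    using assms(1) p(2) by (auto simp: primitive_pairs_def simp del: of_nat_nat int_nat_eq)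
  then show ?thesis unfolding p(1) .
qed

lemma level_lift:
  assumes m: "m > 0" and ab: "(a, b) \<in> primitive_pairs m {p. prime p \<and> p dvd m}"
  obtains a' b' c0 d0 where "int m dvd a' - a" "int m dvd b' - b" "a' * d0 - b' * c0 = 1"
    "a' mod int m = a" "b' mod int m = b"
proof -
  obtain a' b' where l: "int m dvd a' - a" "int m dvd b' - b" "coprime a' b'"
    using coprime_lift [of "int m" a b] m primitive_pairs_prime [OF ab] by auto
  obtain u v where "u * a' + v * b' = 1" using bezout_int [of a' b'] l(3) by auto
  then have "a' * u - b' * (- v) = 1" by (simp add: algebra_simps)
  moreover have "a' mod int m = a mod int m" "b' mod int m = b mod int m"
    using l by (simp_all add: mod_eq_dvd_iff)
  then have "a' mod int m = a" "b' mod int m = b" using ab by (auto simp: primitive_pairs_def)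
  ultimately show ?thesis using that l by blast
qed

text \<open>A primitive row modulo \<open>m\<close> lifts to a coprime integer row, which completes
  to a matrix in \<open>SL2\<close>. As \<open>n\<close> divides \<open>m\<close>, the fibre over it
  is obtained by adding multiples of the lifted row to the second row.\<close>

lemma orb_eq:
  assumes m: "m > 0" and n: "n > 0" "n dvd m"
  shows "orb m n = (\<lambda>((a, b), (c, d)). (a, b, c, d)) `
    (SIGMA z : primitive_pairs m {p. prime p \<and> p dvd m}. fibre n (fst z) (snd z))" (is "_ = ?h ` ?R")
proof (intro equalityI subsetI)
  fix x assume "x \<in> orb m n"
  then obtain A where A: "A \<in> carrier SL2" "x = lact m n A (base_point m n)" by (auto simp: orb_def)
  obtain p q r t where Aeq: "A = (p, q, r, t)" by (cases A)
  have det: "p * t - q * r = 1" using A(1) by (simp add: Aeq)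
  have x: "x = (t mod int m, (- q) mod int m, (- r) mod int n, p mod int n)"
    unfolding A(2) Aeq lact_base ..
  have "(t mod int m, (- q) mod int m) \<in> primitive_pairs m {p. prime p \<and> p dvd m}"
  proof -
    have False if k: "prime k" "k dvd m" "int k dvd t mod int m" "int k dvd (- q) mod int m" for k
    proof -
      have "int k dvd t" "int k dvd q" using k by (simp_all add: dvd_mod_iff)
      then have "int k dvd p * t - q * r" by simp
      then show False using det k(1) by (simp add: prime_gt_1_nat)
    qed
    then show ?thesis using m by (auto simp: primitive_pairs_def)
  qed
  moreover have "((- r) mod int n, p mod int n) \<in> fibre n (t mod int m) ((- q) mod int m)"
  proof -
    have "int n dvd t mod int m - t" "int n dvd (- q) mod int m + q"
      using n(2) by (simp_all add: mod_eq_dvd_iff [symmetric] mod_mod_cancel)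
        (metis add.inverse_inverse diff_minus_eq_add int_dvd_int_iff mod_eq_dvd_iff mod_mod_cancel)
    moreover have "int n dvd p mod int n - p" "int n dvd (- r) mod int n + r"
      by (simp_all add: mod_eq_dvd_iff [symmetric])
        (metis add.inverse_inverse diff_minus_eq_add mod_eq_dvd_iff mod_mod_trivial)
    ultimately have "int n dvd (t mod int m - t) * (p mod int n) + t * (p mod int n - p)
      - (((- q) mod int m + q) * ((- r) mod int n) - q * ((- r) mod int n + r))"
      by (intro dvd_diff [OF dvd_add [OF dvd_mult2 dvd_mult] dvd_diff [OF dvd_mult2 dvd_mult]])
    also have "\<dots> = t mod int m * (p mod int n) - (- q) mod int m * ((- r) mod int n) - (p * t -
        q * r)"
      by (simp add: algebra_simps)
    finally show ?thesis using n(1) det by (simp add: fibre_def)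
  qed
  ultimately show "x \<in> ?h ` ?R" unfolding x
    by (intro image_eqI [of _ _ "((t mod int m, (- q) mod int m), ((- r) mod int n, p mod int
        n))"]) auto
next
  fix x assume "x \<in> ?h ` ?R"
  then obtain a b c d where x: "x = (a, b, c, d)" and ab: "(a, b) \<in> primitive_pairs m {p. prime
      p \<and> p dvd m}"
    and cd: "(c, d) \<in> fibre n a b" by auto
  obtain a' b' c0 d0 where l: "int m dvd a' - a" "int m dvd b' - b" "a' * d0 - b' * c0 = 1"
    "a' mod int m = a" "b' mod int m = b" using level_lift [OF m ab] .
  have "int n dvd a' - a" "int n dvd b' - b"
    using l n(2) by (meson dvd_trans int_dvd_int_iff)+
  from fibre_param [OF n(1) this l(3)]
  have "(c, d) \<in> (\<lambda>k. ((c0 + k * a') mod int n, (d0 + k * b') mod int n)) ` {0..<int n}"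
    using cd unfolding bij_betw_def by simp
  then obtain k where k: "c = (c0 + k * a') mod int n" "d = (d0 + k * b') mod int n" by auto
  have "(d0 + k * b') * a' - (- b') * (- (c0 + k * a')) = 1"
    using l(3) by (simp add: algebra_simps)
  then have "(d0 + k * b', - b', - (c0 + k * a'), a') \<in> carrier SL2" by simp
  moreover have "x = lact m n (d0 + k * b', - b', - (c0 + k * a'), a') (base_point m n)"
    unfolding lact_base x k using l(4,5) by (simp add: algebra_simps)
  ultimately show "x \<in> orb m n" unfolding orb_def by blast
qed

lemma finite_orb: "m > 0 \<Longrightarrow> n > 0 \<Longrightarrow> finite (orb m n)"
proof -
  assume "m > 0" "n > 0"
  then have "orb m n \<subseteq> {0..<int m} \<times> {0..<int m} \<times> {0..<int n} \<times> {0..<int n}"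
    unfolding orb_def by (auto simp: lact_base)
  then show ?thesis by (rule finite_subset) simp
qed

theorem card_orb:
  assumes m: "m > 0" and n: "n > 0" "n dvd m"
  shows "real (card (orb m n)) = real n * real m ^ 2 * (\<Prod>p\<in>{p. prime p \<and> p dvd m}. 1 - 1 / real
      p ^ 2)"
proof -
  let ?P = "primitive_pairs m {p. prime p \<and> p dvd m}"
  have "card (fibre n (fst z) (snd z)) = n" if zP: "z \<in> ?P" for z
  proof -
    obtain a b where z: "z = (a, b)" by (cases z)
    obtain a' b' c0 d0 where l: "int m dvd a' - a" "int m dvd b' - b" "a' * d0 - b' * c0 = 1"
      "a' mod int m = a" "b' mod int m = b" by (rule level_lift [OF m zP [unfolded z]])
    have "int n dvd a' - a" "int n dvd b' - b"
      using l n(2) by (meson dvd_trans int_dvd_int_iff)+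
    from bij_betw_same_card [OF fibre_param [OF n(1) this l(3)]] show ?thesis by (simp add: z)
  qed
  moreover have "finite (fibre n a b)" for a b
    by (rule finite_subset [of _ "{0..<int n} \<times> {0..<int n}"]) (auto simp: fibre_def)
  ultimately have "card (SIGMA z : ?P. fibre n (fst z) (snd z)) = card ?P * n"
    by (subst card_SigmaI) (simp_all add: finite_primitive_pairs)
  moreover have "card (orb m n) = card (SIGMA z : ?P. fibre n (fst z) (snd z))"
    unfolding orb_eq [OF assms] by (rule card_image) (auto simp: inj_on_def)
  moreover have "finite {p. prime p \<and> p dvd m}"
    using m by (intro finite_subset [OF _ finite_divisors_nat [OF m]]) auto
  from card_primitive_pairs [OF this m] have
    "real (card ?P) = real m ^ 2 * (\<Prod>p\<in>{p. prime p \<and> p dvd m}. 1 - 1 / real p ^ 2)" by simp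
  ultimately show ?thesis by simp
qed

section \<open>The torsion-free case\<close>

lemma conj_Delta:
  assumes x: "x \<in> orb m n" and B: "B \<in> carrier SL2" "lact m n B x = x"
  obtains A where "A \<in> carrier SL2" "mmul (minv A) (mmul B A) \<in> Delta m n"
proof -
  obtain A where A: "A \<in> carrier SL2" "x = lact m n A (base_point m n)" using x by (auto simp:
      orb_def)
  have C: "mmul (minv A) (mmul B A) \<in> carrier SL2" by (intro SL2_closed minv_SL2 A B)
  have "lact m n (mmul (minv A) (mmul B A)) (base_point m n) = lact m n (minv A) (lact m n B x)"
    by (simp only: A(2) lact_mult)
  also have "\<dots> = lact m n (mmul (minv A) A) (base_point m n)"
    unfolding B(2) by (simp only: A(2) lact_mult)
  also have "\<dots> = base_point m n" by (simp only: minv_SL2 [OF A(1)] lact_one [OF base_in_orb])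
  finally show ?thesis using that A(1) lact_base_iff [OF C] by simp
qed

lemma trace_conj:
  assumes "A \<in> carrier SL2" "mmul (minv A) (mmul (e, f, g, h) A) = (a, b, c, d)"
  shows "a + d = e + h"
proof -
  obtain p q r t where A: "A = (p, q, r, t)" by (cases A)
  have "a + d = (p * t - q * r) * (e + h)"
    using assms(2) by (auto simp: A algebra_simps)
  then show ?thesis using assms(1) by (simp add: A)
qed

lemma Delta_dvd:
  assumes "(a, b, c, d) \<in> Delta m n"
  shows "int m dvd d - 1"
proof -
  have *: "a * d - b * c = 1" "int m dvd a - 1" "int m dvd b"
    using assms by (auto simp: Delta_def)
  have "d - 1 = b * c - (a - 1) * d" using *(1) by (simp add: algebra_simps)
  also have "int m dvd \<dots>" using * by simp
  finally show ?thesis .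
qed

text \<open>A fixed point puts a conjugate into \<open>Delta m n\<close>. For the central
  \<open>-1\<close> this makes \<open>m\<close> divide 2. A conjugate of \<open>U^2\<close> has
  trace -1 and diagonal entries congruent to 1 modulo \<open>m\<close>, so \<open>m = 3\<close>;
  then \<open>n = 3\<close>, and the determinant is contradictory modulo 9.\<close>

lemma orb_free:
  assumes m: "3 \<le> m" and n: "1 \<le> n" "n dvd m" "(m, n) \<noteq> (3, 1)" and x: "x \<in> orb m n"
  shows "lact m n (-1, 0, 0, -1) x \<noteq> x" "lact m n (-1, 1, -1, 0) x \<noteq> x"
proof
  assume fixed: "lact m n (-1, 0, 0, -1) x = x"
  obtain A where A: "A \<in> carrier SL2" "mmul (minv A) (mmul (-1, 0, 0, -1) A) \<in> Delta m n"
    by (rule conj_Delta [OF x _ fixed]) simp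
  obtain a b c d where C: "mmul (minv A) (mmul (-1, 0, 0, -1) A) = (a, b, c, d)" by (rule prod_cases4)
  have "a + d = -2" using trace_conj [OF A(1) C] by simp
  moreover have "mmul (minv A) (mmul (-1, 0, 0, -1) A) = (-1, 0, 0, -1)"
    using A(1) by (cases A) (auto simp: algebra_simps)
  then have "(-1, 0, 0, -1) \<in> Delta m n" using A(2) by simp
  then have "int m dvd -2" by (simp add: Delta_def)
  then have "int m \<le> 2" by (intro zdvd_imp_le) auto
  then show False using m by simp
next
  show "lact m n (-1, 1, -1, 0) x \<noteq> x"
  proof
    assume fixed: "lact m n (-1, 1, -1, 0) x = x"
    obtain A where A: "A \<in> carrier SL2" "mmul (minv A) (mmul (-1, 1, -1, 0) A) \<in> Delta m n"
      by (rule conj_Delta [OF x _ fixed]) simp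
    obtain a b c d where C: "mmul (minv A) (mmul (-1, 1, -1, 0) A) = (a, b, c, d)" by (rule
        prod_cases4)
    have D: "(a, b, c, d) \<in> Delta m n" using A(2) C by simp
    have tr: "a + d = -1" using trace_conj [OF A(1) C] by simp
    have dvd: "int m dvd a - 1" "int m dvd b" "int n dvd c" "int m dvd d - 1" and det: "a * d -
        b * c = 1"
      using D Delta_dvd [OF D] by (auto simp: Delta_def)
    have "int m dvd (a - 1) + (d - 1)" using dvd by (intro dvd_add)
    also have "(a - 1) + (d - 1) = -3" using tr by simp
    finally have "int m dvd 3" by simp
    then have "int m \<le> 3" by (intro zdvd_imp_le) auto
    then have m3: "m = 3" using m by simp
    then have "n \<le> 3" using n(2) dvd_imp_le by fastforce
    then have n3: "n = 3" using n m3 by (cases "n = 2") auto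
    obtain a1 where a1: "a = 1 + 3 * a1" using dvd(1) m3 by (metis dvdE add.commute
        diff_add_cancel of_nat_numeral)
    obtain d1 where d1: "d = 1 + 3 * d1" using dvd(4) m3 by (metis dvdE add.commute
        diff_add_cancel of_nat_numeral)
    obtain b1 where b1: "b = 3 * b1" using dvd(2) m3 by (metis dvdE of_nat_numeral)
    obtain c1 where c1: "c = 3 * c1" using dvd(3) n3 by (metis dvdE of_nat_numeral)
    have "a1 + d1 = -1" using tr a1 d1 by simp
    moreover have "3 * (a1 + d1) + 9 * (a1 * d1 - b1 * c1) = 0"
      using det unfolding a1 d1 b1 c1 by (simp add: algebra_simps)
    ultimately have "3 * (a1 * d1 - b1 * c1) = 1" by simp
    then show False by presburger
  qed
qed

lemma int_pow_simps_SL2: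
  assumes "A \<in> carrier SL2"
  shows "A [^]\<^bsub>SL2\<^esub> (0::int) = (1, 0, 0, 1)" "A [^]\<^bsub>SL2\<^esub> (1::int) = A" "A [^]\<^bsub>SL2\<^esub> (-1::int) = minv A"
    "A [^]\<^bsub>SL2\<^esub> (2::int) = mmul A A" "A [^]\<^bsub>SL2\<^esub> (3::int) = mmul A (mmul A A)"
    "A [^]\<^bsub>SL2\<^esub> (4::int) = mmul A (mmul A (mmul A A))"
proof -
  interpret SL2: group SL2 by (rule group_SL2)
  show "A [^]\<^bsub>SL2\<^esub> (0::int) = (1, 0, 0, 1)" by simp
  show 1: "A [^]\<^bsub>SL2\<^esub> (1::int) = A" using SL2.int_pow_1 [OF assms] .
  show "A [^]\<^bsub>SL2\<^esub> (-1::int) = minv A"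
    using SL2.int_pow_neg [OF assms, of 1] 1 inv_SL2 [OF assms] by simp
  have 2: "A [^]\<^bsub>SL2\<^esub> (1 + 1::int) = mmul A A" using SL2.int_pow_mult [OF assms, of 1 1] 1 by simp
  then show "A [^]\<^bsub>SL2\<^esub> (2::int) = mmul A A" by simp
  have 3: "A [^]\<^bsub>SL2\<^esub> (1 + (1 + 1)::int) = mmul A (mmul A A)"
    using SL2.int_pow_mult [OF assms, of 1 "1 + 1"] 1 2 by simp
  then show "A [^]\<^bsub>SL2\<^esub> (3::int) = mmul A (mmul A A)" by simp
  show "A [^]\<^bsub>SL2\<^esub> (4::int) = mmul A (mmul A (mmul A A))"
    using SL2.int_pow_mult [OF assms, of 1 "1 + (1 + 1)"] 1 3 by simp
qed

locale free_orbit =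
  fixes m n :: nat
  assumes m: "3 \<le> m" and n: "1 \<le> n" "n dvd m" "(m, n) \<noteq> (3, 1)"
begin

abbreviation "X \<equiv> orb m n"
abbreviation "s \<equiv> lact m n matS"
abbreviation "u \<equiv> lact m n matU"

lemma s_closed: "x \<in> X \<Longrightarrow> s x \<in> X" and u_closed: "x \<in> X \<Longrightarrow> u x \<in> X"
  by (rule lact_closed [OF matS_closed], assumption, rule lact_closed [OF matU_closed], assumption)

lemma s2: "s (s x) = lact m n (-1, 0, 0, -1) x" and u2: "u (u x) = lact m n (-1, 1, -1, 0) x"
  and u3: "u (u (u x)) = s (s x)"
  by (simp_all add: lact_mult [symmetric] del: lact.simps)

lemma s4: "x \<in> X \<Longrightarrow> s (s (s (s x))) = x"
  unfolding s2 using lact_one by (simp add: lact_mult [symmetric] del: lact.simps)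

lemma u6: "x \<in> X \<Longrightarrow> u (u (u (u (u (u x))))) = x"
  unfolding u3 by (rule s4)

lemma ne: assumes "x \<in> X"
  shows "s (s x) \<noteq> x" "u (u x) \<noteq> x" "s x \<noteq> x" "u x \<noteq> x" "s (s (s x)) \<noteq> x" "u (u (u x)) \<noteq> x"
    "u (u (u (u x))) \<noteq> x" "u (u (u (u (u x)))) \<noteq> x"
proof -
  show 1: "s (s x) \<noteq> x" and 2: "u (u x) \<noteq> x"
    unfolding s2 u2 using orb_free [OF m n assms] .
  show "s x \<noteq> x" "u x \<noteq> x" using 1 2 by metis+
  show "s (s (s x)) \<noteq> x" using 1 s4 [OF assms] by metis
  show "u (u (u x)) \<noteq> x" using 1 unfolding u3 .
  show "u (u (u (u x))) \<noteq> x" using 2 u6 [OF assms] by metis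
  show "u (u (u (u (u x)))) \<noteq> x" using 2 u6 [OF assms] by metis
qed

text \<open>Orbits of full length 4 and 6. Since \<open>s (s x) = u (u (u x))\<close>, an orbit of
  \<open>S\<close> meets at most two orbits of \<open>U\<close>: the former is an edge, the latter a
  trivalent vertex.\<close>

definition sorb :: "mat2 \<Rightarrow> mat2 set" where "sorb x = {x, s x, s (s x), s (s (s x))}"
definition uorb :: "mat2 \<Rightarrow> mat2 set" where "uorb x = {x, u x, u (u x), u (u (u x)), u (u (u (u
    x))), u (u (u (u (u x))))}"

lemma uorb_subset: "x \<in> X \<Longrightarrow> uorb x \<subseteq> X"
  unfolding uorb_def by (simp add: s_closed u_closed del: lact.simps)

lemma distinct_sorb: "x \<in> X \<Longrightarrow> distinct [x, s x, s (s x), s (s (s x))]"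
  using ne [of x] ne [of "s x"] ne [of "s (s x)"] s_closed
  by (simp del: lact.simps)

lemma distinct_uorb: assumes x: "x \<in> X"
  shows "distinct [x, u x, u (u x), u (u (u x)), u (u (u (u x))), u (u (u (u (u x))))]"
proof -
  note c = x u_closed [OF x] u_closed [OF u_closed [OF x]] u_closed [OF u_closed [OF u_closed [OF x]]]
    u_closed [OF u_closed [OF u_closed [OF u_closed [OF x]]]]
  note d = c [THEN ne(2)] c [THEN ne(4)] c [THEN ne(6)] c [THEN ne(7)] c [THEN ne(8)]
  show ?thesis
    using d d [symmetric] by (simp del: lact.simps)
qed

lemma card_sorb: "x \<in> X \<Longrightarrow> card (sorb x) = 4"
  using distinct_card [OF distinct_sorb, of x] by (simp add: sorb_def del: lact.simps)

lemma card_uorb: "x \<in> X \<Longrightarrow> card (uorb x) = 6"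
  using distinct_card [OF distinct_uorb, of x] by (simp add: uorb_def del: lact.simps)

lemma sorb_s: "x \<in> X \<Longrightarrow> y \<in> sorb x \<Longrightarrow> s y \<in> sorb x"
  using s4 [of x] unfolding sorb_def by (auto simp del: lact.simps)

lemma uorb_u: "x \<in> X \<Longrightarrow> y \<in> uorb x \<Longrightarrow> u y \<in> uorb x"
  using u6 [of x] unfolding uorb_def by (auto simp del: lact.simps)

text \<open>Tree paths: \<open>U\<close> moves freely inside a vertex, \<open>S\<close> crosses only
  edges in \<open>R\<close>.\<close>

inductive reachR :: "mat2 set \<Rightarrow> mat2 \<Rightarrow> mat2 \<Rightarrow> bool" for R
  where
    one: "reachR R (1, 0, 0, 1) (base_point m n)"
  | S: "reachR R A x \<Longrightarrow> x \<in> R \<Longrightarrow> reachR R (mmul matS A) (s x)"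
  | U: "reachR R A x \<Longrightarrow> reachR R (mmul matU A) (u x)"

lemma reachR_mono: "reachR R A x \<Longrightarrow> R \<subseteq> R' \<Longrightarrow> reachR R' A x"
  by (induction rule: reachR.induct) (auto intro: reachR.intros simp del: lact.simps mmul.simps)

text \<open>Contracting the orbits of \<open>S\<close> and of \<open>U\<close> turns the level structures into a connected
  trivalent graph; \<open>R\<close> holds the edges and \<open>Y\<close> the vertices of a subtree, and \<open>g\<close> carries the
  base point along the tree.\<close>

definition tree :: "mat2 set \<Rightarrow> mat2 set \<Rightarrow> (mat2 \<Rightarrow> mat2) \<Rightarrow> nat \<Rightarrow> bool"
  where "tree Y R g k \<longleftrightarrow> base_point m n \<in> Y \<and> Y \<subseteq> X \<and> (\<forall>x\<in>Y. u x \<in> Y) \<and> R \<subseteq> Y \<and> (\<forall>x\<in>R. s x \<in> R) \<and>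
    card Y = 6 * k \<and> card R + 4 = 4 * k \<and> (\<forall>x\<in>Y. reachR R (g x) x) \<and>
    (\<forall>x\<in>Y. g (u x) = mmul matU (g x)) \<and> (\<forall>x\<in>R. g (s x) = mmul matS (g x))"

text \<open>Prolongs the transversal from \<open>w\<close> over its orbit by powers of
  \<open>U\<close>, which makes all loops of \<open>U\<close> trivial.\<close>

definition spread :: "mat2 \<Rightarrow> mat2 \<Rightarrow> (mat2 \<Rightarrow> mat2) \<Rightarrow> mat2 \<Rightarrow> mat2"
  where "spread w W g = g (w := W, u w := mmul matU W, u (u w) := mmul matU (mmul matU W),
    u (u (u w)) := mmul matU (mmul matU (mmul matU W)),
    u (u (u (u w))) := mmul matU (mmul matU (mmul matU (mmul matU W))),
    u (u (u (u (u w)))) := mmul matU (mmul matU (mmul matU (mmul matU (mmul matU W)))))"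

lemma spread_simps:
  assumes "w \<in> X"
  shows "spread w W g w = W" "spread w W g (u w) = mmul matU W"
    "spread w W g (u (u w)) = mmul matU (mmul matU W)"
    "spread w W g (u (u (u w))) = mmul matU (mmul matU (mmul matU W))"
    "spread w W g (u (u (u (u w)))) = mmul matU (mmul matU (mmul matU (mmul matU W)))"
    "spread w W g (u (u (u (u (u w))))) = mmul matU (mmul matU (mmul matU (mmul matU (mmul matU W))))"
    "y \<notin> uorb w \<Longrightarrow> spread w W g y = g y"
  using distinct_uorb [OF assms] unfolding spread_def uorb_def by (simp_all del: lact.simps
      mmul.simps)

lemma U6: "mmul matU (mmul matU (mmul matU (mmul matU (mmul matU (mmul matU W))))) = W"
  by (cases W) simp

lemma spread_u:
  assumes "w \<in> X" "y \<in> uorb w"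
  shows "spread w W g (u y) = mmul matU (spread w W g y)"
  using assms(2) unfolding uorb_def
  by (elim insertE emptyE; simp only: spread_simps [OF assms(1)] u6 [OF assms(1)] U6)

lemma spread_reach:
  assumes "w \<in> X" "reachR R W w" "y \<in> uorb w"
  shows "reachR R (spread w W g y) y"
  using assms(3) unfolding uorb_def
  by (elim insertE emptyE; simp only: spread_simps [OF assms(1)]; intro reachR.U assms(2))

lemma finite_X: "finite X"
  using m n by (intro finite_orb) auto

lemma tree_start: "\<exists>Y R g. tree Y R g 1"
proof (intro exI)
  let ?b = "base_point m n"
  let ?g = "spread ?b (1, 0, 0, 1) id"
  note b = base_in_orb [of m n]
  have "\<forall>y\<in>uorb ?b. reachR {} (?g y) y" using spread_reach [OF b reachR.one] by blast
  moreover have "?b \<in> uorb ?b" by (simp add: uorb_def)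
  ultimately show "tree (uorb ?b) {} ?g 1"
    using uorb_subset [OF b] uorb_u [OF b] card_uorb [OF b] spread_u [OF b]
    unfolding tree_def by simp
qed

text \<open>An edge leads out of a proper subtree, since otherwise the subtree would be closed under
  both generators and be all of \<open>X\<close>. This edge adds 4 points to \<open>R\<close>, the
  vertex at its far end 6 points to \<open>Y\<close>; \<open>k\<close> counts vertices and
  \<open>k - 1\<close> edges.\<close>

lemma tree_step:
  assumes t: "tree Y R g k" and ne: "Y \<noteq> X"
  shows "\<exists>Y R g. tree Y R g (Suc k)"
proof -
  have Y: "base_point m n \<in> Y" "Y \<subseteq> X" "\<And>x. x \<in> Y \<Longrightarrow> u x \<in> Y"
    and R: "R \<subseteq> Y" "\<And>x. x \<in> R \<Longrightarrow> s x \<in> R" and card: "card Y = 6 * k" "card R + 4 = 4 * k"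
    and g: "\<And>x. x \<in> Y \<Longrightarrow> reachR R (g x) x" "\<And>x. x \<in> Y \<Longrightarrow> g (u x) = mmul matU (g x)"
      "\<And>x. x \<in> R \<Longrightarrow> g (s x) = mmul matS (g x)"
    using t unfolding tree_def by blast+
  have "\<exists>x\<in>Y. s x \<notin> Y"
  proof (rule ccontr)
    assume "\<not> ?thesis"
    then have sY: "\<And>x. x \<in> Y \<Longrightarrow> s x \<in> Y" by blast
    have "lact m n A (base_point m n) \<in> Y" if "A \<in> carrier SL2" for A
      using that
    proof (induction rule: SL2_induct)
      case one
      show ?case using Y(1) by (simp only: lact_one [OF base_in_orb])
    qed (simp_all only: lact_mult sY Y)
    then have "X \<subseteq> Y" unfolding orb_def by (intro image_subsetI)
    then show False using ne Y(2) by simp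
  qed
  then obtain x where x: "x \<in> Y" "s x \<notin> Y" by (elim bexE)
  define w where "w = s x"
  define W where "W = mmul matS (g x)"
  define Y' where "Y' = Y \<union> uorb w"
  define R' where "R' = R \<union> sorb x"
  define g' where "g' = spread w W g"
  have xX: "x \<in> X" using x Y(2) by blast
  have wX: "w \<in> X" unfolding w_def by (rule s_closed [OF xX])
  have disjY: "Y \<inter> uorb w = {}"
  proof -
    have "w \<in> Y" if "y \<in> Y" "y \<in> uorb w" for y
      using that(2) unfolding uorb_def
    proof (elim insertE emptyE)
      assume "y = w" then show ?thesis using that by simp
    next
      assume "y = u w" then show ?thesis using Y(3) [OF Y(3) [OF Y(3) [OF Y(3) [OF Y(3) [OF
          that(1)]]]]] u6 [OF wX] by simp
    next
      assume "y = u (u w)" then show ?thesis using Y(3) [OF Y(3) [OF Y(3) [OF Y(3) [OF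
          that(1)]]]] u6 [OF wX] by simp
    next
      assume "y = u (u (u w))" then show ?thesis using Y(3) [OF Y(3) [OF Y(3) [OF that(1)]]] u6
          [OF wX] by simp
    next
      assume "y = u (u (u (u w)))" then show ?thesis using Y(3) [OF Y(3) [OF that(1)]] u6 [OF
          wX] by simp
    next
      assume "y = u (u (u (u (u w))))" then show ?thesis using Y(3) [OF that(1)] u6 [OF wX] by simp
    qed
    then show ?thesis using x(2) unfolding w_def by blast
  qed
  have disjR: "R \<inter> sorb x = {}"
  proof -
    have "s x \<in> R" if "y \<in> R" "y \<in> sorb x" for y
      using that(2) unfolding sorb_def
    proof (elim insertE emptyE)
      assume "y = x" then show ?thesis using R(2) [OF that(1)] by simp
    next
      assume "y = s x" then show ?thesis using that by simp
    next
      assume "y = s (s x)" then show ?thesis using R(2) [OF R(2) [OF R(2) [OF that(1)]]] s4 [OF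
          s_closed [OF xX]] by simp
    next
      assume "y = s (s (s x))" then show ?thesis using R(2) [OF R(2) [OF that(1)]] s4 [OF
          s_closed [OF xX]] by simp
    qed
    then show ?thesis using x(2) R(1) by blast
  qed
  \<comment> \<open>\<open>S^2 = U^3\<close> puts the remaining two points of the edge into the same
    two vertices.\<close>
  have s2x: "s (s x) = u (u (u x))" and s3x: "s (s (s x)) = u (u (u w))"
    unfolding w_def by (simp_all only: u3)
  have s2Y: "s (s x) \<in> Y" unfolding s2x by (intro Y(3) x)
  have sorbY': "sorb x \<subseteq> Y'"
  proof -
    have "s x \<in> uorb w" by (simp add: w_def [symmetric] uorb_def del: lact.simps)
    moreover have "s (s (s x)) \<in> uorb w" unfolding s3x by (simp add: uorb_def del: lact.simps)
    ultimately show ?thesis using x(1) s2Y unfolding sorb_def Y'_def by simp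
  qed
  have g'Y: "g' y = g y" if "y \<in> Y" for y
    unfolding g'_def using that disjY by (intro spread_simps(7) [OF wX]) blast
  have "tree Y' R' g' (Suc k)"
    unfolding tree_def
  proof (intro conjI ballI)
    show "base_point m n \<in> Y'" "Y' \<subseteq> X" using Y uorb_subset [OF wX] by (auto simp: Y'_def)
    show "R' \<subseteq> Y'" unfolding R'_def using R(1) sorbY' by (auto simp: Y'_def)
    have fin: "finite Y" "finite R" using finite_subset [OF _ finite_X] Y(2) R(1) by blast+
    show "card Y' = 6 * Suc k"
      unfolding Y'_def using card(1) card_uorb [OF wX] fin disjY
      by (subst card_Un_disjoint) (auto simp: uorb_def)
    show "card R' + 4 = 4 * Suc k"
      unfolding R'_def using card(2) card_sorb [OF xX] fin disjR
      by (subst card_Un_disjoint) (auto simp: sorb_def)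
  next
    fix y assume "y \<in> Y'"
    then consider "y \<in> Y" | "y \<in> uorb w" unfolding Y'_def by blast
    then have "u y \<in> Y' \<and> g' (u y) = mmul matU (g' y)"
    proof cases
      case 1
      have "u y \<in> Y'" unfolding Y'_def using Y(3) [OF 1] by simp
      moreover have "g' (u y) = mmul matU (g' y)"
        by (simp only: g'Y [OF 1] g'Y [OF Y(3) [OF 1]] g(2) [OF 1])
      ultimately show ?thesis ..
    next
      case 2
      have "u y \<in> Y'" unfolding Y'_def using uorb_u [OF wX 2] by simp
      moreover have "g' (u y) = mmul matU (g' y)" unfolding g'_def by (rule spread_u [OF wX 2])
      ultimately show ?thesis ..
    qed
    then show "u y \<in> Y'" "g' (u y) = mmul matU (g' y)" by (rule conjunct1, rule conjunct2)
  next
    fix y assume "y \<in> R'"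
    then show "s y \<in> R'" unfolding R'_def using R(2) [of y] sorb_s [OF xX, of y] by blast
  next
    fix y assume "y \<in> Y'"
    then have or: "y \<in> Y \<or> y \<in> uorb w" unfolding Y'_def by blast
    have W: "reachR R' W w"
      unfolding W_def w_def using reachR_mono [OF g(1) [OF x(1)], of R']
      by (intro reachR.S) (auto simp: R'_def sorb_def)
    from or show "reachR R' (g' y) y"
    proof
      assume y: "y \<in> Y"
      show ?thesis unfolding g'Y [OF y] by (rule reachR_mono [OF g(1) [OF y]]) (simp add: R'_def)
    next
      assume y: "y \<in> uorb w"
      show ?thesis unfolding g'_def by (rule spread_reach [OF wX W y])
    qed
  next
    fix y assume "y \<in> R'"
    then consider "y \<in> R" | "y = x" | "y = w" | "y = s (s x)" | "y = s (s (s x))"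
      unfolding R'_def sorb_def w_def by blast
    then show "g' (s y) = mmul matS (g' y)"
    proof cases
      case 1
      then have "y \<in> Y" "s y \<in> Y" using R by blast+
      then show ?thesis using g(3) [OF 1] by (simp only: g'Y)
    next
      case 2
      then show ?thesis using x(1) by (simp only: g'Y w_def [symmetric]) (simp only: g'_def
          spread_simps [OF wX] W_def)
    next
      case 3
      have "g' (s w) = mmul matU (mmul matU (mmul matU (g x)))"
        using s2Y x(1) Y(3) by (simp only: w_def g'Y s2x g(2))
      also have "\<dots> = mmul matS (mmul matS (g x))" by (cases "g x") simp
      finally show ?thesis unfolding 3 by (simp only: g'_def spread_simps [OF wX] W_def)
    next
      case 4
      have "g' (s y) = mmul matU (mmul matU (mmul matU W))"
        unfolding 4 s3x by (simp only: g'_def spread_simps [OF wX])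
      also have "\<dots> = mmul matS (mmul matU (mmul matU (mmul matU (g x))))"
        unfolding W_def by (cases "g x") simp
      also have "mmul matU (mmul matU (mmul matU (g x))) = g' y"
        using s2Y x(1) Y(3) unfolding 4 by (simp only: g'Y s2x g(2))
      finally show ?thesis .
    next
      case 5
      have "g' (s y) = g x" unfolding 5 s4 [OF xX] using x(1) by (simp only: g'Y)
      also have "\<dots> = mmul matS (mmul matU (mmul matU (mmul matU (mmul matS (g x)))))" by (cases
          "g x") simp
      also have "mmul matU (mmul matU (mmul matU (mmul matS (g x)))) = g' y"
        unfolding 5 s3x by (simp only: g'_def spread_simps [OF wX] W_def)
      finally show ?thesis .
    qed
  qed
  then show ?thesis by blast
qed

text \<open>Growth must stop, because \<open>Y\<close> has \<open>6 k\<close> points and lies in the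
  finite set \<open>X\<close>.\<close>

lemma spanning_tree: "\<exists>R g k. tree X R g k"
proof (rule ccontr)
  assume neg: "\<not> ?thesis"
  have "\<exists>Y R g. tree Y R g (Suc k)" for k
  proof (induction k)
    case 0
    show ?case using tree_start by simp
  next
    case (Suc k)
    then obtain Y R g where "tree Y R g (Suc k)" by blast
    then show ?case using neg by (intro tree_step) auto
  qed
  then obtain Y R g where "tree Y R g (Suc (card X))" by blast
  then have "card Y = 6 * Suc (card X)" "Y \<subseteq> X" by (simp_all add: tree_def)
  then have "6 * Suc (card X) \<le> card X" using card_mono [OF finite_X, of Y] by simp
  then show False by simp
qed

text \<open>Used to number the edges outside the tree; the chosen point \<open>e j\<close> also
  orients the edge \<open>j\<close>.\<close>

lemma edge_labels:
  assumes "finite N" "N \<subseteq> X" "\<And>x. x \<in> N \<Longrightarrow> s x \<in> N"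
  shows "\<exists>r e. card N = 4 * r \<and> N = (\<Union>j<r. sorb (e j)) \<and> (\<forall>j<r. e j \<in> X) \<and>
    (\<forall>i<r. \<forall>j<r. i \<noteq> j \<longrightarrow> sorb (e i) \<inter> sorb (e j) = {})"
  using assms
proof (induction "card N" arbitrary: N rule: less_induct)
  case less
  show ?case
  proof (cases "N = {}")
    case True
    then show ?thesis by (intro exI [of _ 0] exI) auto
  next
    case False
    then obtain x where x: "x \<in> N" by blast
    then have xX: "x \<in> X" using less.prems by blast
    have sN: "sorb x \<subseteq> N" using x less.prems(3) unfolding sorb_def by (simp del: lact.simps)
    have cl: "s y \<in> N - sorb x" if "y \<in> N - sorb x" for y
    proof -
      have yX: "y \<in> X" using that less.prems(2) by blast
      have "y \<in> sorb x" if "s y \<in> sorb x"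
        using sorb_s [OF xX sorb_s [OF xX sorb_s [OF xX that]]] s4 [OF yX] by simp
      then show ?thesis using that less.prems(3) [of y] by blast
    qed
    have c: "card N = card (N - sorb x) + 4"
      using card_Diff_subset [OF finite_subset [OF sN less.prems(1)] sN]
        card_mono [OF less.prems(1) sN] card_sorb [OF xX] by simp
    have sub: "card (N - sorb x) < card N" "finite (N - sorb x)" "N - sorb x \<subseteq> X"
      using c less.prems(1,2) by auto
    obtain r e where IH: "card (N - sorb x) = 4 * r" "N - sorb x = (\<Union>j<r. sorb (e j))"
      "\<forall>j<r. e j \<in> X" "\<forall>i<r. \<forall>j<r. i \<noteq> j \<longrightarrow> sorb (e i) \<inter> sorb (e j) = {}"
      using less.hyps [OF sub] cl by metis
    have disj: "sorb (e j) \<inter> sorb x = {}" if "j < r" for j using IH(2) that by blast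
    let ?e = "e(r := x)"
    have "N = (\<Union>j<Suc r. sorb (?e j))" using IH(2) sN by (auto simp: lessThan_Suc)
    moreover have "card N = 4 * Suc r" using c IH(1) by simp
    moreover have "\<forall>j<Suc r. ?e j \<in> X" using IH(3) xX by (auto simp: less_Suc_eq)
    moreover have "\<forall>i<Suc r. \<forall>j<Suc r. i \<noteq> j \<longrightarrow> sorb (?e i) \<inter> sorb (?e j) = {}"
      using IH(4) disj by (auto simp: less_Suc_eq)
    ultimately show ?thesis by blast
  qed
qed

text \<open>The edges outside the tree provide the basis. With \<open>k\<close> vertices and
  \<open>k - 1\<close> tree edges, \<open>4 r = 6 k - 4 (k - 1)\<close>, whence
  \<open>12 r = 6 k + 12\<close>.\<close>

theorem free_abelianization:
  obtains r c where "12 * r = card X + 12" "c \<in> hom (SL2\<lparr>carrier := Delta m n\<rparr>) (TT 1 r)"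
    "c ` Delta m n = carrier (TT 1 r)"
    "\<And>A. A \<in> Delta m n \<Longrightarrow> c A = \<one>\<^bsub>TT 1 r\<^esub> \<Longrightarrow> A \<in> derived SL2 (Delta m n)"
proof -
  obtain R g k where t: "tree X R g k" using spanning_tree by blast
  have R: "R \<subseteq> X" "\<And>x. x \<in> R \<Longrightarrow> s x \<in> R" and card: "card X = 6 * k" "card R + 4 = 4 * k"
    and g: "\<And>x. x \<in> X \<Longrightarrow> reachR R (g x) x" "\<And>x. x \<in> X \<Longrightarrow> g (u x) = mmul matU (g x)"
      "\<And>x. x \<in> R \<Longrightarrow> g (s x) = mmul matS (g x)"
    using t unfolding tree_def by blast+
  have gX: "g x \<in> carrier SL2 \<and> lact m n (g x) (base_point m n) = x" if x: "x \<in> X" for x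
    using g(1) [OF x]
  proof (induction rule: reachR.induct)
    case one
    show ?case using lact_one [OF base_in_orb] by simp
  qed (simp_all only: lact_mult SL2_closed [OF matS_closed] SL2_closed [OF matU_closed] simp_thms)
  let ?loop = "loop m n g"
  have loopR: "?loop matS x = (1, 0, 0, 1)" if "x \<in> R" for x
    using minv_SL2 [OF SL2_closed [OF matS_closed conjunct1 [OF gX]], of x] R(1) that
    by (simp only: loop_def g(3) subsetD)
  have loopU: "?loop matU x = (1, 0, 0, 1)" if "x \<in> X" for x
    using minv_SL2 [OF SL2_closed [OF matU_closed conjunct1 [OF gX]], of x] that
    by (simp only: loop_def g(2))
  \<comment> \<open>\<open>g\<close> is compatible with \<open>U\<close>, hence with
    \<open>-1 = U^3\<close>. Therefore running through an edge backwards gives the inverse of its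
    loop, with no sign left over.\<close>
  have loop_s: "?loop matS (s x) = minv (?loop matS x)" if x: "x \<in> X" for x
  proof -
    have "g (s (s x)) = mmul matU (mmul matU (mmul matU (g x)))"
      unfolding u3 [symmetric] by (simp only: g(2) u_closed x)
    then have 1: "g (s (s x)) = mmul (-1, 0, 0, -1) (g x)" by (cases "g x") simp
    obtain a b c d where "g x = (a, b, c, d)" by (rule prod_cases4)
    moreover obtain a' b' c' d' where "g (s x) = (a', b', c', d')" by (rule prod_cases4)
    ultimately show ?thesis unfolding loop_def 1 by (simp del: lact.simps add: algebra_simps)
  qed
  define N where "N = X - R"
  have sN: "s x \<in> N" if "x \<in> N" for x
  proof -
    have x: "x \<in> X" "x \<notin> R" using that by (simp_all add: N_def)
    have "x \<in> R" if "s x \<in> R" using R(2) [OF R(2) [OF R(2) [OF that]]] s4 [OF x(1)] by simp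
    then show ?thesis using x s_closed [OF x(1)] unfolding N_def by blast
  qed
  obtain r e where e: "card N = 4 * r" "N = (\<Union>j<r. sorb (e j))" "\<forall>j<r. e j \<in> X"
    "\<forall>i<r. \<forall>j<r. i \<noteq> j \<longrightarrow> sorb (e i) \<inter> sorb (e j) = {}"
    using edge_labels [of N] finite_X sN unfolding N_def by (metis Diff_subset finite_Diff)
  define jof where "jof x = (THE j. j < r \<and> x \<in> sorb (e j))" for x
  have jof: "jof x = j" if "j < r" "x \<in> sorb (e j)" for x j
    unfolding jof_def using that e(4) by (intro the_equality) blast+
  \<comment> \<open>The four points of an edge run alternately along and against the orientation
    given by \<open>e (jof x)\<close>.\<close>
  define \<sigma> :: "mat2 \<Rightarrow> int \<times> int \<times> nat" where "\<sigma> x = (if x \<in> R then (0, 0, 0) else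
    (0, if x = e (jof x) \<or> x = s (s (e (jof x))) then 1 else -1, jof x))" for x
  define \<tau> :: "mat2 \<Rightarrow> int \<times> int \<times> nat" where "\<tau> x = (0, 0, 0)" for x
  define L where "L j = ?loop matS (e j)" for j
  have \<sigma>R: "\<sigma> x = (0, 0, 0)" if "x \<in> R" for x using that by (simp add: \<sigma>_def)
  have \<sigma>e: "\<sigma> (e j) = (0, 1, j)" "\<sigma> (s (e j)) = (0, -1, j)" "\<sigma> (s (s (e j))) = (0, 1, j)"
    "\<sigma> (s (s (s (e j)))) = (0, -1, j)" if j: "j < r" for j
  proof -
    have m: "e j \<in> sorb (e j)" "s (e j) \<in> sorb (e j)" "s (s (e j)) \<in> sorb (e j)" "s (s (s (e
        j))) \<in> sorb (e j)"
      by (simp_all add: sorb_def del: lact.simps)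
    have nR: "x \<notin> R" if "x \<in> sorb (e j)" for x
      using that j e(2) unfolding N_def by blast
    have d: "distinct [e j, s (e j), s (s (e j)), s (s (s (e j)))]" using distinct_sorb e(3) j by simp
    then have "s (e j) \<noteq> e j" "s (s (s (e j))) \<noteq> e j" "s (s (s (e j))) \<noteq> s (s (e j))" "s (e j) \<noteq>
        s (s (e j))"
      by (metis distinct.simps(2) list.set_intros)+
    then show "\<sigma> (e j) = (0, 1, j)" "\<sigma> (s (e j)) = (0, -1, j)" "\<sigma> (s (s (e j))) = (0, 1, j)"
      "\<sigma> (s (s (s (e j)))) = (0, -1, j)"
      unfolding \<sigma>_def by (simp_all add: nR [OF m(1)] nR [OF m(2)] nR [OF m(3)] nR [OF m(4)]
        jof [OF j m(1)] jof [OF j m(2)] jof [OF j m(3)] jof [OF j m(4)] del: lact.simps)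
  qed
  have cases: "x \<in> R \<or> (\<exists>j<r. x = e j \<or> x = s (e j) \<or> x = s (s (e j)) \<or> x = s (s (s (e j))))" if
      "x \<in> X" for x
    using that e(2) unfolding N_def sorb_def by blast
  have \<sigma>s: "\<exists>k j. \<sigma> x = (0, k, j) \<and> \<sigma> (s x) = (0, - k, j)" if x: "x \<in> X" for x
    using cases [OF x]
  proof (elim disjE exE conjE)
    assume "x \<in> R" then show ?thesis using \<sigma>R R(2) by simp
  next
    fix j assume "j < r" "x = s (s (s (e j)))"
    moreover from this have "s x = e j" using s4 e(3) by simp
    ultimately show ?thesis using \<sigma>e by simp
  qed (auto simp: \<sigma>e simp del: lact.simps)
  have path: "reach m n \<sigma> \<tau> A x" if "reachR R A x" for A x
    using that
  proof (induction rule: reachR.induct)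
    case one show ?case by (rule reach.one)
  next
    case (S A x) then show ?case using \<sigma>R by (intro reach.S)
  next
    case (U A x) then show ?case by (intro reach.U [of _ _ _ _ _ _ 0]) (simp_all add: \<tau>_def)
  qed
  have L_Delta: "L j \<in> Delta m n" if "j < r" for j
    unfolding L_def using e(3) that by (intro loop_closed [OF matS_closed _ gX]) auto
  have one_pow: "(1, 0, 0, 1) [^]\<^bsub>SL2\<^esub> i = (1, 0, 0, 1)" for i :: int
    using group.int_pow_one [OF group_SL2] by simp
  have one_Delta: "(1, 0, 0, 1) \<in> Delta m n" by (simp add: Delta_def)
  have SLj: "?loop matS x = L j [^]\<^bsub>SL2\<^esub> k" if j: "j < r" and x: "x \<in> sorb (e j)" and k: "\<sigma> x =
      (0, k, j)" for x j k
  proof -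
    have eX: "e j \<in> X" "s (e j) \<in> X" "s (s (e j)) \<in> X" using e(3) j s_closed by simp_all
    have LS: "L j \<in> carrier SL2" using L_Delta [OF j] Delta_subset by blast
    have mm: "minv (minv A) = A" for A by (cases A) simp
    have l: "?loop matS (e j) = L j" "?loop matS (s (e j)) = minv (L j)"
      "?loop matS (s (s (e j))) = L j" "?loop matS (s (s (s (e j)))) = minv (L j)"
      by (simp_all only: loop_s [OF eX(1)] loop_s [OF eX(2)] loop_s [OF eX(3)] L_def mm)
    show ?thesis using x unfolding sorb_def
    proof (elim insertE emptyE)
      assume y: "x = e j"
      then have "k = 1" using k \<sigma>e(1) [OF j] by (simp del: lact.simps)
      then show ?thesis unfolding y by (simp only: int_pow_simps_SL2 [OF LS] l)
    next
      assume y: "x = s (e j)"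
      then have "k = -1" using k \<sigma>e(2) [OF j] by (simp del: lact.simps)
      then show ?thesis unfolding y by (simp only: int_pow_simps_SL2 [OF LS] l)
    next
      assume y: "x = s (s (e j))"
      then have "k = 1" using k \<sigma>e(3) [OF j] by (simp del: lact.simps)
      then show ?thesis unfolding y by (simp only: int_pow_simps_SL2 [OF LS] l)
    next
      assume y: "x = s (s (s (e j)))"
      then have "k = -1" using k \<sigma>e(4) [OF j] by (simp del: lact.simps)
      then show ?thesis unfolding y by (simp only: int_pow_simps_SL2 [OF LS] l)
    qed
  qed
  have result: "\<exists>c. c \<in> hom (SL2\<lparr>carrier := Delta m n\<rparr>) (TT 1 r) \<and> c ` Delta m n = carrier (TT 1 r) \<and>
    (\<forall>A\<in>Delta m n. c A = \<one>\<^bsub>TT 1 r\<^esub> \<longrightarrow> A \<in> derived SL2 (Delta m n))"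
  \<comment> \<open>The stabilizer is free: \<open>q = 1\<close>, with the identity matrix in the
    place of \<open>E\<close>.\<close>
  proof (rule Delta_abelianization [of 1 m n \<sigma> \<tau> g "(1, 0, 0, 1)" r L])
    fix x l assume x: "x \<in> X"
    obtain k j where 1: "\<sigma> x = (0, k, j)" "\<sigma> (s x) = (0, - k, j)" using \<sigma>s [OF x] by blast
    obtain k' j' where 2: "\<sigma> (s (s x)) = (0, k', j')" "\<sigma> (s (s (s x))) = (0, - k', j')"
      using \<sigma>s [OF s_closed [OF s_closed [OF x]]] by blast
    show "let y = s x; z = s y; w = s z
      in (fst (\<sigma> x) + fst (\<sigma> y) + fst (\<sigma> z) + fst (\<sigma> w)) mod int 1 = 0 \<and>
         coord (\<sigma> x) l + coord (\<sigma> y) l + coord (\<sigma> z) l + coord (\<sigma> w) l = 0"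
      unfolding Let_def 1 2 by simp
    show "let y = u x; z = u y; w = s x
      in (fst (\<tau> x) + fst (\<tau> y) + fst (\<tau> z)) mod int 1 = (fst (\<sigma> x) + fst (\<sigma> w)) mod int 1 \<and>
         coord (\<tau> x) l + coord (\<tau> y) l + coord (\<tau> z) l = coord (\<sigma> x) l + coord (\<sigma> w) l"
      unfolding Let_def 1 \<tau>_def by simp
  next
    fix x assume "x \<in> X" then show "reach m n \<sigma> \<tau> (g x) x" by (intro path g(1))
  next
    fix x i k j assume x: "x \<in> X" and k: "\<sigma> x = (i, k, j)"
    from cases [OF x] show "(j < r \<or> k = 0) \<and> ?loop matS x =
      mmul ((1, 0, 0, 1) [^]\<^bsub>SL2\<^esub> i) ((if j < r then L j else (1, 0, 0, 1)) [^]\<^bsub>SL2\<^esub> k)"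
    proof
      assume xR: "x \<in> R"
      then have "k = 0" using \<sigma>R k by simp
      then show ?thesis using loopR [OF xR] by (simp only: one_pow mmul_one) simp
    next
      assume "\<exists>j<r. x = e j \<or> x = s (e j) \<or> x = s (s (e j)) \<or> x = s (s (s (e j)))"
      then obtain j' where j': "j' < r" "x = e j' \<or> x = s (e j') \<or> x = s (s (e j')) \<or> x = s (s
          (s (e j')))" by blast
      then have "i = 0 \<and> j = j'" using k \<sigma>e [OF j'(1)] by (elim disjE; simp del: lact.simps)
      moreover have "x \<in> sorb (e j')" using j'(2) unfolding sorb_def by blast
      ultimately show ?thesis using SLj [OF j'(1), of x k] k j'(1) by (simp only: one_pow
          mmul_one) simp
    qed
  next
    fix x i k j assume x: "x \<in> X" and k: "\<tau> x = (i, k, j)"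
    then have "k = 0" by (simp add: \<tau>_def)
    then show "(j < r \<or> k = 0) \<and> ?loop matU x =
      mmul ((1, 0, 0, 1) [^]\<^bsub>SL2\<^esub> i) ((if j < r then L j else (1, 0, 0, 1)) [^]\<^bsub>SL2\<^esub> k)"
      using loopU [OF x] by (simp only: one_pow mmul_one) simp
  next
    fix j assume "j < r"
    then show "\<exists>x. x \<in> X \<and> \<sigma> x = (0, 1, j)" using e(3) \<sigma>e by blast
  next
    fix c assume "c \<in> hom (SL2\<lparr>carrier := Delta m n\<rparr>) (TT 1 r)" "c ` Delta m n = carrier (TT 1 r)"
      "\<And>A. A \<in> Delta m n \<Longrightarrow> c A = \<one>\<^bsub>TT 1 r\<^esub> \<Longrightarrow> A \<in> derived SL2 (Delta m n)"
    then show ?thesis by (intro exI [of _ c] conjI ballI impI)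
  qed (simp_all add: one_Delta L_Delta one_pow del: SL2_carrier)
  have "card X = card R + card N"
    unfolding N_def using card_Diff_subset [OF finite_subset [OF R(1) finite_X] R(1)] card_mono
        [OF finite_X R(1)] by simp
  then have "12 * r = card X + 12" using e(1) card by linarith
  then show ?thesis using result that by blast
qed

end

section \<open>The three exceptional groups\<close>

lemma orb_subsetI:
  assumes "base_point m n \<in> Z" "\<And>z. z \<in> Z \<Longrightarrow> lact m n matS z \<in> Z" "\<And>z. z \<in> Z \<Longrightarrow> lact m n matU z \<in> Z"
  shows "orb m n \<subseteq> Z"
proof -
  have "lact m n A (base_point m n) \<in> Z" if "A \<in> carrier SL2" for A
    using that
  proof (induction rule: SL2_induct)
    case one
    show ?case using assms(1) by (simp only: lact_one [OF base_in_orb])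
  qed (simp_all only: lact_mult assms)
  then show ?thesis unfolding orb_def by (intro image_subsetI)
qed

text \<open>The transversal \<open>?g\<close> runs along a spanning tree of the graph of groups; \<open>?s\<close> and \<open>?t\<close>
  record the classes of the loops that \<open>S\<close> and \<open>U\<close> close up outside the tree.\<close>

lemma Delta_2_1:
  obtains c where "c \<in> hom (SL2\<lparr>carrier := Delta 2 1\<rparr>) (TT 4 1)"
    "c ` Delta 2 1 = carrier (TT 4 1)"
    "\<And>A. A \<in> Delta 2 1 \<Longrightarrow> c A = \<one>\<^bsub>TT 4 1\<^esub> \<Longrightarrow> A \<in> derived SL2 (Delta 2 1)"
proof -
  \<comment> \<open>\<open>S\<close> fixes \<open>(1, 1, 0, 0)\<close>, and the loop there is
    \<open>E\<close>, of order 4. As \<open>-1 = E^2\<close> fixes all three points, the label 2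
    marks the steps that close up with a sign; \<open>S\<close> at \<open>(1, 0, 0, 0)\<close> gives
    the free generator \<open>L\<close>.\<close>
  let ?s = "(\<lambda>x. if x = (1, 0, 0, 0) then (0, 1, 0) else if x = (1, 1, 0, 0) then (1, 0, 0) else
      if x = (0, 1, 0, 0) then (2, -1, 0) else (0, 0, 0)) :: mat2 \<Rightarrow> int \<times> int \<times> nat"
  let ?t = "(\<lambda>x. if x = (0, 1, 0, 0) then (2, 0, 0) else (0, 0, 0)) :: mat2 \<Rightarrow> int \<times> int \<times> nat"
  let ?g = "(\<lambda>x. if x = (1, 0, 0, 0) then (1, 0, 0, 1) else if x = (1, 1, 0, 0) then (0, 1, -1,
      1) else (-1, 1, -1, 0)) :: mat2 \<Rightarrow> mat2"
  let ?E = "(-1, 2, -1, 1) :: mat2"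
  let ?L = "(\<lambda>j. (1, 0, 1, 1)) :: nat \<Rightarrow> mat2"
  let ?Z = "{(1, 0, 0, 0), (1, 1, 0, 0), (0, 1, 0, 0)} :: mat2 set"
  let ?r = "reach 2 1 ?s ?t"
  have orb: "orb 2 1 \<subseteq> ?Z"
    by (rule orb_subsetI) (simp add: base_point_def, (elim insertE emptyE; simp)+)
  have r0: "?r (1, 0, 0, 1) (1, 0, 0, 0)" using reach.one [of 2 1 ?s ?t] by (simp add: base_point_def)
  have r1: "?r (0, 1, -1, 1) (1, 1, 0, 0)" using reach.U [OF r0, of 0] by simp
  have r2: "?r (-1, 1, -1, 0) (0, 1, 0, 0)" using reach.U [OF r1, of 0] by simp
  have ls: "lact 2 1 matS (1, 0, 0, 0) = (0, 1, 0, 0)"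
    "lact 2 1 matS (1, 1, 0, 0) = (1, 1, 0, 0)"
    "lact 2 1 matS (0, 1, 0, 0) = (1, 0, 0, 0)"
    by simp_all
  have lu: "lact 2 1 matU (1, 0, 0, 0) = (1, 1, 0, 0)"
    "lact 2 1 matU (1, 1, 0, 0) = (0, 1, 0, 0)"
    "lact 2 1 matU (0, 1, 0, 0) = (1, 0, 0, 0)"
    by simp_all
  have p0: "(1, 1, 0, 0) \<in> orb 2 1"
    unfolding orb_def by (rule image_eqI [of _ _ "(0, 1, -1, 1)"], simp add: base_point_def, simp)
  have p1: "(1, 0, 0, 0) \<in> orb 2 1"
    unfolding orb_def by (rule image_eqI [of _ _ "(1, 0, 0, 1)"], simp add: base_point_def, simp)
  show ?thesis
  proof (rule Delta_abelianization [of 4 2 1 ?s ?t ?g ?E 1 ?L])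
    fix x :: mat2 and l assume "x \<in> orb 2 1"
    then have Z: "x \<in> ?Z" by (rule subsetD [OF orb])
    then show "let y = lact 2 1 matS x; z = lact 2 1 matS y; w = lact 2 1 matS z
      in (fst (?s x) + fst (?s y) + fst (?s z) + fst (?s w)) mod int 4 = 0 \<and>
         coord (?s x) l + coord (?s y) l + coord (?s z) l + coord (?s w) l = 0"
      by (elim insertE emptyE; simp only: Let_def ls lu; simp)
    from Z show "let y = lact 2 1 matU x; z = lact 2 1 matU y; w = lact 2 1 matS x
      in (fst (?t x) + fst (?t y) + fst (?t z)) mod int 4 = (fst (?s x) + fst (?s w)) mod int 4 \<and>
         coord (?t x) l + coord (?t y) l + coord (?t z) l = coord (?s x) l + coord (?s w) l"
      by (elim insertE emptyE; simp only: Let_def ls lu; simp)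
  next
    fix x assume "x \<in> orb 2 1"
    then have "x \<in> ?Z" by (rule subsetD [OF orb])
    then show "?r (?g x) x"
      using r0 r1 r2 by (elim insertE emptyE; simp)
  next
    fix x i k j assume "x \<in> orb 2 1" and eq: "?s x = (i, k, j)"
    then have "x \<in> ?Z" by (intro subsetD [OF orb])
    then show "(j < 1 \<or> k = 0) \<and> loop 2 1 ?g matS x =
      mmul (?E [^]\<^bsub>SL2\<^esub> i) ((if j < 1 then ?L j else (1, 0, 0, 1)) [^]\<^bsub>SL2\<^esub> k)"
      using eq by (elim insertE emptyE; auto simp: loop_def int_pow_simps_SL2)
  next
    fix x i k j assume "x \<in> orb 2 1" and eq: "?t x = (i, k, j)"
    then have "x \<in> ?Z" by (intro subsetD [OF orb])
    then show "(j < 1 \<or> k = 0) \<and> loop 2 1 ?g matU x =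
      mmul (?E [^]\<^bsub>SL2\<^esub> i) ((if j < 1 then ?L j else (1, 0, 0, 1)) [^]\<^bsub>SL2\<^esub> k)"
      using eq by (elim insertE emptyE; auto simp: loop_def int_pow_simps_SL2)
  next
    show "4 = (1::nat) \<or> (\<exists>x j. x \<in> orb 2 1 \<and> (?s x = (1, 0, j) \<or> ?t x = (1, 0, j)))"
      using p0 p1 by (intro disjI2 exI [of _ "(1, 1, 0, 0)"] exI [of _ 0]) simp
  next
    fix j :: nat assume "j < 1"
    then have "j = 0" by auto
    then show "\<exists>x. x \<in> orb 2 1 \<and> ?s x = (0, 1, j)"
      using p0 p1 by (intro exI [of _ "(1, 0, 0, 0)"]) simp
  next
    fix c assume "c \<in> hom (SL2\<lparr>carrier := Delta 2 1\<rparr>) (TT 4 1)" "c ` Delta 2 1 = carrier (TT 4 1)"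
      "\<And>A. A \<in> Delta 2 1 \<Longrightarrow> c A = \<one>\<^bsub>TT 4 1\<^esub> \<Longrightarrow> A \<in> derived SL2 (Delta 2 1)"
    then show ?thesis by (rule that)
  qed (auto simp: Delta_def int_pow_simps_SL2)
qed

text \<open>\<open>U\<close> exchanges \<open>(2, 2, 0, 0)\<close> and \<open>(1, 1, 0, 0)\<close>,
  so \<open>U^2\<close> fixes them and the loop of \<open>U\<close> there is \<open>E\<close>, of
  order 3. The orbit of \<open>S\<close> through these points is the tree edge; the other orbit of
  \<open>S\<close> gives the free generator \<open>L\<close>.\<close>

lemma Delta_3_1:
  obtains c where "c \<in> hom (SL2\<lparr>carrier := Delta 3 1\<rparr>) (TT 3 1)"
    "c ` Delta 3 1 = carrier (TT 3 1)"
    "\<And>A. A \<in> Delta 3 1 \<Longrightarrow> c A = \<one>\<^bsub>TT 3 1\<^esub> \<Longrightarrow> A \<in> derived SL2 (Delta 3 1)"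
proof -
  let ?s = "(\<lambda>x. if x = (1, 0, 0, 0) then (0, 1, 0) else if x = (0, 2, 0, 0) then (0, -1, 0)
      else if x = (2, 0, 0, 0) then (0, 1, 0) else if x = (0, 1, 0, 0) then (0, -1, 0) else (0,
      0, 0)) :: mat2 \<Rightarrow> int \<times> int \<times> nat"
  let ?t = "(\<lambda>x. if x = (2, 2, 0, 0) then (1, 0, 0) else if x = (1, 1, 0, 0) then (1, 0, 0) else
      (0, 0, 0)) :: mat2 \<Rightarrow> int \<times> int \<times> nat"
  let ?g = "(\<lambda>x. if x = (1, 0, 0, 0) then (1, 0, 0, 1) else if x = (1, 2, 0, 0) then (0, 1, -1,
      1) else if x = (0, 2, 0, 0) then (-1, 1, -1, 0) else if x = (2, 0, 0, 0) then (-1, 0, 0,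
      -1) else if x = (2, 1, 0, 0) then (0, -1, 1, -1) else if x = (0, 1, 0, 0) then (1, -1, 1,
      0) else if x = (2, 2, 0, 0) then (-1, 1, 0, -1) else (1, -1, 0, 1)) :: mat2 \<Rightarrow> mat2"
  let ?E = "(1, -3, 1, -2) :: mat2"
  let ?L = "(\<lambda>j. (1, 0, 1, 1)) :: nat \<Rightarrow> mat2"
  let ?Z = "{(1, 0, 0, 0), (1, 2, 0, 0), (0, 2, 0, 0), (2, 0, 0, 0), (2, 1, 0, 0), (0, 1, 0, 0),
      (2, 2, 0, 0), (1, 1, 0, 0)} :: mat2 set"
  let ?r = "reach 3 1 ?s ?t"
  have orb: "orb 3 1 \<subseteq> ?Z"
    by (rule orb_subsetI) (simp add: base_point_def, (elim insertE emptyE; simp)+)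
  have r0: "?r (1, 0, 0, 1) (1, 0, 0, 0)" using reach.one [of 3 1 ?s ?t] by (simp add: base_point_def)
  have r1: "?r (0, 1, -1, 1) (1, 2, 0, 0)" using reach.U [OF r0, of 0] by simp
  have r2: "?r (-1, 1, -1, 0) (0, 2, 0, 0)" using reach.U [OF r1, of 0] by simp
  have r3: "?r (-1, 1, 0, -1) (2, 2, 0, 0)" using reach.S [OF r1, of 0] by simp
  have r4: "?r (-1, 0, 0, -1) (2, 0, 0, 0)" using reach.U [OF r2, of 0] by simp
  have r5: "?r (0, -1, 1, -1) (2, 1, 0, 0)" using reach.S [OF r3, of 0] by simp
  have r6: "?r (1, -1, 1, 0) (0, 1, 0, 0)" using reach.U [OF r5, of 0] by simp
  have r7: "?r (1, -1, 0, 1) (1, 1, 0, 0)" using reach.S [OF r5, of 0] by simp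
  have ls: "lact 3 1 matS (1, 0, 0, 0) = (0, 2, 0, 0)"
    "lact 3 1 matS (1, 2, 0, 0) = (2, 2, 0, 0)"
    "lact 3 1 matS (0, 2, 0, 0) = (2, 0, 0, 0)"
    "lact 3 1 matS (2, 0, 0, 0) = (0, 1, 0, 0)"
    "lact 3 1 matS (2, 1, 0, 0) = (1, 1, 0, 0)"
    "lact 3 1 matS (0, 1, 0, 0) = (1, 0, 0, 0)"
    "lact 3 1 matS (2, 2, 0, 0) = (2, 1, 0, 0)"
    "lact 3 1 matS (1, 1, 0, 0) = (1, 2, 0, 0)"
    by simp_all
  have lu: "lact 3 1 matU (1, 0, 0, 0) = (1, 2, 0, 0)"
    "lact 3 1 matU (1, 2, 0, 0) = (0, 2, 0, 0)"
    "lact 3 1 matU (0, 2, 0, 0) = (2, 0, 0, 0)"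
    "lact 3 1 matU (2, 0, 0, 0) = (2, 1, 0, 0)"
    "lact 3 1 matU (2, 1, 0, 0) = (0, 1, 0, 0)"
    "lact 3 1 matU (0, 1, 0, 0) = (1, 0, 0, 0)"
    "lact 3 1 matU (2, 2, 0, 0) = (1, 1, 0, 0)"
    "lact 3 1 matU (1, 1, 0, 0) = (2, 2, 0, 0)"
    by simp_all
  have p0: "(2, 2, 0, 0) \<in> orb 3 1"
    unfolding orb_def by (rule image_eqI [of _ _ "(-1, 1, 0, -1)"], simp add: base_point_def, simp)
  have p1: "(1, 0, 0, 0) \<in> orb 3 1"
    unfolding orb_def by (rule image_eqI [of _ _ "(1, 0, 0, 1)"], simp add: base_point_def, simp)
  show ?thesis
  proof (rule Delta_abelianization [of 3 3 1 ?s ?t ?g ?E 1 ?L])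
    fix x :: mat2 and l assume "x \<in> orb 3 1"
    then have Z: "x \<in> ?Z" by (rule subsetD [OF orb])
    then show "let y = lact 3 1 matS x; z = lact 3 1 matS y; w = lact 3 1 matS z
      in (fst (?s x) + fst (?s y) + fst (?s z) + fst (?s w)) mod int 3 = 0 \<and>
         coord (?s x) l + coord (?s y) l + coord (?s z) l + coord (?s w) l = 0"
      by (elim insertE emptyE; simp only: Let_def ls lu; simp)
    from Z show "let y = lact 3 1 matU x; z = lact 3 1 matU y; w = lact 3 1 matS x
      in (fst (?t x) + fst (?t y) + fst (?t z)) mod int 3 = (fst (?s x) + fst (?s w)) mod int 3 \<and>
         coord (?t x) l + coord (?t y) l + coord (?t z) l = coord (?s x) l + coord (?s w) l"
      by (elim insertE emptyE; simp only: Let_def ls lu; simp)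
  next
    fix x assume "x \<in> orb 3 1"
    then have "x \<in> ?Z" by (rule subsetD [OF orb])
    then show "?r (?g x) x"
      using r0 r1 r2 r4 r5 r6 r3 r7 by (elim insertE emptyE; simp)
  next
    fix x i k j assume "x \<in> orb 3 1" and eq: "?s x = (i, k, j)"
    then have "x \<in> ?Z" by (intro subsetD [OF orb])
    then show "(j < 1 \<or> k = 0) \<and> loop 3 1 ?g matS x =
      mmul (?E [^]\<^bsub>SL2\<^esub> i) ((if j < 1 then ?L j else (1, 0, 0, 1)) [^]\<^bsub>SL2\<^esub> k)"
      using eq by (elim insertE emptyE; auto simp: loop_def int_pow_simps_SL2)
  next
    fix x i k j assume "x \<in> orb 3 1" and eq: "?t x = (i, k, j)"
    then have "x \<in> ?Z" by (intro subsetD [OF orb])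
    then show "(j < 1 \<or> k = 0) \<and> loop 3 1 ?g matU x =
      mmul (?E [^]\<^bsub>SL2\<^esub> i) ((if j < 1 then ?L j else (1, 0, 0, 1)) [^]\<^bsub>SL2\<^esub> k)"
      using eq by (elim insertE emptyE; auto simp: loop_def int_pow_simps_SL2)
  next
    show "3 = (1::nat) \<or> (\<exists>x j. x \<in> orb 3 1 \<and> (?s x = (1, 0, j) \<or> ?t x = (1, 0, j)))"
      using p0 p1 by (intro disjI2 exI [of _ "(2, 2, 0, 0)"] exI [of _ 0]) simp
  next
    fix j :: nat assume "j < 1"
    then have "j = 0" by auto
    then show "\<exists>x. x \<in> orb 3 1 \<and> ?s x = (0, 1, j)"
      using p0 p1 by (intro exI [of _ "(1, 0, 0, 0)"]) simp
  next
    fix c assume "c \<in> hom (SL2\<lparr>carrier := Delta 3 1\<rparr>) (TT 3 1)" "c ` Delta 3 1 = carrier (TT 3 1)"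
      "\<And>A. A \<in> Delta 3 1 \<Longrightarrow> c A = \<one>\<^bsub>TT 3 1\<^esub> \<Longrightarrow> A \<in> derived SL2 (Delta 3 1)"
    then show ?thesis by (rule that)
  qed (auto simp: Delta_def int_pow_simps_SL2)
qed

text \<open>\<open>E = -1\<close> fixes all six points. The graph has two vertices, the orbits of
  \<open>U\<close> with three points each, joined by three edges with two points each. One edge is
  the tree, the others give \<open>L 0\<close> and \<open>L 1\<close>; the first entry of a label
  records the sign.\<close>

lemma Delta_2_2:
  obtains c where "c \<in> hom (SL2\<lparr>carrier := Delta 2 2\<rparr>) (TT 2 2)"
    "c ` Delta 2 2 = carrier (TT 2 2)"
    "\<And>A. A \<in> Delta 2 2 \<Longrightarrow> c A = \<one>\<^bsub>TT 2 2\<^esub> \<Longrightarrow> A \<in> derived SL2 (Delta 2 2)"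
proof -
  let ?s = "(\<lambda>x. if x = (0, 1, 1, 0) then (1, 0, 0) else if x = (1, 1, 1, 0) then (0, 1, 0) else
      if x = (1, 1, 0, 1) then (1, -1, 0) else if x = (0, 1, 1, 1) then (0, 1, 1) else if x =
      (1, 0, 1, 1) then (1, -1, 1) else (0, 0, 0)) :: mat2 \<Rightarrow> int \<times> int \<times> nat"
  let ?t = "(\<lambda>x. if x = (0, 1, 1, 1) then (1, 0, 0) else if x = (1, 1, 0, 1) then (1, 0, 0) else
      (0, 0, 0)) :: mat2 \<Rightarrow> int \<times> int \<times> nat"
  let ?g = "(\<lambda>x. if x = (1, 0, 0, 1) then (1, 0, 0, 1) else if x = (1, 1, 1, 0) then (0, 1, -1,
      1) else if x = (0, 1, 1, 1) then (-1, 1, -1, 0) else if x = (0, 1, 1, 0) then (0, 1, -1,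
      0) else if x = (1, 0, 1, 1) then (-1, 0, -1, -1) else (-1, -1, 0, -1)) :: mat2 \<Rightarrow> mat2"
  let ?E = "(-1, 0, 0, -1) :: mat2"
  let ?L = "(\<lambda>j. if j = 0 then (1, -2, 0, 1) else (1, 0, -2, 1)) :: nat \<Rightarrow> mat2"
  let ?Z = "{(1, 0, 0, 1), (1, 1, 1, 0), (0, 1, 1, 1), (0, 1, 1, 0), (1, 0, 1, 1), (1, 1, 0, 1)}
      :: mat2 set"
  let ?r = "reach 2 2 ?s ?t"
  have orb: "orb 2 2 \<subseteq> ?Z"
    by (rule orb_subsetI) (simp add: base_point_def, (elim insertE emptyE; simp)+)
  have r0: "?r (1, 0, 0, 1) (1, 0, 0, 1)" using reach.one [of 2 2 ?s ?t] by (simp add: base_point_def)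
  have r1: "?r (0, 1, -1, 1) (1, 1, 1, 0)" using reach.U [OF r0, of 0] by simp
  have r2: "?r (0, 1, -1, 0) (0, 1, 1, 0)" using reach.S [OF r0, of 0] by simp
  have r3: "?r (-1, 1, -1, 0) (0, 1, 1, 1)" using reach.U [OF r1, of 0] by simp
  have r4: "?r (-1, 0, -1, -1) (1, 0, 1, 1)" using reach.U [OF r2, of 0] by simp
  have r5: "?r (-1, -1, 0, -1) (1, 1, 0, 1)" using reach.U [OF r4, of 0] by simp
  have ls: "lact 2 2 matS (1, 0, 0, 1) = (0, 1, 1, 0)"
    "lact 2 2 matS (1, 1, 1, 0) = (1, 1, 0, 1)"
    "lact 2 2 matS (0, 1, 1, 1) = (1, 0, 1, 1)"
    "lact 2 2 matS (0, 1, 1, 0) = (1, 0, 0, 1)"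
    "lact 2 2 matS (1, 0, 1, 1) = (0, 1, 1, 1)"
    "lact 2 2 matS (1, 1, 0, 1) = (1, 1, 1, 0)"
    by simp_all
  have lu: "lact 2 2 matU (1, 0, 0, 1) = (1, 1, 1, 0)"
    "lact 2 2 matU (1, 1, 1, 0) = (0, 1, 1, 1)"
    "lact 2 2 matU (0, 1, 1, 1) = (1, 0, 0, 1)"
    "lact 2 2 matU (0, 1, 1, 0) = (1, 0, 1, 1)"
    "lact 2 2 matU (1, 0, 1, 1) = (1, 1, 0, 1)"
    "lact 2 2 matU (1, 1, 0, 1) = (0, 1, 1, 0)"
    by simp_all
  have p0: "(0, 1, 1, 0) \<in> orb 2 2"
    unfolding orb_def by (rule image_eqI [of _ _ "(0, 1, -1, 0)"], simp add: base_point_def, simp)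
  have p1: "(1, 1, 1, 0) \<in> orb 2 2"
    unfolding orb_def by (rule image_eqI [of _ _ "(0, 1, -1, 1)"], simp add: base_point_def, simp)
  have p2: "(0, 1, 1, 1) \<in> orb 2 2"
    unfolding orb_def by (rule image_eqI [of _ _ "(-1, 1, -1, 0)"], simp add: base_point_def, simp)
  show ?thesis
  proof (rule Delta_abelianization [of 2 2 2 ?s ?t ?g ?E 2 ?L])
    fix x :: mat2 and l assume "x \<in> orb 2 2"
    then have Z: "x \<in> ?Z" by (rule subsetD [OF orb])
    then show "let y = lact 2 2 matS x; z = lact 2 2 matS y; w = lact 2 2 matS z
      in (fst (?s x) + fst (?s y) + fst (?s z) + fst (?s w)) mod int 2 = 0 \<and>
         coord (?s x) l + coord (?s y) l + coord (?s z) l + coord (?s w) l = 0"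
      by (elim insertE emptyE; simp only: Let_def ls lu; simp)
    from Z show "let y = lact 2 2 matU x; z = lact 2 2 matU y; w = lact 2 2 matS x
      in (fst (?t x) + fst (?t y) + fst (?t z)) mod int 2 = (fst (?s x) + fst (?s w)) mod int 2 \<and>
         coord (?t x) l + coord (?t y) l + coord (?t z) l = coord (?s x) l + coord (?s w) l"
      by (elim insertE emptyE; simp only: Let_def ls lu; simp)
  next
    fix x assume "x \<in> orb 2 2"
    then have "x \<in> ?Z" by (rule subsetD [OF orb])
    then show "?r (?g x) x"
      using r0 r1 r3 r2 r4 r5 by (elim insertE emptyE; simp)
  next
    fix x i k j assume "x \<in> orb 2 2" and eq: "?s x = (i, k, j)"
    then have "x \<in> ?Z" by (intro subsetD [OF orb])
    then show "(j < 2 \<or> k = 0) \<and> loop 2 2 ?g matS x =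
      mmul (?E [^]\<^bsub>SL2\<^esub> i) ((if j < 2 then ?L j else (1, 0, 0, 1)) [^]\<^bsub>SL2\<^esub> k)"
      using eq by (elim insertE emptyE; auto simp: loop_def int_pow_simps_SL2)
  next
    fix x i k j assume "x \<in> orb 2 2" and eq: "?t x = (i, k, j)"
    then have "x \<in> ?Z" by (intro subsetD [OF orb])
    then show "(j < 2 \<or> k = 0) \<and> loop 2 2 ?g matU x =
      mmul (?E [^]\<^bsub>SL2\<^esub> i) ((if j < 2 then ?L j else (1, 0, 0, 1)) [^]\<^bsub>SL2\<^esub> k)"
      using eq by (elim insertE emptyE; auto simp: loop_def int_pow_simps_SL2)
  next
    show "2 = (1::nat) \<or> (\<exists>x j. x \<in> orb 2 2 \<and> (?s x = (1, 0, j) \<or> ?t x = (1, 0, j)))"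
      using p0 p1 p2 by (intro disjI2 exI [of _ "(0, 1, 1, 0)"] exI [of _ 0]) simp
  next
    fix j :: nat assume "j < 2"
    then have "j = 0 \<or> j = 1" by auto
    then show "\<exists>x. x \<in> orb 2 2 \<and> ?s x = (0, 1, j)"
      using p0 p1 p2 by (elim disjE) (rule exI [of _ "(1, 1, 1, 0)"], simp, rule exI [of _ "(0,
          1, 1, 1)"], simp)
  next
    fix c assume "c \<in> hom (SL2\<lparr>carrier := Delta 2 2\<rparr>) (TT 2 2)" "c ` Delta 2 2 = carrier (TT 2 2)"
      "\<And>A. A \<in> Delta 2 2 \<Longrightarrow> c A = \<one>\<^bsub>TT 2 2\<^esub> \<Longrightarrow> A \<in> derived SL2 (Delta 2 2)"
    then show ?thesis by (rule that)
  qed (auto simp: Delta_def int_pow_simps_SL2)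
qed

section \<open>Arbitrary epimorphisms\<close>

lemma abelianization_iso:
  assumes G: "group G" and H: "group H" and h: "h \<in> iso G H"
  shows "abelianization G \<cong> abelianization H"
proof -
  interpret G: group G by (rule G)
  interpret H: group H by (rule H)
  have hom: "h \<in> hom G H" and surj: "h ` carrier G = carrier H" and inj: "inj_on h (carrier G)"
    using h by (auto simp: iso_iff)
  interpret h: group_hom G H h using hom G H by (simp add: group_hom_def group_hom_axioms_def)
  let ?DG = "derived G (carrier G)" and ?DH = "derived H (carrier H)"
  interpret N: normal ?DH H by (rule H.derived_self_is_normal)
  let ?q = "\<lambda>x. ?DH #>\<^bsub>H\<^esub> h x"
  have q: "?q \<in> hom G (abelianization H)"
    using hom_compose [OF hom N.r_coset_hom_Mod] by (simp add: abelianization_def comp_def)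
  interpret q: group_hom G "abelianization H" ?q
    using q G comm_group_abelianization [OF H] by (simp add: group_hom_def group_hom_axioms_def
        comm_group.axioms)
  have D: "h ` ?DG = ?DH" using h.derived_img [OF subset_refl] surj by simp
  have "?q ` carrier G = (\<lambda>y. ?DH #>\<^bsub>H\<^esub> y) ` (h ` carrier G)" by (simp add: image_image)
  also have "\<dots> = carrier (abelianization H)"
    unfolding surj by (auto simp: abelianization_def FactGroup_def RCOSETS_def)
  finally have surj': "?q ` carrier G = carrier (abelianization H)" .
  have "kernel G (abelianization H) ?q = ?DG"
  proof (intro equalityI subsetI)
    fix x assume "x \<in> kernel G (abelianization H) ?q"
    then have x: "x \<in> carrier G" "?DH #>\<^bsub>H\<^esub> h x = ?DH"
      by (auto simp: kernel_def abelianization_def FactGroup_def)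
    then have "h x \<in> ?DH" using H.rcos_self [OF _ N.subgroup_axioms, of "h x"] by simp
    then obtain y where y: "y \<in> ?DG" "h x = h y" unfolding D [symmetric] by blast
    then have "y \<in> carrier G" using G.derived_in_carrier [OF subset_refl] by blast
    then show "x \<in> ?DG" using inj_onD [OF inj y(2)] x(1) y(1) by simp
  next
    fix x assume x: "x \<in> ?DG"
    then have "x \<in> carrier G" "h x \<in> ?DH" using G.derived_in_carrier [OF subset_refl] D by blast+
    then show "x \<in> kernel G (abelianization H) ?q"
      using N.rcos_const [OF H] by (simp add: kernel_def abelianization_def FactGroup_def)
  qed
  then show ?thesis using q.FactGroup_iso [OF surj'] by (simp add: abelianization_def)
qed

text \<open>Only the kernel is normalised, since the determinant of \<open>\<pi>\<close> modulo
  \<open>n\<close> is invariant under special automorphisms. The first row can be brought to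
  \<open>(1, 0)\<close>; the second becomes \<open>(q', s')\<close> with \<open>s'\<close> a unit
  modulo \<open>n\<close>, and this already determines the kernel.\<close>

lemma standard_kernel:
  assumes m: "m > 0" and n: "n > 0" "n dvd m" and \<pi>: "\<pi> \<in> epi F2 (ZZ m n)"
  obtains \<theta> where "\<theta> \<in> special"
    "\<And>w. w \<in> carrier F2 \<Longrightarrow> \<pi> (\<theta> w) = \<one>\<^bsub>ZZ m n\<^esub> \<longleftrightarrow> int m dvd expx w \<and> int n dvd expy w"
proof -
  interpret ZZ: comm_group "ZZ m n" by (rule comm_group_ZZ)
  have hom: "\<pi> \<in> hom F2 (ZZ m n)" and surj: "\<pi> ` carrier F2 = carrier (ZZ m n)"
    using \<pi> by (auto simp: epi_def)
  obtain p q where x: "\<pi> gx = (p, q)" by (cases "\<pi> gx")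
  obtain r s where y: "\<pi> gy = (r, s)" by (cases "\<pi> gy")
  have c: "(p, q) \<in> carrier (ZZ m n)" "(r, s) \<in> carrier (ZZ m n)"
    using hom_in_carrier [OF hom gen_closed] x y by metis+
  have \<pi>_eq: "\<pi> w = ((p * expx w + r * expy w) mod int m, (q * expx w + s * expy w) mod int n)"
    if "w \<in> carrier F2" for w
  proof (rule F2_hom_eqI [OF ZZ.is_group hom _ _ _ that])
    show "(\<lambda>w. ((p * expx w + r * expy w) mod int m, (q * expx w + s * expy w) mod int n)) \<in> hom
        F2 (ZZ m n)"
    proof -
      have "(p * (X + X') + r * (Y + Y')) mod k = ((p * X + r * Y) mod k + (p * X' + r * Y') mod
          k) mod k"
        for p r X X' Y Y' k :: int
        by (simp only: mod_add_eq) (simp add: algebra_simps)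
      then show ?thesis using m n by (intro homI) (simp_all add: carrier_integer_mod_group)
    qed
  qed (use x y c m n in \<open>auto simp: carrier_integer_mod_group\<close>)
  have onto: "\<exists>X Y. int m dvd p * X + r * Y - i \<and> int n dvd q * X + s * Y - j" for i j
  proof -
    have "(i mod int m, j mod int n) \<in> carrier (ZZ m n)"
      using m n by (simp add: carrier_integer_mod_group)
    then obtain w where "w \<in> carrier F2" "\<pi> w = (i mod int m, j mod int n)"
      unfolding surj [symmetric] by (auto simp del: carrier_DirProd)
    then show ?thesis using \<pi>_eq [of w] by (auto simp: mod_eq_dvd_iff)
  qed
  have prim: "\<not> (k dvd p \<and> k dvd r)" if k: "prime k" "k dvd int m" for k :: int
  proof
    assume kpr: "k dvd p \<and> k dvd r"
    obtain X Y where "int m dvd p * X + r * Y - 1" using onto by blast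
    then have "k dvd p * X + r * Y - 1" using k(2) dvd_trans by blast
    moreover have "k dvd p * X + r * Y" using kpr by simp
    ultimately have "k dvd (p * X + r * Y) - (p * X + r * Y - 1)" by (rule dvd_diff [rotated])
    also have "(p * X + r * Y) - (p * X + r * Y - 1) = 1" by simp
    finally show False using k(1) not_prime_unit by blast
  qed
  obtain p' r' where l: "int m dvd p' - p" "int m dvd r' - r" "coprime p' r'"
    using coprime_lift [of "int m" p r] prim m by auto
  obtain a c where ac: "a * p' + c * r' = 1" using bezout_int [of p' r'] l(3) by auto
  \<comment> \<open>Right multiplication by this matrix takes the row \<open>(p', r')\<close> to
    \<open>(1, 0)\<close>.\<close>
  then have "(a, - r', c, p') \<in> carrier SL2" by (simp add: algebra_simps)
  then obtain \<theta> where \<theta>: "\<theta> \<in> special" "abmat \<theta> = (a, - r', c, p')" by (rule special_surj)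
  have \<theta>c: "\<theta> \<in> carrier Aut2" by (rule special_closed [OF \<theta>(1)])
  define q' where "q' = q * a + s * c"
  define s' where "s' = s * p' - q * r'"
  have e\<theta>: "expx (\<theta> w) = a * expx w - r' * expy w" "expy (\<theta> w) = c * expx w + p' * expy w"
    if "w \<in> carrier F2" for w
    using exp_aut [OF \<theta>c that] \<theta>(2) by (simp_all add: abmat_def)
  have nm: "int n dvd int m" using n(2) by simp
  have 1: "int m dvd p * (a * X - r' * Y) + r * (c * X + p' * Y) - X" for X Y
  proof -
    have "p * (a * X - r' * Y) + r * (c * X + p' * Y) - X =
        (a * p' + c * r' - 1) * X - (p' - p) * (a * X - r' * Y) - (r' - r) * (c * X + p' * Y)"
      by (simp add: algebra_simps)
    also have "\<dots> = - ((p' - p) * (a * X - r' * Y) + (r' - r) * (c * X + p' * Y))" using ac by simp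
    finally show ?thesis using l by simp
  qed
  have 2: "q * (a * X - r' * Y) + s * (c * X + p' * Y) = q' * X + s' * Y" for X Y
    by (simp add: q'_def s'_def algebra_simps)
  \<comment> \<open>A preimage of \<open>(0, 1)\<close>. Written in the new coordinates, its first
    entry \<open>X\<close> is divisible by \<open>m\<close>, so its second entry \<open>Y\<close>
    inverts \<open>s'\<close> modulo \<open>n\<close>.\<close>
  obtain X0 Y0 where XY: "int m dvd p * X0 + r * Y0 - 0" "int n dvd q * X0 + s * Y0 - 1" using
      onto by blast
  define X where "X = p' * X0 + r' * Y0"
  define Y where "Y = a * Y0 - c * X0"
  have XY0: "a * X - r' * Y = (a * p' + c * r') * X0" "c * X + p' * Y = (a * p' + c * r') * Y0"
    by (simp_all add: X_def Y_def algebra_simps)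
  have "int m dvd X"
  proof -
    have "X = (p * X0 + r * Y0) + ((p' - p) * X0 + (r' - r) * Y0)" by (simp add: X_def algebra_simps)
    then show ?thesis using XY(1) l by simp
  qed
  have "q' * X + s' * Y = q * X0 + s * Y0" using 2 [of X Y] unfolding XY0 ac by simp
  then have "int n dvd q' * X + s' * Y - 1" using XY(2) by simp
  moreover have "int n dvd q' * X" using dvd_trans [OF nm \<open>int m dvd X\<close>] by simp
  ultimately have "int n dvd (q' * X + s' * Y - 1) - q' * X" by (rule dvd_diff)
  then have unit: "int n dvd s' * Y - 1" by (simp add: algebra_simps)
  have "\<pi> (\<theta> w) = \<one>\<^bsub>ZZ m n\<^esub> \<longleftrightarrow> int m dvd expx w \<and> int n dvd expy w" if w: "w \<in> carrier F2" for w
  proof -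
    let ?X = "expx w" and ?Y = "expy w"
    have "\<pi> (\<theta> w) = \<one>\<^bsub>ZZ m n\<^esub> \<longleftrightarrow> int m dvd p * (a * ?X - r' * ?Y) + r * (c * ?X + p' * ?Y) \<and>
        int n dvd q' * ?X + s' * ?Y"
      using \<pi>_eq [OF aut_closed [OF \<theta>c w]] by (simp add: e\<theta> [OF w] 2 [symmetric] dvd_eq_mod_eq_0)
    also have "int m dvd p * (a * ?X - r' * ?Y) + r * (c * ?X + p' * ?Y) \<longleftrightarrow> int m dvd ?X"
      using 1 [of ?X ?Y] by (metis dvd_diff_right_iff dvd_diff_left_iff)
    also have "int m dvd ?X \<and> int n dvd q' * ?X + s' * ?Y \<longleftrightarrow> int m dvd ?X \<and> int n dvd ?Y"
    proof (rule conj_cong [OF refl])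
      assume "int m dvd ?X"
      then have "int n dvd q' * ?X" using nm by (meson dvd_mult dvd_trans)
      then have "int n dvd q' * ?X + s' * ?Y \<longleftrightarrow> int n dvd s' * ?Y" by (rule dvd_add_right_iff)
      also have "\<dots> \<longleftrightarrow> int n dvd ?Y"
      proof
        assume "int n dvd s' * ?Y"
        then have "int n dvd Y * (s' * ?Y) - (s' * Y - 1) * ?Y" using unit by (intro dvd_diff)
            simp_all
        then show "int n dvd ?Y" by (simp add: algebra_simps)
      qed simp
      finally show "int n dvd q' * ?X + s' * ?Y \<longleftrightarrow> int n dvd ?Y" .
    qed
    finally show ?thesis .
  qed
  then show ?thesis using that [OF \<theta>(1)] by blast
qed

lemma Gam_iff:
  "\<phi> \<in> Gam m n \<longleftrightarrow> \<phi> \<in> carrier Aut2 \<and> abmat \<phi> \<in> carrier SL2 \<and>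
    (\<forall>w\<in>carrier F2. int m dvd expx (\<phi> w) - expx w \<and> int n dvd expy (\<phi> w) - expy w)" (is "_ \<longleftrightarrow> ?R")
proof
  assume \<phi>: "\<phi> \<in> Gam m n"
  then have \<phi>c: "\<phi> \<in> carrier Aut2" and D: "abmat \<phi> \<in> Delta m n" by (simp_all add: Gam_def)
  have dvd: "int m dvd expx (\<phi> gx) - 1" "int m dvd expx (\<phi> gy)"
      "int n dvd expy (\<phi> gx)" "int n dvd expy (\<phi> gy) - 1"
    using D by (simp_all add: Delta_def abmat_def)
  have *: "int m dvd expx (\<phi> w) - expx w" "int n dvd expy (\<phi> w) - expy w" if w: "w \<in> carrier F2" for w
  proof -
    have "expx (\<phi> w) - expx w = (expx (\<phi> gx) - 1) * expx w + expx (\<phi> gy) * expy w"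
      "expy (\<phi> w) - expy w = expy (\<phi> gx) * expx w + (expy (\<phi> gy) - 1) * expy w"
      unfolding exp_aut [OF \<phi>c w] by (simp_all add: algebra_simps)
    then show "int m dvd expx (\<phi> w) - expx w" "int n dvd expy (\<phi> w) - expy w" using dvd by simp_all
  qed
  show ?R by (intro conjI ballI \<phi>c subsetD [OF Delta_subset D] *)
next
  assume R: ?R
  note all = conjunct2 [OF conjunct2 [OF R]]
  show "\<phi> \<in> Gam m n"
    using R bspec [OF all gen_closed [of 1]] bspec [OF all gen_closed [of 2]]
    by (simp add: Gam_def Delta_def abmat_def)
qed

text \<open>\<open>\<pi> \<circ> \<phi> = \<pi>\<close> means that \<open>\<phi> w\<close> and
  \<open>w\<close> always differ by an element of the kernel of \<open>\<pi>\<close>. So conjugation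
  by \<open>\<theta>\<close>, which carries the standard kernel to that of \<open>\<pi>\<close>,
  identifies the two groups.\<close>

theorem Gamma_plus_abelianization:
  assumes m: "m > 0" and n: "n > 0" "n dvd m" and \<pi>: "\<pi> \<in> epi F2 (ZZ m n)"
  shows "abelianization (Gamma_plus \<pi>) \<cong> abelianization (GG m n)"
proof -
  interpret ZZ: comm_group "ZZ m n" by (rule comm_group_ZZ)
  have hom: "\<pi> \<in> hom F2 (ZZ m n)" using \<pi> by (simp add: epi_def)
  interpret \<pi>: group_hom F2 "ZZ m n" \<pi>
    using hom by (simp add: group_hom_def group_hom_axioms_def group_free_group ZZ.is_group)
  obtain \<theta> where \<theta>: "\<theta> \<in> special"
    and ker: "\<And>w. w \<in> carrier F2 \<Longrightarrow> \<pi> (\<theta> w) = \<one>\<^bsub>ZZ m n\<^esub> \<longleftrightarrow> int m dvd expx w \<and> int n dvd expy w"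
    by (rule standard_kernel [OF m n \<pi>], rule that)
  have \<theta>c: "\<theta> \<in> carrier Aut2" and \<theta>S: "abmat \<theta> \<in> carrier SL2"
    using special_closed [OF \<theta>] special_act [OF \<theta>] by blast+
  define c where "c \<psi> = \<theta> \<otimes>\<^bsub>Aut2\<^esub> \<psi> \<otimes>\<^bsub>Aut2\<^esub> inv\<^bsub>Aut2\<^esub> \<theta>" for \<psi>
  have c_mult: "c (\<phi> \<otimes>\<^bsub>Aut2\<^esub> \<psi>) = c \<phi> \<otimes>\<^bsub>Aut2\<^esub> c \<psi>" if "\<phi> \<in> carrier Aut2" "\<psi> \<in> carrier Aut2" for \<phi> \<psi>
  proof -
    have "inv\<^bsub>Aut2\<^esub> \<theta> \<otimes>\<^bsub>Aut2\<^esub> (\<theta> \<otimes>\<^bsub>Aut2\<^esub> \<eta>) = \<eta>" if "\<eta> \<in> carrier Aut2" for \<eta>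
      using that \<theta>c by (simp add: Aut2.m_assoc [symmetric] Aut2.l_inv)
    then show ?thesis unfolding c_def using that \<theta>c by (simp add: Aut2.m_assoc)
  qed
  have c_closed: "c \<psi> \<in> carrier Aut2" if "\<psi> \<in> carrier Aut2" for \<psi>
    unfolding c_def using that \<theta>c by simp
  have c_hom: "c \<in> hom Aut2 Aut2" by (rule homI) (simp_all add: c_closed c_mult)
  interpret c: group_hom Aut2 Aut2 c using c_hom by (simp add: group_hom_def group_hom_axioms_def)
  have c_apply: "c \<psi> (\<theta> w) = \<theta> (\<psi> w)" if "\<psi> \<in> carrier Aut2" "w \<in> carrier F2" for \<psi> w
    unfolding c_def using that \<theta>c by simp
  have c_inj: "inj_on c (carrier Aut2)"
    unfolding c_def using \<theta>c by (auto simp: inj_on_def)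
  have c_onto: "\<exists>\<psi>\<in>carrier Aut2. \<phi> = c \<psi>" if "\<phi> \<in> carrier Aut2" for \<phi>
  proof (rule bexI)
    show "\<phi> = c (inv\<^bsub>Aut2\<^esub> \<theta> \<otimes>\<^bsub>Aut2\<^esub> \<phi> \<otimes>\<^bsub>Aut2\<^esub> \<theta>)"
    proof (rule aut_eqI)
      show "\<phi> gx = c (inv\<^bsub>Aut2\<^esub> \<theta> \<otimes>\<^bsub>Aut2\<^esub> \<phi> \<otimes>\<^bsub>Aut2\<^esub> \<theta>) gx" "\<phi> gy = c (inv\<^bsub>Aut2\<^esub> \<theta> \<otimes>\<^bsub>Aut2\<^esub> \<phi>
          \<otimes>\<^bsub>Aut2\<^esub> \<theta>) gy"
        unfolding c_def using that \<theta>c by simp_all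
    qed (use that \<theta>c in \<open>simp_all add: c_closed\<close>)
  qed (use that \<theta>c in simp)
  have det: "abmat (c \<psi>) \<in> carrier SL2 \<longleftrightarrow> abmat \<psi> \<in> carrier SL2" if \<psi>: "\<psi> \<in> carrier Aut2" for \<psi>
  proof -
    interpret SL2: group SL2 by (rule group_SL2)
    have i: "abmat (inv\<^bsub>Aut2\<^esub> \<theta>) = minv (abmat \<theta>)" using abmat_inv [OF \<theta>c \<theta>S] inv_SL2 [OF \<theta>S] by simp
    have eq: "abmat (c \<psi>) = mmul (mmul (abmat \<theta>) (abmat \<psi>)) (minv (abmat \<theta>))"
      unfolding c_def using \<psi> \<theta>c by (simp add: mat_mult i)
    note I = minv_SL2 [OF \<theta>S]
    show ?thesis
    proof
      assume "abmat \<psi> \<in> carrier SL2"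
      then show "abmat (c \<psi>) \<in> carrier SL2" unfolding eq by (intro SL2_closed \<theta>S I(1))
    next
      assume *: "abmat (c \<psi>) \<in> carrier SL2"
      have "mmul (mmul (minv (abmat \<theta>)) (abmat (c \<psi>))) (abmat \<theta>) =
          mmul (mmul (minv (abmat \<theta>)) (abmat \<theta>)) (mmul (abmat \<psi>) (mmul (minv (abmat \<theta>)) (abmat \<theta>)))"
        unfolding eq by (simp only: mmul_assoc)
      then have "abmat \<psi> = mmul (mmul (minv (abmat \<theta>)) (abmat (c \<psi>))) (abmat \<theta>)"
        by (simp only: I(2) mmul_one)
      also have "\<dots> \<in> carrier SL2" by (intro SL2_closed I(1) * \<theta>S)
      finally show "abmat \<psi> \<in> carrier SL2" .
    qed
  qed
  have quot: "A \<otimes>\<^bsub>ZZ m n\<^esub> inv\<^bsub>ZZ m n\<^esub> B = \<one>\<^bsub>ZZ m n\<^esub> \<longleftrightarrow> A = B"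
    if "A \<in> carrier (ZZ m n)" "B \<in> carrier (ZZ m n)" for A B
  proof
    assume "A \<otimes>\<^bsub>ZZ m n\<^esub> inv\<^bsub>ZZ m n\<^esub> B = \<one>\<^bsub>ZZ m n\<^esub>"
    from ZZ.inv_equality [OF this] show "A = B" using that ZZ.inv_inv ZZ.inv_closed by metis
  qed (use that ZZ.r_inv in simp)
  have fix_iff: "(\<forall>v\<in>carrier F2. \<pi> (c \<psi> v) = \<pi> v) \<longleftrightarrow>
      (\<forall>w\<in>carrier F2. int m dvd expx (\<psi> w) - expx w \<and> int n dvd expy (\<psi> w) - expy w)"
    if \<psi>: "\<psi> \<in> carrier Aut2" for \<psi>
  proof -
    have "\<theta> ` carrier F2 = carrier F2" using aut_bij [OF \<theta>c] by (simp add: bij_betw_def)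
    moreover have "(\<forall>v\<in>\<theta> ` carrier F2. \<pi> (c \<psi> v) = \<pi> v) \<longleftrightarrow> (\<forall>w\<in>carrier F2. \<pi> (c \<psi> (\<theta> w)) = \<pi> (\<theta> w))"
      by (rule ball_simps)
    ultimately have "(\<forall>v\<in>carrier F2. \<pi> (c \<psi> v) = \<pi> v) \<longleftrightarrow> (\<forall>w\<in>carrier F2. \<pi> (c \<psi> (\<theta> w)) = \<pi> (\<theta> w))"
      by (simp only:)
    also have "\<dots> \<longleftrightarrow> (\<forall>w\<in>carrier F2. int m dvd expx (\<psi> w) - expx w \<and> int n dvd expy (\<psi> w) - expy w)"
    proof (rule ball_cong [OF refl])
      fix w assume w: "w \<in> carrier F2"
      let ?z = "\<psi> w \<otimes>\<^bsub>F2\<^esub> inv\<^bsub>F2\<^esub> w"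
      have z: "?z \<in> carrier F2" using w \<psi> by simp
      have "\<pi> (\<theta> ?z) = \<pi> (\<theta> (\<psi> w)) \<otimes>\<^bsub>ZZ m n\<^esub> inv\<^bsub>ZZ m n\<^esub> \<pi> (\<theta> w)"
        using w \<psi> \<theta>c by (simp only: aut_mult aut_inv aut_closed F2.inv_closed \<pi>.hom_mult \<pi>.hom_inv)
      then have "\<pi> (c \<psi> (\<theta> w)) = \<pi> (\<theta> w) \<longleftrightarrow> \<pi> (\<theta> ?z) = \<one>\<^bsub>ZZ m n\<^esub>"
        unfolding c_apply [OF \<psi> w]
        using quot [OF \<pi>.hom_closed \<pi>.hom_closed, of "\<theta> (\<psi> w)" "\<theta> w"] w \<psi> \<theta>c by simp
      also have "\<dots> \<longleftrightarrow> int m dvd expx (\<psi> w) - expx w \<and> int n dvd expy (\<psi> w) - expy w"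
        unfolding ker [OF z] using w \<psi> by simp
      finally show "\<pi> (c \<psi> (\<theta> w)) = \<pi> (\<theta> w) \<longleftrightarrow>
        int m dvd expx (\<psi> w) - expx w \<and> int n dvd expy (\<psi> w) - expy w" .
    qed
    finally show ?thesis .
  qed
  have carrier_eq: "{\<phi> \<in> Aut_plus. \<forall>w \<in> carrier F2. \<pi> (\<phi> w) = \<pi> w} = c ` Gam m n"
  proof (intro equalityI subsetI)
    fix \<phi> assume \<phi>: "\<phi> \<in> {\<phi> \<in> Aut_plus. \<forall>w \<in> carrier F2. \<pi> (\<phi> w) = \<pi> w}"
    then obtain \<psi> where \<psi>: "\<psi> \<in> carrier Aut2" "\<phi> = c \<psi>" using c_onto [of \<phi>] by (auto simp:
        Aut_plus_iff)
    then have "\<psi> \<in> Gam m n" unfolding Gam_iff using \<phi> det fix_iff by (simp add: Aut_plus_iff)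
    then show "\<phi> \<in> c ` Gam m n" using \<psi> by blast
  next
    fix \<phi> assume "\<phi> \<in> c ` Gam m n"
    then obtain \<psi> where \<psi>: "\<psi> \<in> Gam m n" "\<phi> = c \<psi>" by blast
    then show "\<phi> \<in> {\<phi> \<in> Aut_plus. \<forall>w \<in> carrier F2. \<pi> (\<phi> w) = \<pi> w}"
      using fix_iff det c_closed unfolding Gam_iff by (simp add: Aut_plus_iff)
  qed
  have Gp: "Gamma_plus \<pi> = Aut2\<lparr>carrier := c ` Gam m n\<rparr>"
    unfolding Gamma_plus_def carrier_eq ..
  have "group (Gamma_plus \<pi>)"
    unfolding Gp using c.subgroup_img_is_subgroup [OF Gam_subgroup] Aut2.is_group
    by (rule subgroup.subgroup_is_group)
  moreover have sub: "Gam m n \<subseteq> carrier Aut2" by (auto simp: Gam_def)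
  have "c \<in> iso (GG m n) (Gamma_plus \<pi>)"
    unfolding Gp iso_iff using inj_on_subset [OF c_inj sub] by (auto intro!: homI simp: c_mult
        subsetD [OF sub])
  moreover have "group (GG m n)" by (rule group_GG)
  ultimately show ?thesis
    using abelianization_iso [of "GG m n" "Gamma_plus \<pi>" c]
      group.iso_sym [OF comm_group.axioms(2) [OF comm_group_abelianization [of "GG m n"]]] by blast
qed

lemma Delta_to_Gamma_plus:
  assumes m: "m > 0" and n: "n > 0" "n dvd m" and \<pi>: "\<pi> \<in> epi F2 (ZZ m n)"
    and c: "c \<in> hom (SL2\<lparr>carrier := Delta m n\<rparr>) (TT q r)" "c ` Delta m n = carrier (TT q r)"
      "\<And>A. A \<in> Delta m n \<Longrightarrow> c A = \<one>\<^bsub>TT q r\<^esub> \<Longrightarrow> A \<in> derived SL2 (Delta m n)"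
  shows "abelianization (Gamma_plus \<pi>) \<cong> ZZ m n \<times>\<times> (integer_mod_group q \<times>\<times> Z_power r)"
  using iso_trans [OF Gamma_plus_abelianization [OF m n \<pi>]
      gamma_abelianization [OF m n(1) comm_group_TT c]]
  by (simp add: TT_def)

section \<open>Rearranging the direct products\<close>

lemma iso_unit_left: "integer_mod_group 1 \<times>\<times> A \<cong> A"
  by (rule is_isoI [of snd]) (auto simp: iso_iff hom_def inj_on_def carrier_integer_mod_group
      mult_DirProd' image_iff)

lemma iso_unit_right: "A \<times>\<times> integer_mod_group 1 \<cong> A"
  by (rule is_isoI [of fst]) (auto simp: iso_iff hom_def inj_on_def carrier_integer_mod_group
      mult_DirProd' image_iff)

lemma iso_assoc: "(A \<times>\<times> B) \<times>\<times> C \<cong> A \<times>\<times> (B \<times>\<times> C)"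
  by (rule is_isoI [of "\<lambda>((a, b), c). (a, (b, c))"])
    (auto simp: iso_iff hom_def inj_on_def image_iff Bex_def)

lemma iso_Z_power_1: "Z_power 1 \<cong> integer_group"
proof (rule is_isoI [of "\<lambda>f. f 0"])
  have "\<exists>f\<in>{..<Suc 0} \<rightarrow>\<^sub>E (UNIV :: int set). x = f 0" for x
    by (rule bexI [of _ "\<lambda>i\<in>{..<Suc 0}. x"]) auto
  moreover have "f = f'" if "f \<in> {..<Suc 0} \<rightarrow>\<^sub>E (UNIV :: int set)" "f' \<in> {..<Suc 0} \<rightarrow>\<^sub>E UNIV" "f
      0 = f' 0" for f f'
    using that by (intro PiE_ext) auto
  ultimately show "(\<lambda>f. f 0) \<in> iso (Z_power 1) integer_group"
    by (auto simp: iso_iff Z_power_def inj_on_def image_iff intro!: homI)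
qed

text \<open>A cyclic group is the case \<open>n = 1\<close>: a second coordinate 0 is added to
  \<open>\<pi>\<close>, which leaves \<open>Gamma_plus\<close> unchanged.\<close>

lemma cyclic_case:
  assumes m: "m > 0" and \<pi>: "\<pi> \<in> epi F2 (integer_mod_group m)"
    and c: "c \<in> hom (SL2\<lparr>carrier := Delta m 1\<rparr>) (TT q 1)" "c ` Delta m 1 = carrier (TT q 1)"
      "\<And>A. A \<in> Delta m 1 \<Longrightarrow> c A = \<one>\<^bsub>TT q 1\<^esub> \<Longrightarrow> A \<in> derived SL2 (Delta m 1)"
  shows "abelianization (Gamma_plus \<pi>) \<cong> integer_mod_group m \<times>\<times> integer_mod_group q \<times>\<times> integer_group"
proof -
  define \<pi>' where "\<pi>' w = (\<pi> w, 0 :: int)" for w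
  have "\<pi>' \<in> epi F2 (ZZ m 1)"
  proof -
    have hom: "\<pi> \<in> hom F2 (integer_mod_group m)" and surj: "\<pi> ` carrier F2 = carrier
        (integer_mod_group m)"
      using \<pi> by (auto simp: epi_def)
    have "\<pi>' \<in> hom F2 (ZZ m 1)"
      using hom_in_carrier [OF hom] hom_mult [OF hom] by (intro homI) (simp_all add: \<pi>'_def)
    moreover have "\<pi>' ` carrier F2 = (\<lambda>z. (z, 0)) ` (\<pi> ` carrier F2)" by (simp add: \<pi>'_def
        image_image)
    moreover have "(\<lambda>z. (z, 0)) ` carrier (integer_mod_group m) = carrier (ZZ m 1)"
      by (auto simp: carrier_integer_mod_group)
    ultimately show ?thesis unfolding epi_def surj by simp
  qed
  from Delta_to_Gamma_plus [OF m _ _ this c]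
  have "abelianization (Gamma_plus \<pi>') \<cong> ZZ m 1 \<times>\<times> (integer_mod_group q \<times>\<times> Z_power 1)" by simp
  moreover have "Gamma_plus \<pi>' = Gamma_plus \<pi>" by (simp add: Gamma_plus_def \<pi>'_def)
  moreover have "ZZ m 1 \<times>\<times> (integer_mod_group q \<times>\<times> Z_power 1) \<cong>
      integer_mod_group m \<times>\<times> (integer_mod_group q \<times>\<times> integer_group)"
    by (intro group.DirProd_iso_trans iso_unit_right iso_Z_power_1 iso_refl DirProd_group) simp_all
  ultimately show ?thesis using iso_trans by metis
qed

theorem theorem1p1:
  shows "(\<forall>(m::nat) (n::nat) \<pi>.
            3 \<le> m \<and> 1 \<le> n \<and> n dvd m \<and> (m, n) \<noteq> (3, 1) \<and>
            \<pi> \<in> epi F2 (integer_mod_group m \<times>\<times> integer_mod_group n) \<longrightarrow>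
            (\<exists>r::nat.
               real r = 1 + real n * real m ^ 2 / 12 *
                          (\<Prod>p\<in>{p::nat. prime p \<and> p dvd m}. 1 - 1 / real p ^ 2) \<and>
               abelianization (Gamma_plus \<pi>) \<cong>
                 (integer_mod_group m \<times>\<times> integer_mod_group n) \<times>\<times> Z_power r))
       \<and> (\<forall>\<pi> \<in> epi F2 (integer_mod_group 2).
            abelianization (Gamma_plus \<pi>) \<cong>
              integer_mod_group 2 \<times>\<times> integer_mod_group 4 \<times>\<times> integer_group)
       \<and> (\<forall>\<pi> \<in> epi F2 (integer_mod_group 3).
            abelianization (Gamma_plus \<pi>) \<cong>
              integer_mod_group 3 \<times>\<times> integer_mod_group 3 \<times>\<times> integer_group)
       \<and> (\<forall>\<pi> \<in> epi F2 (integer_mod_group 2 \<times>\<times> integer_mod_group 2).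
            abelianization (Gamma_plus \<pi>) \<cong>
              integer_mod_group 2 \<times>\<times> integer_mod_group 2 \<times>\<times> integer_mod_group 2 \<times>\<times> Z_power 2)"
proof (intro conjI allI ballI impI)
  fix m n :: nat and \<pi>
  assume *: "3 \<le> m \<and> 1 \<le> n \<and> n dvd m \<and> (m, n) \<noteq> (3, 1) \<and>
    \<pi> \<in> epi F2 (integer_mod_group m \<times>\<times> integer_mod_group n)"
  then have pos: "m > 0" "n > 0" "n dvd m" and \<pi>: "\<pi> \<in> epi F2 (ZZ m n)" by auto
  interpret free_orbit m n using * by unfold_locales auto
  obtain r c where r: "12 * r = card (orb m n) + 12"
    and c: "c \<in> hom (SL2\<lparr>carrier := Delta m n\<rparr>) (TT 1 r)" "c ` Delta m n = carrier (TT 1 r)"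
      "\<And>A. A \<in> Delta m n \<Longrightarrow> c A = \<one>\<^bsub>TT 1 r\<^esub> \<Longrightarrow> A \<in> derived SL2 (Delta m n)"
    using free_abelianization by blast
  have "12 * real r = real (card (orb m n)) + 12" using arg_cong [OF r, of real] by simp
  then have "real r = 1 + real n * real m ^ 2 / 12 * (\<Prod>p\<in>{p::nat. prime p \<and> p dvd m}. 1 - 1 /
      real p ^ 2)"
    unfolding card_orb [OF pos] by simp
  moreover have "abelianization (Gamma_plus \<pi>) \<cong> ZZ m n \<times>\<times> (integer_mod_group 1 \<times>\<times> Z_power r)"
    by (rule Delta_to_Gamma_plus [OF pos \<pi> c])
  moreover have "ZZ m n \<times>\<times> (integer_mod_group 1 \<times>\<times> Z_power r) \<cong> ZZ m n \<times>\<times> Z_power r"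
    by (intro group.DirProd_iso_trans iso_unit_left iso_refl DirProd_group) simp_all
  ultimately show "\<exists>r::nat. real r = 1 + real n * real m ^ 2 / 12 *
        (\<Prod>p\<in>{p::nat. prime p \<and> p dvd m}. 1 - 1 / real p ^ 2) \<and>
      abelianization (Gamma_plus \<pi>) \<cong> ZZ m n \<times>\<times> Z_power r"
    using iso_trans by blast
next
  fix \<pi> assume \<pi>: "\<pi> \<in> epi F2 (integer_mod_group 2)"
  show "abelianization (Gamma_plus \<pi>) \<cong> integer_mod_group 2 \<times>\<times> integer_mod_group 4 \<times>\<times> integer_group"
    by (rule Delta_2_1, rule cyclic_case [OF _ \<pi>]) simp_all
next
  fix \<pi> assume \<pi>: "\<pi> \<in> epi F2 (integer_mod_group 3)"
  show "abelianization (Gamma_plus \<pi>) \<cong> integer_mod_group 3 \<times>\<times> integer_mod_group 3 \<times>\<times> integer_group"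
    by (rule Delta_3_1, rule cyclic_case [OF _ \<pi>]) simp_all
next
  fix \<pi> assume \<pi>: "\<pi> \<in> epi F2 (integer_mod_group 2 \<times>\<times> integer_mod_group 2)"
  have "abelianization (Gamma_plus \<pi>) \<cong> ZZ 2 2 \<times>\<times> (integer_mod_group 2 \<times>\<times> Z_power 2)"
    by (rule Delta_2_2, rule Delta_to_Gamma_plus [OF _ _ _ \<pi>]) simp_all
  then show "abelianization (Gamma_plus \<pi>) \<cong>
      integer_mod_group 2 \<times>\<times> integer_mod_group 2 \<times>\<times> integer_mod_group 2 \<times>\<times> Z_power 2"
    by (rule iso_trans [OF _ iso_assoc])
qed

end
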